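(* Let $b\ge 2$ and let $A=K[[x,y,z]]/I$ be a local ring of type $(2,b)$ with maximal ideal $\mathfrak m$. Then the associated graded ring $gr_{\mathfrak m}(A)=\bigoplus_{t\ge0}\mathfrak m^t/\mathfrak m^{t+1}$ is Cohen-Macaulay if and only if the Hilbert function $HF_A$ is strictly increasing.
   Context: $K$ is an algebraically closed field of characteristic zero, $R=K[[x,y,z]]$ with maximal ideal $\mathcal M=(x,y,z)$, $P=K[x,y,z]$. For nonzero $f\in R$, $\operatorname{order}(f)$ is the least degree $v$ of a monomial appearing in $f$, and $f^*\in P$ is the homogeneous component of degree $v$ of $f$ (its initial form). $A=R/I$ is of type $(a,b)$, $2\le a\le b$, if $I$ is generated by a regular sequence $\{f,g\}$ with $\operatorname{order}(f)=a$, $\operatorname{order}(g)=b$, $g^*\notin(f^* )$ (ideal of $P$). With $\mathfrak m=\mathcal M/I$, $HF_A(t)=\dim_K(\mathfrak m^t/\mathfrak m^{t+1})$. Such $A$ is one-dimensional Cohen-Macaulay; its multiplicity $e$ is the value of $HF_A(t)$ for all large $t$. Let $r$ be the least integer with $HF_A(r)=e$. $HF_A$ is strictly increasing if $HF_A(n)<HF_A(n+1)$ for all $n=0,\dots,r-1$. *)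

theory Defs
  imports
    "HOL-Algebra.Algebraic_Closure_Type"
    "HOL-Algebra.Embedded_Algebras"
    "HOL-Algebra.Ideal_Product"
    "HOL-Algebra.QuotRing"
    "HOL-Algebra.Ring_Divisibility"
    "HOL-Computational_Algebra.Computational_Algebra"
    "HOL-Library.Extended_Nat"
begin

section \<open>Regular sequences and Cohen--Macaulay rings\<close>

text \<open>The second conjunct says that \<open>xs ! i\<close> is a nonzerodivisor on
  \<open>R/(xs ! 0, \<dots>, xs ! (i - 1))\<close>.\<close>

definition regular_sequence :: "('a, 'b) ring_scheme \<Rightarrow> 'a list \<Rightarrow> bool" where
  "regular_sequence R xs \<longleftrightarrow>
     set xs \<subseteq> carrier R \<and>
     (\<forall>i<length xs. \<forall>a\<in>carrier R.
        xs ! i \<otimes>\<^bsub>R\<^esub> a \<in> Idl\<^bsub>R\<^esub> (set (take i xs)) \<longrightarrow> a \<in> Idl\<^bsub>R\<^esub> (set (take i xs))) \<and>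
     Idl\<^bsub>R\<^esub> (set xs) \<noteq> carrier R"

definition ideal_depth :: "('a, 'b) ring_scheme \<Rightarrow> 'a set \<Rightarrow> enat" where
  "ideal_depth R J = Sup {enat (length xs) | xs. regular_sequence R xs \<and> set xs \<subseteq> J}"

definition prime_height :: "('a, 'b) ring_scheme \<Rightarrow> 'a set \<Rightarrow> enat" where
  "prime_height R P = Sup {enat n | n. \<exists>p. p n = P \<and>
     (\<forall>i\<le>n. primeideal (p i) R) \<and> (\<forall>i<n. p i \<subset> p (Suc i))}"

text \<open>This is Eisenbud's definition (Commutative Algebra with a View Toward Algebraic Geometry,
  Section 18.2): a Noetherian ring is Cohen--Macaulay if depth equals codimension for every
  maximal ideal, not only for the irrelevant one when the ring is graded.\<close>

definition cohen_macaulay_ring :: "('a, 'b) ring_scheme \<Rightarrow> bool" where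
  "cohen_macaulay_ring R \<longleftrightarrow> cring R \<and> noetherian_ring R \<and>
     (\<forall>M. maximalideal M R \<longrightarrow> ideal_depth R M = prime_height R M)"

section \<open>Associated graded rings and Hilbert functions\<close>

abbreviation ideal_pow :: "('a, 'b) ring_scheme \<Rightarrow> 'a set \<Rightarrow> nat \<Rightarrow> 'a set" where
  "ideal_pow A m t \<equiv> m [^]\<^bsub>ideals_set A\<^esub> t"

text \<open>\<open>m\<^sup>t/m\<^sup>t\<^sup>+\<^sup>1\<close>, as a subset of \<open>A/m\<^sup>t\<^sup>+\<^sup>1\<close>.\<close>

definition graded_piece :: "('a, 'b) ring_scheme \<Rightarrow> 'a set \<Rightarrow> nat \<Rightarrow> 'a set set" where
  "graded_piece A m t = (\<lambda>a. ideal_pow A m (Suc t) +>\<^bsub>A\<^esub> a) ` ideal_pow A m t"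

text \<open>Elements of the direct sum are families of cosets \<open>u t \<in> m\<^sup>t/m\<^sup>t\<^sup>+\<^sup>1\<close>, almost all zero. The
  product of \<open>a + m\<^sup>i\<^sup>+\<^sup>1\<close> and \<open>b + m\<^sup>j\<^sup>+\<^sup>1\<close> with \<open>i + j = n\<close> is \<open>ab + m\<^sup>n\<^sup>+\<^sup>1\<close>, which is what
  \<^const>\<open>rcoset_mult\<close> modulo \<open>m\<^sup>n\<^sup>+\<^sup>1\<close> gives on these two sets.\<close>

definition assoc_graded_ring :: "('a, 'b) ring_scheme \<Rightarrow> 'a set \<Rightarrow> (nat \<Rightarrow> 'a set) ring" where
  "assoc_graded_ring A m =
     \<lparr>carrier = {u. (\<forall>t. u t \<in> graded_piece A m t) \<and> finite {t. u t \<noteq> ideal_pow A m (Suc t)}},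
      monoid.mult = (\<lambda>u v n. finsum (A Quot ideal_pow A m (Suc n))
        (\<lambda>i. rcoset_mult A (ideal_pow A m (Suc n)) (u i) (v (n - i))) {..n}),
      one = (\<lambda>t. if t = 0 then ideal_pow A m 1 +>\<^bsub>A\<^esub> \<one>\<^bsub>A\<^esub> else ideal_pow A m (Suc t)),
      ring.zero = (\<lambda>t. ideal_pow A m (Suc t)),
      add = (\<lambda>u v t. u t <+>\<^bsub>A\<^esub> v t)\<rparr>"

text \<open>Here \<open>k\<close> is a coefficient field of \<open>A\<close>; it acts on \<open>m\<^sup>t/m\<^sup>t\<^sup>+\<^sup>1\<close> through its image
  in \<open>A/m\<^sup>t\<^sup>+\<^sup>1\<close>.\<close>

definition hilbert_function :: "('a, 'b) ring_scheme \<Rightarrow> 'a set \<Rightarrow> 'a set \<Rightarrow> nat \<Rightarrow> nat" where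
  "hilbert_function A m k t =
     ring.dim (A Quot ideal_pow A m (Suc t))
       ((\<lambda>c. ideal_pow A m (Suc t) +>\<^bsub>A\<^esub> c) ` k) (graded_piece A m t)"

text \<open>The next three definitions are meant for functions that are eventually constant.\<close>

definition eventual_value :: "(nat \<Rightarrow> nat) \<Rightarrow> nat" where
  "eventual_value H = (THE e. \<forall>\<^sub>F t in sequentially. H t = e)"

definition first_attained :: "(nat \<Rightarrow> nat) \<Rightarrow> nat" where
  "first_attained H = (LEAST r. H r = eventual_value H)"

definition strictly_increasing_HF :: "(nat \<Rightarrow> nat) \<Rightarrow> bool" where
  "strictly_increasing_HF H \<longleftrightarrow> (\<forall>n<first_attained H. H n < H (Suc n))"

section \<open>The rings \<open>K[[x,y,z]]\<close> and \<open>K[x,y,z]\<close>\<close>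

text \<open>Both are iterated: \<open>x\<close> is the innermost variable and \<open>z\<close> the outermost one.\<close>

type_synonym 'k ps3 = "'k fps fps fps"
type_synonym 'k poly3 = "'k poly poly poly"

abbreviation ps3_ring :: "'k::field ps3 ring" where
  "ps3_ring \<equiv> ring_of_type_algebra"

abbreviation poly3_ring :: "'k::field poly3 ring" where
  "poly3_ring \<equiv> ring_of_type_algebra"

definition ps3_coeff :: "'k::field ps3 \<Rightarrow> nat \<Rightarrow> nat \<Rightarrow> nat \<Rightarrow> 'k" where
  "ps3_coeff f i j l = fps_nth (fps_nth (fps_nth f l) j) i"

definition ps3_const :: "'k::field \<Rightarrow> 'k ps3" where
  "ps3_const c = fps_const (fps_const (fps_const c))"

definition ps3_max_ideal :: "'k::field ps3 set" where
  "ps3_max_ideal = Idl\<^bsub>ps3_ring\<^esub> {fps_const (fps_const fps_X), fps_const fps_X, fps_X}"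

definition poly3_monom :: "'k::field \<Rightarrow> nat \<Rightarrow> nat \<Rightarrow> nat \<Rightarrow> 'k poly3" where
  "poly3_monom c i j l = Polynomial.monom (Polynomial.monom (Polynomial.monom c i) j) l"

text \<open>Only meaningful for nonzero \<open>f\<close>.\<close>

definition ps3_order :: "'k::field ps3 \<Rightarrow> nat" where
  "ps3_order f = (LEAST v. \<exists>i j l. i + j + l = v \<and> ps3_coeff f i j l \<noteq> 0)"

definition initial_form :: "'k::field ps3 \<Rightarrow> 'k poly3" where
  "initial_form f =
     (\<Sum>(i, j, l) \<in> {(i, j, l). i + j + l = ps3_order f}. poly3_monom (ps3_coeff f i j l) i j l)"

section \<open>Local rings of type \<open>(a, b)\<close>\<close>

definition ideal_of_type :: "nat \<Rightarrow> nat \<Rightarrow> 'k::field ps3 set \<Rightarrow> bool" where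
  "ideal_of_type a b I \<longleftrightarrow> 2 \<le> a \<and> a \<le> b \<and>
     (\<exists>f g. f \<noteq> 0 \<and> g \<noteq> 0 \<and> regular_sequence ps3_ring [f, g] \<and> I = Idl\<^bsub>ps3_ring\<^esub> {f, g} \<and>
        ps3_order f = a \<and> ps3_order g = b \<and>
        initial_form g \<notin> PIdl\<^bsub>poly3_ring\<^esub> (initial_form f))"

abbreviation quot_max_ideal :: "'k::field ps3 set \<Rightarrow> 'k ps3 set set" where
  "quot_max_ideal I \<equiv> (\<lambda>f. I +>\<^bsub>ps3_ring\<^esub> f) ` ps3_max_ideal"

definition quot_HF :: "'k::field ps3 set \<Rightarrow> nat \<Rightarrow> nat" where
  "quot_HF I = hilbert_function (ps3_ring Quot I) (quot_max_ideal I)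
     ((\<lambda>c. I +>\<^bsub>ps3_ring\<^esub> ps3_const c) ` UNIV)"

end

theory Submission
  imports Defs "HOL-Library.Set_Algebras"
begin

text \<open>Let \<open>I = (f, g)\<close> and \<open>A = K[[x,y,z]]/I\<close>. After a change of coordinates \<open>f\<close> is regular of order
  \<open>2\<close> in \<open>x\<close>, so \<open>K[[x,y,z]]/(f)\<close> is free of rank \<open>2\<close> over \<open>K[[y,z]]\<close>, and the norm \<open>h\<close> of \<open>g\<close> lies in
  \<open>I\<close>. A linear form \<open>l\<close> that avoids the finitely many tangent lines of \<open>h\<close> and of \<open>g\<close> is then a
  nonzerodivisor on \<open>A\<close> with \<open>m\<^sup>N\<^sup>+\<^sup>1 = l m\<^sup>N\<close> for large \<open>N\<close>, and \<open>l : m\<^sup>n\<^sup>-\<^sup>1/m\<^sup>n \<rightarrow> m\<^sup>n/m\<^sup>n\<^sup>+\<^sup>1\<close> has corank at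
  most \<open>1\<close> for \<open>n \<ge> b\<close> and is injective for \<open>n < b\<close>, because in those degrees the tangent cone is
  cut out by the initial form of \<open>f\<close> alone.

  Since \<open>dim (m\<^sup>n/l m\<^sup>n)\<close> does not depend on \<open>n\<close>, the Hilbert function takes its eventual value at \<open>n\<close>
  exactly if \<open>m\<^sup>n\<^sup>+\<^sup>1 = l m\<^sup>n\<close>, and then \<open>l\<close> is bijective from degree \<open>n\<close> on. If the Hilbert function is
  strictly increasing, the corank bound forces \<open>l\<close> to be injective on the whole associated graded
  ring, which is therefore a finite torsion-free algebra over \<open>K[l]\<close>; such an algebra is
  Cohen--Macaulay. Conversely, if \<open>l\<close> is not injective, an element of largest degree in its kernel is
  annihilated by the irrelevant ideal, which then contains no nonzerodivisor although its height is
  positive; and if \<open>l\<close> is injective, then the Hilbert function cannot repeat a value before it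
  becomes constant.\<close>

section \<open>Prime ideals\<close>

text \<open>The corank bound is where order 2 of f enters. In coordinates with l = y, K[[x,y,z]]/(f)
  has basis 1, x over K[[y,z]], so modulo y and higher order the degree n part is spanned by the two
  classes of z^n and x z^(n-1). From n = b on, the leading part of g modulo f is a relation between
  them, nontrivial because the initial form of g is not a multiple of that of f and because l is
  chosen off finitely many directions. With nullity k and corank c of l from degree n to n+1,
  HF(n+1) - HF(n) = c - k; a positive difference together with c \<le> 1 leaves k = 0.

  Cohen-Macaulayness is tested at every maximal ideal of the graded ring, also at inhomogeneous
  ones, where the grading gives no help. Hence the detour through finite torsion-free K[t]-algebras:
  there every maximal ideal contains a nonzero polynomial in t, and integral equations give depth
  and height 1 uniformly.

  Characteristic zero supplies infinitely many directions for l and the exponential form of the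
  substitution that turns l into a coordinate.\<close>

context cring begin

lemma ideal_add_cgenideal:
  assumes "ideal J R" "a \<in> carrier R"
  shows "ideal (J <+>\<^bsub>R\<^esub> PIdl a) R" "J \<subseteq> J <+>\<^bsub>R\<^esub> PIdl a" "a \<in> J <+>\<^bsub>R\<^esub> PIdl a"
    and "x \<in> J <+>\<^bsub>R\<^esub> PIdl a \<longleftrightarrow> (\<exists>j\<in>J. \<exists>r\<in>carrier R. x = j \<oplus> a \<otimes> r)"
proof -
  interpret J: ideal J R by fact
  show "ideal (J <+>\<^bsub>R\<^esub> PIdl a) R"
    using add_ideals assms cgenideal_ideal by blast
  show iff: "x \<in> J <+>\<^bsub>R\<^esub> PIdl a \<longleftrightarrow> (\<exists>j\<in>J. \<exists>r\<in>carrier R. x = j \<oplus> a \<otimes> r)" for x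
    unfolding set_add_def' cgenideal_def using assms(2) m_comm by fastforce
  show "J \<subseteq> J <+>\<^bsub>R\<^esub> PIdl a"
  proof
    fix j assume "j \<in> J"
    then have "j = j \<oplus> a \<otimes> \<zero>" using assms(2) J.Icarr by simp
    then show "j \<in> J <+>\<^bsub>R\<^esub> PIdl a" unfolding iff using \<open>j \<in> J\<close> by blast
  qed
  have "a = \<zero> \<oplus> a \<otimes> \<one>" using assms(2) by simp
  then show "a \<in> J <+>\<^bsub>R\<^esub> PIdl a" unfolding iff using J.zero_closed by blast
qed

lemma genideal_empty: "Idl {} = {\<zero>}"
  using genideal_minimal[OF zeroideal, of "{}"] ideal.axioms(1)[OF genideal_ideal[of "{}"]]
    additive_subgroup.zero_closed by blast

text \<open>An ideal maximal among those missing \<open>S\<close> is prime: if \<open>a\<close> and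
  \<open>b\<close> lie outside it, adjoining either one meets \<open>S\<close>, and the product of
  the two meeting points is again in \<open>S\<close>. Both lower bounds for heights use it, with
  \<open>S\<close> containing the complement of the larger prime and one element of that
  prime.\<close>

lemma exists_primeideal_disjoint:
  assumes S: "S \<subseteq> carrier R" "\<one> \<in> S" "\<zero> \<notin> S"
    and mult: "\<And>a b. a \<in> S \<Longrightarrow> b \<in> S \<Longrightarrow> a \<otimes> b \<in> S"
  shows "\<exists>P. primeideal P R \<and> P \<inter> S = {}"
proof -
  define \<A> where "\<A> = {J. ideal J R \<and> J \<inter> S = {}}"
  have "\<exists>P\<in>\<A>. \<forall>Y\<in>\<A>. P \<subseteq> Y \<longrightarrow> Y = P"
  proof (rule subset_Zorn_nonempty)
    show "\<A> \<noteq> {}" unfolding \<A>_def using zeroideal S(3) by blast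
    fix C assume C: "C \<noteq> {}" "subset.chain \<A> C"
    then have "subset.chain {I. ideal I R} C"
      unfolding pred_on.chain_def \<A>_def by blast
    from chain_Union_is_ideal[OF this] C(1) have "ideal (\<Union>C) R" by simp
    moreover have "\<Union>C \<inter> S = {}" using C(2) unfolding pred_on.chain_def \<A>_def by blast
    ultimately show "\<Union>C \<in> \<A>" unfolding \<A>_def by blast
  qed
  then obtain P where "P \<in> \<A>" and "\<forall>Y\<in>\<A>. P \<subseteq> Y \<longrightarrow> Y = P" ..
  then have P: "ideal P R" "P \<inter> S = {}"
    and max: "\<And>Y. ideal Y R \<Longrightarrow> Y \<inter> S = {} \<Longrightarrow> P \<subseteq> Y \<Longrightarrow> Y = P"
    by (simp_all add: \<A>_def)
  interpret P: ideal P R by fact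
  have meets: "\<exists>p\<in>P. \<exists>r\<in>carrier R. p \<oplus> a \<otimes> r \<in> S" if "a \<in> carrier R" "a \<notin> P" for a
  proof -
    have "(P <+>\<^bsub>R\<^esub> PIdl a) \<inter> S \<noteq> {}"
      using max[OF ideal_add_cgenideal(1)[OF P(1) that(1)]] ideal_add_cgenideal(2,3)[OF P(1) that(1)]
        that(2) by blast
    then obtain s where "s \<in> P <+>\<^bsub>R\<^esub> PIdl a" "s \<in> S" by blast
    with ideal_add_cgenideal(4)[OF P(1) that(1), of s] show ?thesis by auto
  qed
  have "primeideal P R"
  proof (rule primeidealI[OF P(1) is_cring])
    show "carrier R \<noteq> P" using P(2) S by blast
    fix a b assume ab: "a \<in> carrier R" "b \<in> carrier R" "a \<otimes> b \<in> P"
    show "a \<in> P \<or> b \<in> P"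
    proof (rule ccontr)
      assume "\<not> (a \<in> P \<or> b \<in> P)"
      with meets ab obtain p q r s where
        "p \<in> P" "r \<in> carrier R" "p \<oplus> a \<otimes> r \<in> S" "q \<in> P" "s \<in> carrier R" "q \<oplus> b \<otimes> s \<in> S"
        by metis
      note * = this
      have "p \<in> carrier R" "q \<in> carrier R" using * P.Icarr by auto
      then have "(p \<oplus> a \<otimes> r) \<otimes> (q \<oplus> b \<otimes> s) = (q \<oplus> b \<otimes> s) \<otimes> p \<oplus> (a \<otimes> r) \<otimes> q \<oplus> (r \<otimes> s) \<otimes> (a \<otimes> b)"
        using * ab by algebra
      moreover have "\<dots> \<in> P"
        using * ab P.I_l_closed P.a_closed \<open>q \<in> carrier R\<close> by auto
      ultimately show False using mult[OF *(3) *(6)] P(2) by auto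
    qed
  qed
  with P(2) show ?thesis by blast
qed

end

section \<open>Modules over a polynomial ring in one variable\<close>

definition pmodule :: "('a, 'b) ring_scheme \<Rightarrow> ('k::field poly \<Rightarrow> 'a) \<Rightarrow> 'a set \<Rightarrow> bool" where
  "pmodule R e U \<longleftrightarrow> U \<subseteq> carrier R \<and> \<zero>\<^bsub>R\<^esub> \<in> U \<and> (\<forall>u\<in>U. \<forall>v\<in>U. u \<oplus>\<^bsub>R\<^esub> v \<in> U) \<and>
     (\<forall>p. \<forall>u\<in>U. e p \<otimes>\<^bsub>R\<^esub> u \<in> U)"

text \<open>Starting from \<open>J\<close> instead of zero lets one definition serve spans modulo an
  ideal. Peeling off one generator at a time matches the induction in the Noetherian argument
  below.\<close>

fun pspan :: "('a, 'b) ring_scheme \<Rightarrow> ('k::field poly \<Rightarrow> 'a) \<Rightarrow> 'a set \<Rightarrow> 'a list \<Rightarrow> 'a set" where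
  "pspan R e J [] = J"
| "pspan R e J (g # gs) = {e c \<otimes>\<^bsub>R\<^esub> g \<oplus>\<^bsub>R\<^esub> v | c v. v \<in> pspan R e J gs}"

locale palgebra = cring R for R (structure) +
  fixes e :: "'k::field poly \<Rightarrow> 'a"
  assumes e_closed [simp]: "e p \<in> carrier R"
    and e_add: "e (p + q) = e p \<oplus> e q"
    and e_mult: "e (p * q) = e p \<otimes> e q"
    and e_one: "e 1 = \<one>"
begin

lemma e_zero: "e 0 = \<zero>"
proof -
  have "e 0 \<oplus> e 0 = e 0" using e_add[of 0 0] by simp
  then show ?thesis by (metis add.r_cancel_one e_closed)
qed

lemma e_uminus: "e (- p) = \<ominus> e p"
  using e_add[of "- p" p] e_zero by (metis add.left_inverse e_closed minus_equality)

lemma pmodule_uminus: "pmodule R e U \<Longrightarrow> u \<in> U \<Longrightarrow> \<ominus> u \<in> U"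
proof -
  assume a: "pmodule R e U" "u \<in> U"
  then have "u \<in> carrier R" by (auto simp: pmodule_def)
  then have "\<ominus> u = e (- 1) \<otimes> u" by (simp add: e_uminus e_one l_minus)
  with a show ?thesis by (simp add: pmodule_def)
qed

lemma pmodule_minus: "pmodule R e U \<Longrightarrow> u \<in> U \<Longrightarrow> v \<in> U \<Longrightarrow> u \<ominus> v \<in> U"
  unfolding a_minus_def using pmodule_uminus by (auto simp: pmodule_def)

lemma ideal_pmodule: "ideal J R \<Longrightarrow> pmodule R e J"
proof -
  assume "ideal J R"
  then interpret ideal J R .
  show ?thesis unfolding pmodule_def using I_l_closed a_subset by auto
qed

lemma pspan_pmodule:
  assumes "pmodule R e J" "set gs \<subseteq> carrier R"
  shows "pmodule R e (pspan R e J gs) \<and> J \<subseteq> pspan R e J gs \<and> set gs \<subseteq> pspan R e J gs"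
  using assms(2)
proof (induction gs)
  case Nil
  then show ?case using assms by simp
next
  case (Cons g gs)
  then have g: "g \<in> carrier R" and IH: "pmodule R e (pspan R e J gs)"
    "J \<subseteq> pspan R e J gs" "set gs \<subseteq> pspan R e J gs" by auto
  have sub: "pspan R e J gs \<subseteq> pspan R e J (g # gs)"
  proof
    fix v assume v: "v \<in> pspan R e J gs"
    then have "v \<in> carrier R" using IH(1) by (auto simp: pmodule_def)
    then have "v = e 0 \<otimes> g \<oplus> v" by (simp add: g e_zero)
    with v show "v \<in> pspan R e J (g # gs)" by auto
  qed
  have 0: "\<zero> \<in> pspan R e J gs" using IH(1) by (simp add: pmodule_def)
  have "g = e 1 \<otimes> g \<oplus> \<zero>" by (simp add: g e_one)
  then have gin: "g \<in> pspan R e J (g # gs)" using 0 by auto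
  have c: "v \<in> carrier R" if "v \<in> pspan R e J gs" for v
    using that IH(1) by (auto simp: pmodule_def)
  have "pmodule R e (pspan R e J (g # gs))"
    unfolding pmodule_def
  proof (intro conjI ballI allI)
    show "pspan R e J (g # gs) \<subseteq> carrier R" using c g by auto
    show "\<zero> \<in> pspan R e J (g # gs)" using sub 0 by blast
    fix u assume "u \<in> pspan R e J (g # gs)"
    then obtain a x where u: "u = e a \<otimes> g \<oplus> x" "x \<in> pspan R e J gs" by auto
    { fix v assume "v \<in> pspan R e J (g # gs)"
      then obtain b y where v: "v = e b \<otimes> g \<oplus> y" "y \<in> pspan R e J gs" by auto
      have "u \<oplus> v = e (a + b) \<otimes> g \<oplus> (x \<oplus> y)"
        unfolding u v e_add using g c[OF u(2)] c[OF v(2)] e_closed[of a] e_closed[of b] by algebra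
      moreover have "x \<oplus> y \<in> pspan R e J gs" using u v IH(1) by (simp add: pmodule_def)
      ultimately show "u \<oplus> v \<in> pspan R e J (g # gs)" by auto }
    fix p
    have "e p \<otimes> u = e (p * a) \<otimes> g \<oplus> e p \<otimes> x"
      unfolding u e_mult using g c[OF u(2)] e_closed[of a] e_closed[of p] by algebra
    moreover have "e p \<otimes> x \<in> pspan R e J gs" using u IH(1) by (simp add: pmodule_def)
    ultimately show "e p \<otimes> u \<in> pspan R e J (g # gs)" by auto
  qed
  then show ?case using sub IH gin by auto
qed

lemma pspan_minimal:
  assumes "pmodule R e W" "J \<subseteq> W" "set gs \<subseteq> W"
  shows "pspan R e J gs \<subseteq> W"
  using assms by (induction gs) (auto simp: pmodule_def)

lemma poly_ideal_generator:
  fixes L :: "'k poly set"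
  assumes "0 \<in> L" "\<And>p q. p \<in> L \<Longrightarrow> q \<in> L \<Longrightarrow> p + q \<in> L" "\<And>p q. p \<in> L \<Longrightarrow> q * p \<in> L"
  shows "\<exists>d\<in>L. \<forall>p\<in>L. d dvd p"
proof (cases "L \<subseteq> {0}")
  case True
  then show ?thesis using assms(1) by blast
next
  case False
  define n where "n = (LEAST n. \<exists>p\<in>L. p \<noteq> 0 \<and> degree p = n)"
  have "\<exists>n. \<exists>p\<in>L. p \<noteq> 0 \<and> degree p = n" using False by blast
  from LeastI_ex[OF this] obtain d where d: "d \<in> L" "d \<noteq> 0" "degree d = n"
    unfolding n_def by blast
  have "d dvd p" if "p \<in> L" for p
  proof (rule ccontr)
    assume n: "\<not> d dvd p"
    then have "p mod d \<noteq> 0" by (simp add: dvd_eq_mod_eq_0)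
    moreover have "p mod d = p + (- (p div d)) * d" by (simp add: minus_div_mult_eq_mod)
    then have "p mod d \<in> L" using assms(2)[OF that assms(3)[OF d(1)]] by metis
    ultimately have "n \<le> degree (p mod d)" unfolding n_def by (intro Least_le) blast
    then show False using degree_mod_less'[of d p] d \<open>p mod d \<noteq> 0\<close> by auto
  qed
  with d show ?thesis by blast
qed

text \<open>The coefficients at the first generator \<open>g\<close> that occur in elements of
  \<open>U\<close> form an ideal of K[t], hence are the multiples of some \<open>d\<close>. One
  element of \<open>U\<close> with coefficient \<open>d\<close> reduces all others into the span of
  the remaining generators, where induction applies. Generation is phrased through all submodules
  \<open>W\<close> above \<open>J\<close> and \<open>A\<close>, which spares an enumeration of
  \<open>A\<close>.\<close>

lemma pmodule_finitely_generated:
  assumes "pmodule R e J" "set gs \<subseteq> carrier R"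
    and "pmodule R e U" "J \<subseteq> U" "U \<subseteq> pspan R e J gs"
  shows "\<exists>A\<subseteq>U. finite A \<and> (\<forall>W. pmodule R e W \<longrightarrow> J \<subseteq> W \<longrightarrow> A \<subseteq> W \<longrightarrow> U \<subseteq> W)"
  using assms(2-)
proof (induction gs arbitrary: U)
  case Nil
  then show ?case by (intro exI[of _ "{}"]) auto
next
  case (Cons g gs)
  let ?P = "pspan R e J gs"
  have g: "g \<in> carrier R" and gs: "set gs \<subseteq> carrier R" using Cons.prems by auto
  note P = pspan_pmodule[OF assms(1) gs]
  have cP: "v \<in> carrier R" if "v \<in> ?P" for v using that P by (auto simp: pmodule_def)
  have "pmodule R e (U \<inter> ?P)" using Cons.prems(2) P unfolding pmodule_def by auto
  from Cons.IH[OF gs this] P Cons.prems obtain A where A: "A \<subseteq> U \<inter> ?P" "finite A"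
    "\<And>W. pmodule R e W \<Longrightarrow> J \<subseteq> W \<Longrightarrow> A \<subseteq> W \<Longrightarrow> U \<inter> ?P \<subseteq> W" by auto
  define L where "L = {c. \<exists>v\<in>?P. e c \<otimes> g \<oplus> v \<in> U}"
  have "\<exists>d\<in>L. \<forall>p\<in>L. d dvd p"
  proof (rule poly_ideal_generator)
    have "e 0 \<otimes> g \<oplus> \<zero> \<in> U" using g Cons.prems(2) by (simp add: e_zero pmodule_def)
    then show "0 \<in> L" unfolding L_def using P by (auto simp: pmodule_def)
    fix p q assume "p \<in> L"
    then obtain v where v: "v \<in> ?P" "e p \<otimes> g \<oplus> v \<in> U" unfolding L_def by blast
    { assume "q \<in> L"
      then obtain w where w: "w \<in> ?P" "e q \<otimes> g \<oplus> w \<in> U" unfolding L_def by blast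
      have "e (p + q) \<otimes> g \<oplus> (v \<oplus> w) = (e p \<otimes> g \<oplus> v) \<oplus> (e q \<otimes> g \<oplus> w)"
        unfolding e_add using g cP[OF v(1)] cP[OF w(1)] e_closed[of p] e_closed[of q] by algebra
      also have "\<dots> \<in> U" using v w Cons.prems(2) by (simp add: pmodule_def)
      finally show "p + q \<in> L" unfolding L_def using v w P by (auto simp: pmodule_def) }
    have "e (q * p) \<otimes> g \<oplus> (e q \<otimes> v) = e q \<otimes> (e p \<otimes> g \<oplus> v)"
      unfolding e_mult using g cP[OF v(1)] e_closed[of p] e_closed[of q] by algebra
    also have "\<dots> \<in> U" using v Cons.prems(2) by (simp add: pmodule_def)
    finally show "q * p \<in> L" unfolding L_def using v P by (auto simp: pmodule_def)
  qed
  then obtain d v where d: "\<And>p. p \<in> L \<Longrightarrow> d dvd p" "v \<in> ?P" "e d \<otimes> g \<oplus> v \<in> U"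
    unfolding L_def by blast
  let ?u = "e d \<otimes> g \<oplus> v"
  show ?case
  proof (intro exI[of _ "insert ?u A"] conjI allI impI subsetI)
    fix W u assume W: "pmodule R e W" "J \<subseteq> W" "insert ?u A \<subseteq> W" and u: "u \<in> U"
    then have sub: "U \<inter> ?P \<subseteq> W" using A(3) by blast
    obtain c w where cw: "u = e c \<otimes> g \<oplus> w" "w \<in> ?P" using u Cons.prems(4) by auto
    then have "c \<in> L" unfolding L_def using u by blast
    then obtain k where k: "c = k * d" using d(1) by (metis dvd_def mult.commute)
    have "u \<ominus> e k \<otimes> ?u = w \<ominus> e k \<otimes> v"
      unfolding cw k e_mult using g cP[OF cw(2)] cP[OF d(2)] e_closed[of k] e_closed[of d] by algebra
    moreover have "w \<ominus> e k \<otimes> v \<in> ?P"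
      using pmodule_minus[of ?P] P cw(2) d(2) by (simp add: pmodule_def)
    moreover have "u \<ominus> e k \<otimes> ?u \<in> U"
      using pmodule_minus[OF Cons.prems(2)] u d(3) Cons.prems(2) by (simp add: pmodule_def)
    ultimately have "u \<ominus> e k \<otimes> ?u \<in> W" using sub by auto
    moreover have "e k \<otimes> ?u \<in> W" using W by (auto simp: pmodule_def)
    ultimately have "(u \<ominus> e k \<otimes> ?u) \<oplus> e k \<otimes> ?u \<in> W" using W(1) by (auto simp: pmodule_def)
    moreover have "u \<in> carrier R" "e k \<otimes> ?u \<in> carrier R"
      using u Cons.prems(2) g cP[OF d(2)] by (auto simp: pmodule_def)
    then have "(u \<ominus> e k \<otimes> ?u) \<oplus> e k \<otimes> ?u = u"
      by algebra
    ultimately show "u \<in> W" by simp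
  qed (use A d in auto)
qed

text \<open>The increasing modules spanned by \<open>J\<close> and \<open>1, w, \<dots>, w\<^sup>m\<^sup>-\<^sup>1\<close> become stationary, so \<open>w\<close> is
  integral modulo \<open>J\<close>.\<close>

lemma integral_mod:
  assumes "pmodule R e J" "set gs \<subseteq> carrier R" "pspan R e J gs = carrier R" "w \<in> carrier R"
  shows "\<exists>m. w [^] m \<in> pspan R e J (map (\<lambda>i::nat. w [^] i) (rev [0..<m]))"
proof -
  define Q where "Q m = pspan R e J (map (\<lambda>i::nat. w [^] i) (rev [0..<m]))" for m
  have c: "set (map (\<lambda>i::nat. w [^] i) (rev [0..<m])) \<subseteq> carrier R" for m using assms(4) by auto
  note Q = pspan_pmodule[OF assms(1) c, folded Q_def]
  have Qc: "Q m \<subseteq> carrier R" for m using Q[of m] by (simp add: pmodule_def)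
  have mono: "Q m \<subseteq> Q n" if "m \<le> n" for m n
  proof -
    have "set (map (\<lambda>i::nat. w [^] i) (rev [0..<m])) \<subseteq> set (map (\<lambda>i::nat. w [^] i) (rev [0..<n]))"
      using that by auto
    then show ?thesis
      unfolding Q_def[of m] using Q[of n] by (intro pspan_minimal) auto
  qed
  have UN: "pmodule R e (\<Union>m. Q m)"
    unfolding pmodule_def
  proof (intro conjI ballI allI)
    show "(\<Union>m. Q m) \<subseteq> carrier R" using Qc by blast
    show "\<zero> \<in> (\<Union>m. Q m)" using Q[of 0] by (auto simp: pmodule_def)
    fix u assume "u \<in> (\<Union>m. Q m)"
    then obtain m where m: "u \<in> Q m" by blast
    then have "e p \<otimes> u \<in> Q m" for p using Q[of m] by (simp add: pmodule_def)
    then show "e p \<otimes> u \<in> (\<Union>m. Q m)" for p by blast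
    fix v assume "v \<in> (\<Union>m. Q m)"
    then obtain n where n: "v \<in> Q n" by blast
    have "u \<in> Q (max m n)" "v \<in> Q (max m n)"
      using m n mono[of m "max m n"] mono[of n "max m n"] by auto
    then have "u \<oplus> v \<in> Q (max m n)" using Q[of "max m n"] by (simp add: pmodule_def)
    then show "u \<oplus> v \<in> (\<Union>m. Q m)" by blast
  qed
  have "J \<subseteq> (\<Union>m. Q m)" using Q[of 0] by blast
  from pmodule_finitely_generated[OF assms(1,2) UN this]
  obtain A where A: "A \<subseteq> (\<Union>m. Q m)" "finite A"
    "\<And>W. pmodule R e W \<Longrightarrow> J \<subseteq> W \<Longrightarrow> A \<subseteq> W \<Longrightarrow> (\<Union>m. Q m) \<subseteq> W"
    using Qc assms(3) by blast
  have "\<exists>m. A \<subseteq> Q m" using A(2,1)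
  proof (induction A)
    case (insert a A)
    then obtain m n where "A \<subseteq> Q m" "a \<in> Q n" by auto
    then have "insert a A \<subseteq> Q (max m n)"
      using mono[of m "max m n"] mono[of n "max m n"] by auto
    then show ?case by blast
  qed auto
  then obtain m where "A \<subseteq> Q m" by blast
  with A(3)[of "Q m"] Q[of m] have sub: "(\<Union>m. Q m) \<subseteq> Q m" by blast
  have "w [^] m \<in> set (map (\<lambda>i::nat. w [^] i) (rev [0..<Suc m]))" by simp
  then have "w [^] m \<in> Q (Suc m)" using Q[of "Suc m"] by blast
  then have "w [^] m \<in> Q m" using sub by blast
  then show ?thesis unfolding Q_def by blast
qed

text \<open>A Horner step: a polynomial in \<open>w\<close> is its constant coefficient plus
  \<open>w\<close> times a polynomial of lower degree. It isolates the constant term of an integral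
  equation.\<close>

lemma pspan_powers_Suc:
  assumes "ideal J R" "w \<in> carrier R" "v \<in> pspan R e J (map (\<lambda>i::nat. w [^] i) (rev [0..<Suc m]))"
  shows "\<exists>c j v'. v' \<in> pspan R e J (map (\<lambda>i::nat. w [^] i) (rev [0..<m])) \<and> j \<in> J \<and>
    v = e c \<oplus> w \<otimes> v' \<oplus> j"
  using assms(3)
proof (induction m arbitrary: v)
  case 0
  then obtain c j where cj: "v = e c \<otimes> \<one> \<oplus> j" "j \<in> J" by auto
  have j0: "\<zero> \<in> J" "j \<in> carrier R"
    using ideal.Icarr[OF assms(1)] cj(2) additive_subgroup.zero_closed[OF ideal.axioms(1)[OF assms(1)]]
    by simp_all
  show ?case
    by (rule exI[of _ c], rule exI[of _ j], rule exI[of _ \<zero>]) (use cj j0 assms(2) in simp)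
next
  case (Suc m)
  then obtain c v1 where v: "v = e c \<otimes> (w [^] Suc m) \<oplus> v1"
    "v1 \<in> pspan R e J (map (\<lambda>i::nat. w [^] i) (rev [0..<Suc m]))" by auto
  from Suc.IH[OF v(2)] obtain d j v' where
    *: "v' \<in> pspan R e J (map (\<lambda>i::nat. w [^] i) (rev [0..<m]))" "j \<in> J" "v1 = e d \<oplus> w \<otimes> v' \<oplus> j"
    by blast
  have cj: "j \<in> carrier R" using ideal.Icarr[OF assms(1) *(2)] .
  have "set (map (\<lambda>i::nat. w [^] i) (rev [0..<m])) \<subseteq> carrier R" using assms(2) by auto
  from pspan_pmodule[OF ideal_pmodule[OF assms(1)] this] have cv: "v' \<in> carrier R"
    using *(1) by (auto simp: pmodule_def)
  have "v = e d \<oplus> w \<otimes> (e c \<otimes> w [^] m \<oplus> v') \<oplus> j"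
    unfolding v(1) *(3) using assms(2) cj cv e_closed[of c] e_closed[of d] nat_pow_closed[OF assms(2), of m]
    unfolding nat_pow_Suc by algebra
  moreover have "e c \<otimes> w [^] m \<oplus> v' \<in> pspan R e J (map (\<lambda>i::nat. w [^] i) (rev [0..<Suc m]))"
    using *(1) by auto
  ultimately show ?case using *(2) by blast
qed

text \<open>The witness is the constant term of an integral equation of least degree for \<open>w\<close> modulo \<open>J\<close>.\<close>

lemma constant_term_of_nonzerodivisor:
  assumes J: "ideal J R" "\<one> \<notin> J"
    and gs: "set gs \<subseteq> carrier R" "pspan R e J gs = carrier R"
    and w: "w \<in> carrier R" "\<And>a. a \<in> carrier R \<Longrightarrow> w \<otimes> a \<in> J \<Longrightarrow> a \<in> J"
  shows "\<exists>c. e c \<notin> J \<and> (\<exists>v\<in>carrier R. e c \<oplus> w \<otimes> v \<in> J)"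
proof -
  interpret J: ideal J R by fact
  define Q where "Q m = pspan R e J (map (\<lambda>i::nat. w [^] i) (rev [0..<m]))" for m
  have "set (map (\<lambda>i::nat. w [^] i) (rev [0..<m])) \<subseteq> carrier R" for m using w(1) by auto
  note Q = pspan_pmodule[OF ideal_pmodule[OF J(1)] this, folded Q_def]
  define m where "m = (LEAST m. w [^] m \<in> Q m)"
  have "w [^] m \<in> Q m" unfolding m_def
    by (rule LeastI_ex) (use integral_mod[OF ideal_pmodule[OF J(1)] gs w(1)] in \<open>simp add: Q_def\<close>)
  have min: "w [^] k \<notin> Q k" if "k < m" for k using not_less_Least that unfolding m_def by blast
  have "m \<noteq> 0"
    using \<open>w [^] m \<in> Q m\<close> J(2) by (cases m) (auto simp: Q_def)
  then obtain k where k: "m = Suc k" by (cases m) auto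
  from pspan_powers_Suc[OF J(1) w(1)] \<open>w [^] m \<in> Q m\<close>[unfolded Q_def k] obtain c j v where
    *: "v \<in> Q k" "j \<in> J" "w [^] Suc k = e c \<oplus> w \<otimes> v \<oplus> j" unfolding Q_def by metis
  have cv: "v \<in> carrier R" using Q[of k] *(1) by (auto simp: pmodule_def)
  have cj: "j \<in> carrier R" using *(2) by auto
  have wk: "w [^] k \<in> carrier R" using w(1) by simp
  have eq: "w [^] Suc k = w \<otimes> w [^] k" using w(1) m_comm wk by simp
  have ec: "e c \<oplus> w \<otimes> (v \<ominus> w [^] k) = \<ominus> j"
  proof -
    have "e c = w \<otimes> w [^] k \<ominus> w \<otimes> v \<ominus> j"
      using *(3) eq cv cj wk w(1) e_closed[of c] by algebra
    then show ?thesis using cv cj wk w(1) by algebra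
  qed
  \<comment> \<open>Were the constant term in \<open>J\<close>, the factor \<open>w\<close> could be
    cancelled modulo \<open>J\<close>, leaving an integral equation of degree \<open>k\<close>, one
    below the least degree \<open>m\<close>.\<close>
  moreover have "e c \<notin> J"
  proof
    assume a: "e c \<in> J"
    have "w \<otimes> (w [^] k \<ominus> v) = e c \<oplus> j"
      using *(3) eq cv cj wk w(1) e_closed[of c] by algebra
    then have "w \<otimes> (w [^] k \<ominus> v) \<in> J" using a *(2) by auto
    then have "w [^] k \<ominus> v \<in> J" by (rule w(2)[rotated]) (use cv wk in simp)
    then have "w [^] k \<ominus> v \<in> Q k" using Q[of k] by blast
    then have "(w [^] k \<ominus> v) \<oplus> v \<in> Q k" using Q[of k] *(1) by (simp add: pmodule_def)
    moreover have "(w [^] k \<ominus> v) \<oplus> v = w [^] k" using cv wk by algebra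
    ultimately show False using min[of k] k by auto
  qed
  moreover have "\<ominus> j \<in> J" using *(2) by auto
  moreover have "v \<ominus> w [^] k \<in> carrier R" using cv wk by simp
  ultimately show ?thesis by metis
qed

end

section \<open>Cohen--Macaulayness of finite torsion-free algebras over a polynomial ring\<close>

locale finite_torsionfree_palgebra = palgebra R e
  for R (structure) and e :: "'k::field poly \<Rightarrow> 'a" +
  fixes gs :: "'a list"
  assumes gs_closed: "set gs \<subseteq> carrier R"
    and gs_span: "pspan R e {\<zero>} gs = carrier R"
    and torsionfree: "u \<in> carrier R \<Longrightarrow> e p \<otimes> u = \<zero> \<Longrightarrow> p = 0 \<or> u = \<zero>"
    and one_neq_zero: "\<one> \<noteq> \<zero>"
begin

lemma gs_span_mod: "ideal J R \<Longrightarrow> pspan R e J gs = carrier R"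
proof -
  assume J: "ideal J R"
  interpret J: ideal J R by fact
  note * = pspan_pmodule[OF ideal_pmodule[OF J] gs_closed]
  have "pspan R e {\<zero>} gs \<subseteq> pspan R e J gs"
    using * by (intro pspan_minimal) (auto simp: pmodule_def)
  with * show ?thesis unfolding gs_span by (auto simp: pmodule_def)
qed

lemma noetherian: "noetherian_ring R"
proof (rule noetherian_ringI)
  fix I assume I: "ideal I R"
  then interpret I: ideal I R .
  have "{\<zero>} \<subseteq> I" by simp
  from pmodule_finitely_generated[OF ideal_pmodule[OF zeroideal] gs_closed ideal_pmodule[OF I] this]
  obtain A where A: "A \<subseteq> I" "finite A"
    "\<And>W. pmodule R e W \<Longrightarrow> {\<zero>} \<subseteq> W \<Longrightarrow> A \<subseteq> W \<Longrightarrow> I \<subseteq> W"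
    unfolding gs_span using I.a_subset by blast
  have c: "A \<subseteq> carrier R" using A(1) I.a_subset by blast
  interpret A: ideal "Idl A" R using genideal_ideal[OF c] .
  have "I \<subseteq> Idl A"
    using A(3)[OF ideal_pmodule[OF A.is_ideal]] genideal_self[OF c] by simp
  moreover have "Idl A \<subseteq> I" using genideal_minimal[OF I A(1)] .
  ultimately show "\<exists>A\<subseteq>carrier R. finite A \<and> I = Idl A" using A c by blast
qed

text \<open>Evaluation at 0 lets K[t] act through its constants, so the finiteness results for
  K[t]-modules can be reused for vector spaces over K.\<close>

lemma palgebra_const: "palgebra R (\<lambda>p. e [:Polynomial.coeff p 0:])"
proof
  fix p q :: "'k poly"
  show "e [:Polynomial.coeff (p + q) 0:] = e [:Polynomial.coeff p 0:] \<oplus> e [:Polynomial.coeff q 0:]"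
    unfolding e_add[symmetric] by simp
  show "e [:Polynomial.coeff (p * q) 0:] = e [:Polynomial.coeff p 0:] \<otimes> e [:Polynomial.coeff q 0:]"
    unfolding e_mult[symmetric] by (simp add: coeff_mult_0 mult.commute)
  show "e [:Polynomial.coeff 1 0:] = \<one>" using e_one by (simp add: one_pCons)
qed auto

lemma finite_over_field_mod:
  assumes J: "ideal J R" and c: "c \<noteq> 0" "e c \<in> J"
  shows "\<exists>hs. set hs \<subseteq> carrier R \<and> pspan R (\<lambda>p. e [:Polynomial.coeff p 0:]) J hs = carrier R"
proof -
  interpret J: ideal J R by fact
  let ?e = "\<lambda>p. e [:Polynomial.coeff p 0:]"
  interpret C: palgebra R ?e by (rule palgebra_const)
  \<comment> \<open>Division with remainder by \<open>c\<close>, which acts as zero modulo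
    \<open>J\<close>, leaves only the products of each generator with powers of t below the degree
    of \<open>c\<close>.\<close>
  define hs where "hs = concat (map (\<lambda>g. map (\<lambda>i. e (Polynomial.monom 1 i) \<otimes> g) [0..<Polynomial.degree c]) gs)"
  have hs: "set hs \<subseteq> carrier R" unfolding hs_def using gs_closed by auto
  define W where "W = pspan R ?e J hs"
  have W: "pmodule R ?e W" "J \<subseteq> W" "set hs \<subseteq> W"
    using C.pspan_pmodule[OF C.ideal_pmodule[OF J] hs] unfolding W_def by auto
  have low: "e p \<otimes> g \<in> W" if g: "g \<in> set gs" and "\<And>i. n \<le> i \<Longrightarrow> Polynomial.coeff p i = 0" "n \<le> Polynomial.degree c"
    for p g n
    using that(2,3)
  proof (induction n arbitrary: p)
    case 0
    then have "p = 0" by (simp add: poly_eq_iff)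
    then show ?case using W(1) g gs_closed by (auto simp: e_zero pmodule_def)
  next
    case (Suc n)
    let ?m = "Polynomial.monom (Polynomial.coeff p n) n"
    have "Polynomial.coeff (p - ?m) i = 0" if "n \<le> i" for i
      using that Suc.prems(1)[of i] by (cases "i = n") auto
    then have IH: "e (p - ?m) \<otimes> g \<in> W" by (rule Suc.IH) (use Suc.prems(2) in simp_all)
    have gc: "g \<in> carrier R" using g gs_closed by blast
    have "e (Polynomial.monom 1 n) \<otimes> g \<in> set hs" unfolding hs_def using g Suc.prems(2) by (auto intro!: bexI[of _ g])
    then have h: "e (Polynomial.monom 1 n) \<otimes> g \<in> W" using W(3) by blast
    have "?e [:Polynomial.coeff p n:] \<otimes> (e (Polynomial.monom 1 n) \<otimes> g) = e ?m \<otimes> g"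
      using gc by (simp add: m_assoc[symmetric] e_mult[symmetric] smult_monom)
    moreover have "?e [:Polynomial.coeff p n:] \<otimes> (e (Polynomial.monom 1 n) \<otimes> g) \<in> W"
      using h W(1) by (simp only: pmodule_def)
    ultimately have "e (p - ?m) \<otimes> g \<oplus> e ?m \<otimes> g \<in> W"
      using IH W(1) by (simp only: pmodule_def)
    moreover have "e p \<otimes> g = e (p - ?m) \<otimes> g \<oplus> e ?m \<otimes> g"
      using gc e_add[of "p - ?m" ?m] by (simp add: l_distr)
    ultimately show ?case by simp
  qed
  have all: "e p \<otimes> g \<in> W" if g: "g \<in> set gs" for p g
  proof -
    have gc: "g \<in> carrier R" using g gs_closed by blast
    have "e (p mod c) \<otimes> g \<in> W"
    proof (cases "p mod c = 0")
      case True
      then show ?thesis using W(1) gc by (auto simp: e_zero pmodule_def)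
    next
      case False
      then have "Polynomial.degree (p mod c) < Polynomial.degree c" using degree_mod_less'[OF c(1)] by blast
      then show ?thesis by (intro low[OF g, of "Polynomial.degree c"]) (auto intro: coeff_eq_0)
    qed
    moreover have "e (p div c * c) \<otimes> g \<in> J"
      unfolding e_mult using c(2) gc by (simp add: J.I_l_closed J.I_r_closed)
    ultimately have "e (p div c * c) \<otimes> g \<oplus> e (p mod c) \<otimes> g \<in> W"
      using W(1,2) by (auto simp: pmodule_def)
    moreover have "e p \<otimes> g = e (p div c * c) \<otimes> g \<oplus> e (p mod c) \<otimes> g"
      using gc by (metis div_mult_mod_eq e_add e_closed l_distr)
    ultimately show ?thesis by simp
  qed
  have "pspan R e {\<zero>} ks \<subseteq> W" if "set ks \<subseteq> set gs" for ks
    using that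
  proof (induction ks)
    case Nil
    then show ?case using W(1) by (simp add: pmodule_def)
  next
    case (Cons k ks)
    then show ?case using all[of k] W(1) by (auto simp: pmodule_def)
  qed
  from this[of gs] have "carrier R \<subseteq> W" using gs_span by simp
  moreover have "W \<subseteq> carrier R" using W(1) by (simp add: pmodule_def)
  ultimately show ?thesis using hs W_def by blast
qed

text \<open>Two integral equations are combined. The one for \<open>w\<close> modulo
  \<open>J\<close> puts a nonzero polynomial \<open>e c\<close> into \<open>J'\<close>, so R/J' is
  finite-dimensional over K; there the constant term in the equation of the nonzerodivisor
  \<open>u\<close> is a nonzero scalar, which makes \<open>u\<close> a unit. This bounds both depth
  and height by 1.\<close>

lemma nonzerodivisor_mod_is_unit_mod:
  assumes "ideal J R" "\<one> \<notin> J" and J': "ideal J' R" "\<one> \<notin> J'" "J \<subseteq> J'"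
    and w: "w \<in> J'" "\<And>a. a \<in> carrier R \<Longrightarrow> w \<otimes> a \<in> J \<Longrightarrow> a \<in> J"
    and u: "u \<in> carrier R" "\<And>a. a \<in> carrier R \<Longrightarrow> u \<otimes> a \<in> J' \<Longrightarrow> a \<in> J'"
  shows "\<exists>j\<in>J'. \<exists>v\<in>carrier R. \<one> = j \<oplus> u \<otimes> v"
proof -
  interpret J: ideal J R by fact
  interpret J': ideal J' R by fact
  have wc: "w \<in> carrier R" using w(1) J'.Icarr by blast
  from constant_term_of_nonzerodivisor[OF assms(1,2) gs_closed gs_span_mod[OF assms(1)] wc w(2)]
  obtain c v where c: "e c \<notin> J" "v \<in> carrier R" "e c \<oplus> w \<otimes> v \<in> J" by blast
  have "c \<noteq> 0" using c(1) e_zero by auto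
  have "e c = (e c \<oplus> w \<otimes> v) \<ominus> w \<otimes> v" using c(2) wc e_closed[of c] by algebra
  moreover have "(e c \<oplus> w \<otimes> v) \<ominus> w \<otimes> v \<in> J'"
    using c(2,3) J'(3) w(1) J'.I_r_closed unfolding a_minus_def by auto
  ultimately have "e c \<in> J'" by simp
  from finite_over_field_mod[OF J'(1) \<open>c \<noteq> 0\<close> this] obtain hs where
    hs: "set hs \<subseteq> carrier R" "pspan R (\<lambda>p. e [:Polynomial.coeff p 0:]) J' hs = carrier R" by blast
  from palgebra.constant_term_of_nonzerodivisor[OF palgebra_const J'(1,2) hs u]
  obtain d v where d: "e [:Polynomial.coeff d 0:] \<notin> J'" "v \<in> carrier R" "e [:Polynomial.coeff d 0:] \<oplus> u \<otimes> v \<in> J'"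
    by blast
  define a where "a = Polynomial.coeff d 0"
  have "a \<noteq> 0" using d(1) e_zero unfolding a_def by auto
  have "e [:1 / a:] \<otimes> e [:a:] = \<one>"
    unfolding e_mult[symmetric] using \<open>a \<noteq> 0\<close> e_one by (simp add: one_pCons)
  then have "\<one> = e [:1 / a:] \<otimes> (e [:a:] \<oplus> u \<otimes> v) \<oplus> u \<otimes> (\<ominus> (e [:1 / a:] \<otimes> v))"
    using d(2) u(1) e_closed[of "[:a:]"] e_closed[of "[:1 / a:]"] by algebra
  moreover have "e [:1 / a:] \<otimes> (e [:a:] \<oplus> u \<otimes> v) \<in> J'"
    using d(3) J'.I_l_closed unfolding a_def by simp
  moreover have "\<ominus> (e [:1 / a:] \<otimes> v) \<in> carrier R" using d(2) by simp
  ultimately show ?thesis by blast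
qed

text \<open>Apply the preceding lemma to the zero ideal and the ideal of the first term: a second
  term would be a unit modulo the first, so the sequence would generate the whole ring.\<close>

lemma regular_sequence_length: "regular_sequence R xs \<Longrightarrow> length xs \<le> 1"
proof (rule ccontr)
  assume reg: "regular_sequence R xs" and "\<not> length xs \<le> 1"
  then obtain u w ys where xs: "xs = w # u # ys"
    by (metis One_nat_def Suc_le_mono length_Cons list.exhaust list.size(3) nat_le_linear zero_le)
  have c: "w \<in> carrier R" "u \<in> carrier R" "set xs \<subseteq> carrier R"
    using reg unfolding regular_sequence_def xs by auto
  have r: "\<forall>i<length xs. \<forall>a\<in>carrier R. xs ! i \<otimes> a \<in> Idl (set (take i xs)) \<longrightarrow> a \<in> Idl (set (take i xs))"
    and ne: "Idl (set xs) \<noteq> carrier R"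
    using reg unfolding regular_sequence_def by blast+
  have w: "a \<in> {\<zero>}" if "a \<in> carrier R" "w \<otimes> a \<in> {\<zero>}" for a
    using r[rule_format, of 0 a] that by (simp add: xs genideal_empty)
  have u: "a \<in> Idl {w}" if "a \<in> carrier R" "u \<otimes> a \<in> Idl {w}" for a
    using r[rule_format, of 1 a] that by (simp add: xs)
  interpret X: ideal "Idl (set xs)" R using genideal_ideal[OF c(3)] .
  interpret J: ideal "Idl {w}" R using genideal_ideal[of "{w}"] c(1) by simp
  have self: "set xs \<subseteq> Idl (set xs)" by (rule genideal_self[OF c(3)])
  have sub: "Idl {w} \<subseteq> Idl (set xs)"
    using genideal_minimal[OF X.is_ideal, of "{w}"] self by (simp add: xs)
  have n1: "\<one> \<notin> Idl (set xs)" using ne X.one_imp_carrier by blast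
  then have "\<one> \<notin> Idl {w}" using sub by blast
  moreover have "w \<in> Idl {w}" using genideal_self'[OF c(1)] .
  ultimately have "\<exists>j\<in>Idl {w}. \<exists>v\<in>carrier R. \<one> = j \<oplus> u \<otimes> v"
    using nonzerodivisor_mod_is_unit_mod[OF zeroideal _ J.is_ideal _ _ _ w c(2) u] one_neq_zero by auto
  then obtain j v where jv: "j \<in> Idl {w}" "v \<in> carrier R" "\<one> = j \<oplus> u \<otimes> v" by blast
  have "u \<in> Idl (set xs)" using self by (simp add: xs)
  then have "j \<oplus> u \<otimes> v \<in> Idl (set xs)" using jv sub X.I_r_closed X.a_closed by blast
  with jv(3) n1 show False by simp
qed

text \<open>An element of \<open>q - p\<close> is a nonzerodivisor modulo \<open>p\<close>, and one
  of \<open>r - q\<close> modulo \<open>q\<close>. The latter would be a unit modulo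
  \<open>q\<close>, which forces \<open>\<one> \<in> r\<close>.\<close>

lemma prime_chain_length:
  assumes "primeideal p R" "primeideal q R" "primeideal r R" "p \<subset> q" "q \<subset> r"
  shows False
proof -
  interpret p: primeideal p R by fact
  interpret q: primeideal q R by fact
  interpret r: primeideal r R by fact
  have 1: "\<one> \<notin> p" "\<one> \<notin> q" "\<one> \<notin> r"
    using p.one_imp_carrier p.I_notcarr q.one_imp_carrier q.I_notcarr r.one_imp_carrier r.I_notcarr
    by auto
  obtain w u where w: "w \<in> q" "w \<notin> p" and u: "u \<in> r" "u \<notin> q" using assms(4,5) by blast
  have c: "w \<in> carrier R" "u \<in> carrier R" using w u q.Icarr r.Icarr by auto
  have "\<exists>j\<in>q. \<exists>v\<in>carrier R. \<one> = j \<oplus> u \<otimes> v"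
  proof (rule nonzerodivisor_mod_is_unit_mod[OF p.is_ideal 1(1) q.is_ideal 1(2) _ w(1) _ c(2)])
    show "p \<subseteq> q" using assms(4) by blast
    show "a \<in> p" if "a \<in> carrier R" "w \<otimes> a \<in> p" for a using p.I_prime[OF c(1) that] w(2) by blast
    show "a \<in> q" if "a \<in> carrier R" "u \<otimes> a \<in> q" for a using q.I_prime[OF c(2) that] u(2) by blast
  qed
  then obtain j v where jv: "j \<in> q" "v \<in> carrier R" "\<one> = j \<oplus> u \<otimes> v" by blast
  have "j \<oplus> u \<otimes> v \<in> r" using jv(1,2) u(1) assms(5) r.I_r_closed r.a_closed by blast
  with jv(3) 1(3) show False by simp
qed

text \<open>If the variable \<open>t\<close> does not lie in \<open>M\<close>, invert it modulo \<open>M\<close> and clear denominators in an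
  integral equation of the inverse: this gives a polynomial with constant term \<open>1\<close>.\<close>

lemma maximalideal_contracts_nonzero:
  assumes "maximalideal M R"
  shows "\<exists>c. c \<noteq> 0 \<and> e c \<in> M"
proof (cases "e (Polynomial.monom 1 1) \<in> M")
  case True
  then show ?thesis by (intro exI[of _ "Polynomial.monom 1 1"]) (simp add: monom_eq_0_iff)
next
  case False
  interpret M: maximalideal M R by fact
  let ?t = "e (Polynomial.monom 1 1)"
  have t: "?t \<in> carrier R" by simp
  note idl = ideal_add_cgenideal[OF M.is_ideal t]
  have "M <+>\<^bsub>R\<^esub> PIdl ?t \<subseteq> carrier R"
    using idl(1) by (meson additive_subgroup.a_subset ideal.axioms(1))
  then have "M <+>\<^bsub>R\<^esub> PIdl ?t = carrier R"
    using M.I_maximal[OF idl(1,2)] idl(3) False by blast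
  then have "\<one> \<in> M <+>\<^bsub>R\<^esub> PIdl ?t" by simp
  then obtain j w where w: "j \<in> M" "w \<in> carrier R" "\<one> = j \<oplus> ?t \<otimes> w" using idl(4) by blast
  have jc: "j \<in> carrier R" using w(1) M.Icarr by blast
  have tw: "\<exists>j'\<in>M. (?t \<otimes> w) [^] m = \<one> \<oplus> j'" for m :: nat
  proof (induction m)
    case 0
    then show ?case using M.zero_closed by (intro bexI[of _ \<zero>]) auto
  next
    case (Suc m)
    then obtain j' where j': "j' \<in> M" "(?t \<otimes> w) [^] m = \<one> \<oplus> j'" by blast
    have c: "j' \<in> carrier R" using j'(1) M.Icarr by blast
    have "?t \<otimes> w = \<one> \<ominus> j" using w(3) jc w(2) t by algebra
    then have "(?t \<otimes> w) [^] Suc m = \<one> \<oplus> (j' \<ominus> j \<ominus> j' \<otimes> j)"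
      unfolding nat_pow_Suc j'(2) using c jc by algebra
    moreover have "j' \<ominus> j \<ominus> j' \<otimes> j \<in> M"
      unfolding a_minus_def using j'(1) w(1) c jc M.I_l_closed by auto
    ultimately show ?case by blast
  qed
  have powc: "set (map (\<lambda>i::nat. w [^] i) (rev [0..<m])) \<subseteq> carrier R" for m using w(2) by auto
  \<comment> \<open>For i < m the product of \<open>?t [^] m\<close> and \<open>w [^] i\<close> is a
    positive power of the variable modulo \<open>M\<close>, so clearing denominators always leaves a
    factor \<open>?t\<close>. This factor is why the final polynomial has constant term 1.\<close>
  have *: "\<exists>p. ?t [^] m \<otimes> v \<ominus> ?t \<otimes> e p \<in> M"
    if "v \<in> pspan R e {\<zero>} (map (\<lambda>i::nat. w [^] i) (rev [0..<m]))" for v m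
    using that
  proof (induction m arbitrary: v)
    case 0
    then have "?t [^] (0::nat) \<otimes> v \<ominus> ?t \<otimes> e 0 = \<zero>" by (simp add: e_zero a_minus_def)
    then show ?case using M.zero_closed by metis
  next
    case (Suc m)
    then obtain c v' where v: "v = e c \<otimes> (w [^] m) \<oplus> v'"
      "v' \<in> pspan R e {\<zero>} (map (\<lambda>i::nat. w [^] i) (rev [0..<m]))" by auto
    from Suc.IH[OF v(2)] obtain p where p: "?t [^] m \<otimes> v' \<ominus> ?t \<otimes> e p \<in> M" by blast
    from tw[of m] obtain j' where j': "j' \<in> M" "(?t \<otimes> w) [^] m = \<one> \<oplus> j'" by blast
    have v'c: "v' \<in> carrier R"
      using v(2) pspan_pmodule[OF ideal_pmodule[OF zeroideal] powc[of m]] unfolding pmodule_def by blast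
    have tm: "?t [^] m \<in> carrier R" "w [^] m \<in> carrier R" using w(2) by auto
    have j'c: "j' \<in> carrier R" using j'(1) M.Icarr by blast
    have eq: "?t [^] m \<otimes> w [^] m = \<one> \<oplus> j'" using j'(2) w(2) t nat_pow_distrib by metis
    have "?t [^] Suc m \<otimes> v \<ominus> ?t \<otimes> e (c + Polynomial.monom 1 1 * p)
      = ?t \<otimes> e c \<otimes> (?t [^] m \<otimes> w [^] m \<ominus> \<one>) \<oplus> ?t \<otimes> (?t [^] m \<otimes> v' \<ominus> ?t \<otimes> e p)"
      unfolding v(1) e_add e_mult nat_pow_Suc
      using tm v'c e_closed[of c] e_closed[of p] t by algebra
    also have "?t [^] m \<otimes> w [^] m \<ominus> \<one> = j'" unfolding eq using j'c by algebra
    also have "?t \<otimes> e c \<otimes> j' \<oplus> ?t \<otimes> (?t [^] m \<otimes> v' \<ominus> ?t \<otimes> e p) \<in> M"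
      using j'(1) p M.I_l_closed by auto
    finally show ?case by blast
  qed
  from integral_mod[OF ideal_pmodule[OF zeroideal] gs_closed gs_span w(2)] obtain m where
    "w [^] m \<in> pspan R e {\<zero>} (map (\<lambda>i::nat. w [^] i) (rev [0..<m]))" by blast
  from *[OF this] obtain p where p: "?t [^] m \<otimes> w [^] m \<ominus> ?t \<otimes> e p \<in> M" by blast
  from tw[of m] obtain j' where j': "j' \<in> M" "(?t \<otimes> w) [^] m = \<one> \<oplus> j'" by blast
  have j'c: "j' \<in> carrier R" using j'(1) M.Icarr by blast
  have eq: "?t [^] m \<otimes> w [^] m = \<one> \<oplus> j'" using j'(2) w(2) t nat_pow_distrib by metis
  have "e (1 - Polynomial.monom 1 1 * p) = \<one> \<ominus> ?t \<otimes> e p"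
    using e_add[of 1 "- (Polynomial.monom 1 1 * p)"] by (simp add: e_uminus e_mult e_one a_minus_def)
  also have "\<dots> = (?t [^] m \<otimes> w [^] m \<ominus> ?t \<otimes> e p) \<ominus> j'"
    unfolding eq using j'c e_closed[of p] t by algebra
  also have "\<dots> \<in> M" by (rule pmodule_minus[OF ideal_pmodule[OF M.is_ideal] p j'(1)])
  finally have "e (1 - Polynomial.monom 1 1 * p) \<in> M" .
  moreover have "Polynomial.coeff (1 - Polynomial.monom 1 1 * p) 0 = 1" by (simp add: coeff_mult_0)
  then have "1 - Polynomial.monom 1 1 * p \<noteq> 0" by force
  ultimately show ?thesis by blast
qed

lemma maximalideal_depth_height:
  assumes "maximalideal M R"
  shows "ideal_depth R M = 1" "prime_height R M = 1"
proof -
  interpret M: maximalideal M R by fact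
  obtain c where c: "c \<noteq> 0" "e c \<in> M" using maximalideal_contracts_nonzero[OF assms] by blast
  have nz: "e c \<noteq> \<zero>" using torsionfree[OF one_closed, of c] c(1) one_neq_zero by auto
  have "Idl {e c} \<subseteq> M" using genideal_minimal[OF M.is_ideal] c(2) by blast
  then have "Idl {e c} \<noteq> carrier R" using M.I_notcarr M.a_subset by blast
  then have reg: "regular_sequence R [e c]"
    unfolding regular_sequence_def using torsionfree c(1) by (auto simp: genideal_empty)
  show "ideal_depth R M = 1"
    unfolding ideal_depth_def
  proof (rule antisym)
    show "Sup {enat (length xs) |xs. regular_sequence R xs \<and> set xs \<subseteq> M} \<le> 1"
      using regular_sequence_length by (intro Sup_least) (auto simp: one_enat_def)
    show "1 \<le> Sup {enat (length xs) |xs. regular_sequence R xs \<and> set xs \<subseteq> M}"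
      using reg c(2) by (intro Sup_upper) (auto intro!: exI[of _ "[e c]"] simp: one_enat_def)
  qed
  \<comment> \<open>\<open>S\<close> contains the complement of \<open>M\<close> (take
    \<open>p = 1\<close>) and the element \<open>e c\<close> of \<open>M\<close> (take
    \<open>s = \<one>\<close>), so a prime missing \<open>S\<close> lies strictly below
    \<open>M\<close>. Torsion-freeness keeps zero out of \<open>S\<close>.\<close>
  define S where "S = {e p \<otimes> s | p s. p \<noteq> 0 \<and> s \<in> carrier R - M}"
  have SI: "e p \<otimes> s \<in> S" if "p \<noteq> 0" "s \<in> carrier R - M" for p s
    unfolding S_def using that by blast
  interpret MP: primeideal M R using maximalideal_prime[OF assms] .
  have 1: "\<one> \<in> carrier R - M" using M.one_imp_carrier M.I_notcarr by auto
  have "\<exists>P. primeideal P R \<and> P \<inter> S = {}"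
  proof (rule exists_primeideal_disjoint)
    show "S \<subseteq> carrier R" unfolding S_def by auto
    have "e 1 \<otimes> \<one> \<in> S" by (rule SI) (use 1 in simp_all)
    then show "\<one> \<in> S" by (simp add: e_one)
    show "\<zero> \<notin> S" unfolding S_def using torsionfree M.zero_closed by force
    fix a b assume "a \<in> S" "b \<in> S"
    then obtain p q s t where *: "a = e p \<otimes> s" "b = e q \<otimes> t" "p \<noteq> 0" "q \<noteq> 0"
      "s \<in> carrier R - M" "t \<in> carrier R - M" unfolding S_def by blast
    have "a \<otimes> b = e (p * q) \<otimes> (s \<otimes> t)"
      unfolding *(1,2) e_mult using *(5,6) by (simp add: m_ac)
    moreover have "s \<otimes> t \<in> carrier R - M" using * MP.I_prime by blast
    moreover have "p * q \<noteq> 0" using * by simp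
    ultimately show "a \<otimes> b \<in> S" using SI by simp
  qed
  then obtain P where P: "primeideal P R" "P \<inter> S = {}" by blast
  interpret P: primeideal P R by fact
  have "P \<subseteq> M"
  proof
    fix x assume x: "x \<in> P"
    then have xc: "x \<in> carrier R" using P.Icarr by blast
    show "x \<in> M"
    proof (rule ccontr)
      assume "x \<notin> M"
      then have "e 1 \<otimes> x \<in> S" by (intro SI) (use xc in simp_all)
      then show False using P(2) x xc by (auto simp: e_one)
    qed
  qed
  moreover have "e c \<otimes> \<one> \<in> S" using SI c(1) 1 by blast
  then have "e c \<notin> P" using P(2) by auto
  ultimately have PM: "P \<subset> M" using c(2) by blast
  show "prime_height R M = 1"
    unfolding prime_height_def
  proof (rule antisym)
    show "Sup {enat n |n. \<exists>p. p n = M \<and> (\<forall>i\<le>n. primeideal (p i) R) \<and> (\<forall>i<n. p i \<subset> p (Suc i))} \<le> 1"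
    proof (rule Sup_least)
      fix x assume "x \<in> {enat n |n. \<exists>p. p n = M \<and> (\<forall>i\<le>n. primeideal (p i) R) \<and> (\<forall>i<n. p i \<subset> p (Suc i))}"
      then obtain n p where n: "x = enat n" "\<forall>i\<le>n. primeideal (p i) R" "\<forall>i<n. p i \<subset> p (Suc i)"
        by blast
      have "\<not> 2 \<le> n"
      proof
        assume "2 \<le> n"
        then have "primeideal (p 0) R" "primeideal (p 1) R" "primeideal (p 2) R"
          "p 0 \<subset> p 1" "p 1 \<subset> p 2"
          using n(2,3)[rule_format, of 0] n(2,3)[rule_format, of 1] n(2)[rule_format, of 2]
          by (simp_all add: numeral_2_eq_2)
        then show False by (rule prime_chain_length)
      qed
      then show "x \<le> 1" by (simp add: n(1) one_enat_def)
    qed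
    have "\<exists>p. p 1 = M \<and> (\<forall>i\<le>1. primeideal (p i) R) \<and> (\<forall>i<(1::nat). p i \<subset> p (Suc i))"
      by (rule exI[of _ "\<lambda>i. if i = 0 then P else M"]) (use P PM MP.primeideal in auto)
    then show "1 \<le> Sup {enat n |n. \<exists>p. p n = M \<and> (\<forall>i\<le>n. primeideal (p i) R) \<and> (\<forall>i<n. p i \<subset> p (Suc i))}"
      by (intro Sup_upper) (unfold one_enat_def, blast)
  qed
qed

theorem cohen_macaulay: "cohen_macaulay_ring R"
  unfolding cohen_macaulay_ring_def
  using is_cring noetherian maximalideal_depth_height by simp

end

section \<open>Relative dimension\<close>

locale kspace = vector_space scale for scale :: "'k::field \<Rightarrow> 'b::ab_group_add \<Rightarrow> 'b"
begin

text \<open>\<open>reldim U n W\<close> says that \<open>W/U\<close> has dimension \<open>n\<close>.\<close>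

inductive reldim :: "'b set \<Rightarrow> nat \<Rightarrow> 'b set \<Rightarrow> bool" for U :: "'b set" where
  reldim_0: "reldim U 0 U"
| reldim_Suc: "reldim U n W \<Longrightarrow> v \<notin> W \<Longrightarrow> reldim U (Suc n) (W + range (\<lambda>c. scale c v))"

lemma in_line: "x \<in> W + range (\<lambda>c. scale c v) \<longleftrightarrow> (\<exists>w\<in>W. \<exists>c. x = w + scale c v)"
  by (auto simp: set_plus_def)

lemma subspace_plus: "subspace A \<Longrightarrow> subspace B \<Longrightarrow> subspace (A + B)"
  using subspace_sums[of A B] by (simp add: set_plus_def Bex_def conj_ac cong: conj_cong)

lemma subspace_range_scale: "subspace (range (\<lambda>c. scale c v))"
proof -
  have "range (\<lambda>c. scale c v) = span {v}" by (simp add: span_singleton)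
  then show ?thesis by simp
qed

lemma subspace_line: "subspace W \<Longrightarrow> subspace (W + range (\<lambda>c. scale c v))"
  by (intro subspace_plus subspace_range_scale)

lemma line_superset: "W \<subseteq> W + range (\<lambda>c. scale c v)"
proof
  fix x assume "x \<in> W"
  then show "x \<in> W + range (\<lambda>c. scale c v)"
    unfolding in_line by (intro bexI[of _ x] exI[of _ 0]) auto
qed

lemma line_self: "subspace W \<Longrightarrow> v \<in> W + range (\<lambda>c. scale c v)"
  unfolding in_line using subspace_0[of W] by (intro bexI[of _ 0] exI[of _ 1]) auto

lemma line_subset: "subspace Y \<Longrightarrow> W \<subseteq> Y \<Longrightarrow> v \<in> Y \<Longrightarrow> W + range (\<lambda>c. scale c v) \<subseteq> Y"
  by (auto simp: in_line intro!: subspace_add subspace_scale)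

lemma line_exchange:
  assumes "subspace W" "t \<in> W + range (\<lambda>c. scale c v)" "t \<notin> W"
  shows "v \<in> W + range (\<lambda>c. scale c t)"
proof -
  from assms(2) obtain w c where w: "w \<in> W" "t = w + scale c v" unfolding in_line by blast
  have "c \<noteq> 0" using w assms(3) by auto
  then have "v = scale (- inverse c) w + scale (inverse c) t"
    by (simp add: w(2) scale_right_distrib)
  with subspace_scale[OF assms(1) w(1), of "- inverse c"] show ?thesis unfolding in_line by blast
qed

lemma reldim_subspace:
  assumes "reldim U n W" "subspace U"
  shows "subspace W" "U \<subseteq> W"
proof -
  have "subspace W \<and> U \<subseteq> W" using assms
  proof induction
    case (reldim_Suc n W v)
    then show ?case using subspace_line[of W v] line_superset[of W v] by blast
  qed simp
  then show "subspace W" "U \<subseteq> W" by auto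
qed

lemma reldim_trans: "reldim W m Y \<Longrightarrow> reldim U n W \<Longrightarrow> reldim U (n + m) Y"
  by (induction rule: reldim.induct) (auto intro: reldim_Suc)

text \<open>By exchange, a step \<open>v\<close> that became redundant after adding the line of
  \<open>t\<close> would put \<open>t\<close> into the top space. So the chain stays strict.\<close>

lemma reldim_line:
  assumes "reldim U n W" "subspace U" "t \<notin> W"
  shows "reldim (U + range (\<lambda>c. scale c t)) n (W + range (\<lambda>c. scale c t))"
  using assms
proof induction
  case reldim_0
  show ?case by (rule reldim.reldim_0)
next
  case (reldim_Suc n W v)
  have W: "subspace W" using reldim_subspace reldim_Suc by blast
  have t: "t \<notin> W" using reldim_Suc.prems(2) line_superset by blast
  have "v \<notin> W + range (\<lambda>c. scale c t)"
    using line_exchange[OF W _ reldim_Suc.hyps(2)] reldim_Suc.prems(2) by blast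
  from reldim.reldim_Suc[OF reldim_Suc.IH[OF reldim_Suc.prems(1) t] this]
  show ?case by (simp add: ac_simps)
qed

text \<open>Intersect \<open>T\<close> with the members of the chain. If \<open>T\<close> sticks out
  of \<open>W\<close>, a vector \<open>t\<close> of \<open>T\<close> can replace the last step
  \<open>v\<close>, and \<open>T\<close> is its intersection with \<open>W\<close> plus the line of
  \<open>t\<close>, so this step counts towards \<open>T\<close>. Uniqueness of relative dimensions
  and their existence for subspaces both rest on this.\<close>

lemma reldim_split:
  assumes "reldim U n W" "subspace U" "subspace T" "U \<subseteq> T" "T \<subseteq> W"
  shows "\<exists>i j. n = i + j \<and> reldim U i T \<and> reldim T j W"
  using assms
proof (induction arbitrary: T)
  case reldim_0
  then have "T = U" by auto
  then show ?case using reldim.reldim_0 by (intro exI[of _ 0]) auto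
next
  case (reldim_Suc n W v)
  have W: "subspace W" "U \<subseteq> W" using reldim_subspace reldim_Suc by blast+
  have "\<exists>i j. n = i + j \<and> reldim U i (T \<inter> W) \<and> reldim (T \<inter> W) j W"
    using reldim_Suc.IH[of "T \<inter> W"] reldim_Suc.prems W by (auto intro: subspace_inter)
  then obtain i j where ij: "n = i + j" "reldim U i (T \<inter> W)" "reldim (T \<inter> W) j W" by blast
  show ?case
  proof (cases "T \<subseteq> W")
    case True
    then have "T \<inter> W = T" by blast
    have "reldim U i T" "reldim T j W" using ij \<open>T \<inter> W = T\<close> by simp_all
    from this(1) reldim.reldim_Suc[OF this(2) reldim_Suc.hyps(2)] show ?thesis
      using ij(1) by (intro exI[of _ i] exI[of _ "Suc j"] conjI) simp_all
  next
    case False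
    then obtain t where t: "t \<in> T" "t \<notin> W" by blast
    have TW: "subspace (T \<inter> W)" using subspace_inter reldim_Suc.prems(2) W(1) by blast
    have vt: "v \<in> W + range (\<lambda>c. scale c t)"
      using line_exchange[OF W(1) _ t(2)] t reldim_Suc.prems(4) by blast
    have eqW: "W + range (\<lambda>c. scale c v) = W + range (\<lambda>c. scale c t)"
      using line_subset[OF subspace_line[OF W(1)] line_superset vt]
        line_subset[OF subspace_line[OF W(1)] line_superset, of t v] t reldim_Suc.prems(4) by blast
    have eqT: "T = (T \<inter> W) + range (\<lambda>c. scale c t)"
    proof
      show "(T \<inter> W) + range (\<lambda>c. scale c t) \<subseteq> T"
        using line_subset[OF reldim_Suc.prems(2), of "T \<inter> W" t] t by blast
      show "T \<subseteq> (T \<inter> W) + range (\<lambda>c. scale c t)"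
      proof
        fix x assume x: "x \<in> T"
        then have "x \<in> W + range (\<lambda>c. scale c t)" using reldim_Suc.prems(4) eqW by blast
        then obtain w c where w: "w \<in> W" "x = w + scale c t" unfolding in_line by blast
        have "w = x - scale c t" using w(2) by simp
        then have "w \<in> T" using subspace_diff[OF reldim_Suc.prems(2) x] subspace_scale[OF reldim_Suc.prems(2) t(1)]
          by simp
        then show "x \<in> (T \<inter> W) + range (\<lambda>c. scale c t)" unfolding in_line using w by blast
      qed
    qed
    have "reldim U (Suc i) T"
      using reldim.reldim_Suc[OF ij(2), of t] t(2) eqT by simp
    moreover have "reldim T j (W + range (\<lambda>c. scale c v))"
      using reldim_line[OF ij(3) TW t(2)] eqT eqW by simp
    ultimately show ?thesis using ij(1) by (intro exI[of _ "Suc i"] exI[of _ j] conjI) simp_all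
  qed
qed

lemma reldim_0_iff: "subspace U \<Longrightarrow> reldim U n U \<Longrightarrow> n = 0"
proof (cases n)
  case (Suc m)
  assume U: "subspace U" and "reldim U n U"
  then obtain W v where W: "reldim U m W" "v \<notin> W" "U = W + range (\<lambda>c. scale c v)"
    using Suc by (auto elim: reldim.cases)
  have "v \<in> U" using W(3) line_self reldim_subspace[OF W(1) U] by blast
  then show ?thesis using reldim_subspace[OF W(1) U] W(2) by blast
qed

lemma reldim_1:
  assumes "subspace W" "v \<notin> W" "reldim W k (W + range (\<lambda>c. scale c v))"
  shows "k = 1"
  using assms(3)
proof cases
  case reldim_0
  then show ?thesis using line_self[OF assms(1), of v] assms(2) by auto
next
  case (reldim_Suc j Y u)
  have Y: "subspace Y" "W \<subseteq> Y" using reldim_subspace[OF reldim_Suc(3) assms(1)] by auto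
  have "Y = W"
  proof (rule ccontr)
    assume "Y \<noteq> W"
    then obtain y where y: "y \<in> Y" "y \<notin> W" using Y by blast
    have "y \<in> W + range (\<lambda>c. scale c v)" using y(1) reldim_Suc(2) line_superset by blast
    then have "v \<in> W + range (\<lambda>c. scale c y)" using line_exchange[OF assms(1) _ y(2)] by blast
    then have "v \<in> Y" using line_subset[OF Y y(1)] by blast
    then have "W + range (\<lambda>c. scale c v) \<subseteq> Y" using line_subset[OF Y] by blast
    then show False using reldim_Suc(2,4) line_self[OF Y(1), of u] by blast
  qed
  then show ?thesis using reldim_Suc reldim_0_iff[OF assms(1)] by auto
qed

lemma reldim_unique:
  assumes "reldim U n W" "reldim U m W" "subspace U"
  shows "n = m"
  using assms
proof (induction arbitrary: m)
  case reldim_0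
  then show ?case using reldim_0_iff by auto
next
  case (reldim_Suc n W v)
  have W: "subspace W" "U \<subseteq> W" using reldim_subspace reldim_Suc by blast+
  from reldim_split[OF reldim_Suc.prems(1,2) W line_superset] obtain i j where
    ij: "m = i + j" "reldim U i W" "reldim W j (W + range (\<lambda>c. scale c v))" by blast
  from reldim_Suc.IH[OF ij(2) reldim_Suc.prems(2)] reldim_1[OF W(1) reldim_Suc.hyps(2) ij(3)] ij(1)
  show ?case by simp
qed

lemma reldim_exists:
  assumes "subspace U" "subspace W" "U \<subseteq> W" "finite A" "W \<subseteq> U + span A"
  shows "\<exists>n. reldim U n W"
proof -
  have "\<exists>n. reldim U n (U + span A)" using assms(4)
  proof (induction A)
    case empty
    have "U + span {} = U" by (simp add: set_zero[symmetric] del: set_zero)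
    then show ?case using reldim_0 by metis
  next
    case (insert a A)
    then obtain n where n: "reldim U n (U + span A)" by blast
    have "span (insert a A) = range (\<lambda>c. scale c a) + span A"
    proof
      show "span (insert a A) \<subseteq> range (\<lambda>c. scale c a) + span A"
      proof
        fix x assume "x \<in> span (insert a A)"
        then obtain k where "x - scale k a \<in> span A" unfolding span_insert by blast
        then have "scale k a + (x - scale k a) \<in> range (\<lambda>c. scale c a) + span A"
          by (intro set_plus_intro) auto
        then show "x \<in> range (\<lambda>c. scale c a) + span A" by simp
      qed
      show "range (\<lambda>c. scale c a) + span A \<subseteq> span (insert a A)"
      proof
        fix x assume "x \<in> range (\<lambda>c. scale c a) + span A"
        then obtain c y where "y \<in> span A" "x = scale c a + y" by (auto simp: set_plus_def)
        then show "x \<in> span (insert a A)" unfolding span_insert by (auto intro!: exI[of _ c])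
      qed
    qed
    then have eq: "U + span (insert a A) = (U + span A) + range (\<lambda>c. scale c a)"
      by (simp add: ac_simps)
    have ss: "subspace (U + span A)" by (intro subspace_plus assms(1)) simp
    show ?case
    proof (cases "a \<in> U + span A")
      case True
      then have "U + span (insert a A) = U + span A"
        unfolding eq using line_subset[OF ss subset_refl] line_superset by blast
      then show ?thesis using n by auto
    next
      case False
      from reldim_Suc[OF n this] show ?thesis unfolding eq by blast
    qed
  qed
  then obtain n where "reldim U n (U + span A)" by blast
  from reldim_split[OF this assms(1,2,3,5)] show ?thesis by blast
qed

text \<open>The last hypothesis says that \<open>\<phi>\<close> induces an injection of B/A into the
  whole space modulo \<open>U\<close>, so linear independence of the chain survives.\<close>

lemma reldim_map:
  assumes "reldim A n B" "subspace A" "subspace U"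
    and add: "\<And>x y. \<phi> (x + y) = \<phi> x + \<phi> y" and scl: "\<And>c x. \<phi> (scale c x) = scale c (\<phi> x)"
    and "\<And>b. b \<in> B \<Longrightarrow> \<phi> b \<in> U \<longleftrightarrow> b \<in> A"
  shows "reldim U n (\<phi> ` B + U)"
  using assms(1,2,6)
proof induction
  case reldim_0
  then have "\<phi> ` A \<subseteq> U" by blast
  moreover have "0 \<in> \<phi> ` A" using scl[of 0 0] subspace_0[OF reldim_0(1)] by (force simp: image_iff)
  ultimately have "\<phi> ` A + U = U"
    using subspace_add[OF assms(3)] set_zero_plus2[of "\<phi> ` A" U]
    by (auto simp: set_plus_def)
  then show ?case using reldim.reldim_0 by simp
next
  case (reldim_Suc n W v)
  have W: "subspace W" "A \<subseteq> W" using reldim_subspace reldim_Suc by blast+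
  have IH: "reldim U n (\<phi> ` W + U)" using reldim_Suc.IH reldim_Suc.prems line_superset by blast
  have "\<phi> v \<notin> \<phi> ` W + U"
  proof
    assume "\<phi> v \<in> \<phi> ` W + U"
    then obtain w u where w: "w \<in> W" "u \<in> U" "\<phi> v = \<phi> w + u" by (auto simp: set_plus_def)
    have mm: "\<phi> (scale (-1) w) = - \<phi> w" using scl[of "-1" w] by simp
    have "\<phi> (v + scale (-1) w) = u" unfolding add mm using w(3) by simp
    moreover have "v + scale (-1) w \<in> W + range (\<lambda>c. scale c v)"
      using subspace_scale[OF W(1) w(1), of "-1"] unfolding in_line
      by (intro bexI[of _ "scale (-1) w"] exI[of _ 1]) auto
    ultimately have "v + scale (-1) w \<in> A" using reldim_Suc.prems(2) w(2) by blast
    then have "(v + scale (-1) w) + w \<in> W" using W w(1) subspace_add by blast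
    then show False using reldim_Suc.hyps(2) by simp
  qed
  from reldim.reldim_Suc[OF IH this]
  have "reldim U (Suc n) (\<phi> ` W + U + range (\<lambda>c. scale c (\<phi> v)))" .
  moreover have "\<phi> ` (W + range (\<lambda>c. scale c v)) = \<phi> ` W + range (\<lambda>c. scale c (\<phi> v))"
  proof
    show "\<phi> ` (W + range (\<lambda>c. scale c v)) \<subseteq> \<phi> ` W + range (\<lambda>c. scale c (\<phi> v))"
      by (fastforce simp: in_line add scl)
    show "\<phi> ` W + range (\<lambda>c. scale c (\<phi> v)) \<subseteq> \<phi> ` (W + range (\<lambda>c. scale c v))"
    proof
      fix x assume "x \<in> \<phi> ` W + range (\<lambda>c. scale c (\<phi> v))"
      then obtain w c where "w \<in> W" "x = \<phi> (w + scale c v)" by (auto simp: in_line add scl)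
      then show "x \<in> \<phi> ` (W + range (\<lambda>c. scale c v))" using in_line by blast
    qed
  qed
  ultimately show ?case by (simp add: ac_simps)
qed

end

section \<open>Weierstrass division\<close>

text \<open>Abstracts the filtration by order, so that division can be proved one variable at a time
  while the order of the quotient is controlled.\<close>

definition filtration :: "(nat \<Rightarrow> 'a::comm_ring_1 set) \<Rightarrow> bool" where
  "filtration F \<longleftrightarrow> F 0 = UNIV \<and> (\<forall>m n. m \<le> n \<longrightarrow> F n \<subseteq> F m) \<and> (\<forall>n. 0 \<in> F n) \<and>
     (\<forall>n. \<forall>a\<in>F n. \<forall>b\<in>F n. a - b \<in> F n) \<and> (\<forall>m n. \<forall>a\<in>F m. \<forall>b\<in>F n. a * b \<in> F (m + n))"

text \<open>The new variable gets weight 1. Truncated subtraction makes the condition void for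
  \<open>j \<ge> n\<close>, since \<open>F 0\<close> is everything in a filtration.\<close>

definition fps_filtration :: "(nat \<Rightarrow> 'a::comm_ring_1 set) \<Rightarrow> nat \<Rightarrow> 'a fps set" where
  "fps_filtration F n = {f. \<forall>j. fps_nth f j \<in> F (n - j)}"

lemma filtrationD:
  assumes "filtration F"
  shows "a \<in> F 0" "m \<le> n \<Longrightarrow> F n \<subseteq> F m" "0 \<in> F n"
    and "a \<in> F n \<Longrightarrow> b \<in> F n \<Longrightarrow> a - b \<in> F n" "a \<in> F n \<Longrightarrow> b \<in> F n \<Longrightarrow> a + b \<in> F n"
    and "a \<in> F n \<Longrightarrow> - a \<in> F n"
    and "a \<in> F m \<Longrightarrow> b \<in> F n \<Longrightarrow> a * b \<in> F (m + n)"
proof -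
  show 0: "0 \<in> F n" and d: "\<And>a b. a \<in> F n \<Longrightarrow> b \<in> F n \<Longrightarrow> a - b \<in> F n"
    using assms by (auto simp: filtration_def)

  show "a \<in> F n \<Longrightarrow> - a \<in> F n" using d[OF 0, of a] by simp
  show "a \<in> F n \<Longrightarrow> b \<in> F n \<Longrightarrow> a + b \<in> F n" using d[of a "- b"] d[OF 0, of b] by simp
qed (use assms in \<open>auto simp: filtration_def\<close>)

lemma filtration_sum:
  assumes "filtration F" "\<And>i. i \<in> A \<Longrightarrow> g i \<in> F n"
  shows "sum g A \<in> F n"
  using assms(2) by (induction A rule: infinite_finite_induct) (auto intro: filtrationD[OF assms(1)])

lemma filtration_mult_le:
  assumes "filtration F" "a \<in> F m" "b \<in> F n" "k \<le> m + n"
  shows "a * b \<in> F k"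
  using filtrationD(7)[OF assms(1-3)] filtrationD(2)[OF assms(1,4)] by blast

lemma filtration_fps: "filtration F \<Longrightarrow> filtration (fps_filtration F)"
proof -
  assume F: "filtration F"
  note D = filtrationD[OF F]
  show ?thesis unfolding filtration_def fps_filtration_def
  proof (intro conjI allI impI ballI)
    show "{f. \<forall>j. fps_nth f j \<in> F (0 - j)} = UNIV" using D(1) by auto
    show "{f. \<forall>j. fps_nth f j \<in> F (n - j)} \<subseteq> {f. \<forall>j. fps_nth f j \<in> F (m - j)}" if "m \<le> n" for m n
      using D(2)[of "m - j" "n - j" for j] that by fastforce
    fix m n :: nat and a b
    assume a: "a \<in> {f. \<forall>j. fps_nth f j \<in> F (m - j)}" and b: "b \<in> {f. \<forall>j. fps_nth f j \<in> F (n - j)}"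
    have "fps_nth (a * b) j \<in> F (m + n - j)" for j
      unfolding fps_mult_nth
    proof (rule filtration_sum[OF F])
      fix i assume "i \<in> {0..j}"
      then show "fps_nth a i * fps_nth b (j - i) \<in> F (m + n - j)"
        using a b by (intro filtration_mult_le[OF F, of _ "m - i" _ "n - (j - i)"])
          (auto simp del: Nat.diff_diff_right)
    qed
    then show "a * b \<in> {f. \<forall>j. fps_nth f j \<in> F (m + n - j)}" by blast
  qed (use D(3,4) in auto)
qed

text \<open>\<open>C\<close> is the set of admissible remainders and 2 the order of the divisor. For
  \<open>C\<close> closed under differences, the second clause is uniqueness of the
  quotient.\<close>

definition has_division :: "(nat \<Rightarrow> 'a::comm_ring_1 set) \<Rightarrow> 'a set \<Rightarrow> 'a \<Rightarrow> bool" where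
  "has_division F C f \<longleftrightarrow> (\<forall>n. \<forall>a\<in>F n. \<exists>q\<in>F (n - 2). a - q * f \<in> C) \<and> (\<forall>q. q * f \<in> C \<longrightarrow> q = 0)"

lemmas [fundef_cong] = sum.cong

text \<open>Coefficients of the quotient, one after the other: the contribution of the earlier ones
  is subtracted and the rest is divided by the constant coefficient of \<open>f\<close> in the new
  variable. The choice carries the order bound because the next step relies on it.\<close>

function fps_quotient ::
  "(nat \<Rightarrow> 'a::comm_ring_1 set) \<Rightarrow> 'a set \<Rightarrow> 'a fps \<Rightarrow> 'a fps \<Rightarrow> nat \<Rightarrow> nat \<Rightarrow> 'a" where
  "fps_quotient F C f a n j = (SOME q. q \<in> F (n - 2 - j) \<and>
     fps_nth a j - (\<Sum>i<j. fps_quotient F C f a n i * fps_nth f (j - i)) - q * fps_nth f 0 \<in> C)"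
  by auto
termination by (relation "measure (\<lambda>(F, C, f, a, n, j). j)") auto

declare fps_quotient.simps [simp del]

text \<open>Comparing coefficients of the new variable gives a triangular system with
  \<open>fps_nth f 0\<close> on the diagonal, so it is enough to divide by that one
  coefficient.\<close>

lemma has_division_fps:
  assumes F: "filtration F" and C: "0 \<in> C" "\<And>a b. a \<in> C \<Longrightarrow> b \<in> C \<Longrightarrow> a - b \<in> C"
    and div: "has_division F C (fps_nth f 0)" and f: "f \<in> fps_filtration F 2"
  shows "has_division (fps_filtration F) {a. \<forall>j. fps_nth a j \<in> C} f"
  unfolding has_division_def
proof (intro conjI allI ballI impI)
  fix n a assume a: "a \<in> fps_filtration F n"
  define q where "q = fps_quotient F C f a n"
  have q: "q j \<in> F (n - 2 - j) \<and> fps_nth a j - (\<Sum>i<j. q i * fps_nth f (j - i)) - q j * fps_nth f 0 \<in> C" for j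
  proof (induction j rule: less_induct)
    case (less j)
    have "(\<Sum>i<j. q i * fps_nth f (j - i)) \<in> F (n - j)"
    proof (rule filtration_sum[OF F])
      fix i assume "i \<in> {..<j}"
      then show "q i * fps_nth f (j - i) \<in> F (n - j)"
        using less[of i] f
        by (intro filtration_mult_le[OF F, of _ "n - 2 - i" _ "2 - (j - i)"])
            (auto simp: fps_filtration_def simp del: Nat.diff_diff_right)
    qed
    then have "fps_nth a j - (\<Sum>i<j. q i * fps_nth f (j - i)) \<in> F (n - j)"
      using a by (intro filtrationD(4)[OF F]) (auto simp: fps_filtration_def)
    then obtain r where "r \<in> F (n - j - 2)"
      "fps_nth a j - (\<Sum>i<j. q i * fps_nth f (j - i)) - r * fps_nth f 0 \<in> C"
      using div unfolding has_division_def by blast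
    then have "\<exists>r. r \<in> F (n - 2 - j) \<and>
      fps_nth a j - (\<Sum>i<j. q i * fps_nth f (j - i)) - r * fps_nth f 0 \<in> C"
      by (metis diff_commute)
    from someI_ex[OF this] show ?case
      unfolding q_def by (subst (1 3) fps_quotient.simps) simp
  qed
  have "fps_nth (a - Abs_fps q * f) j \<in> C" for j
  proof -
    have "fps_nth (Abs_fps q * f) j = (\<Sum>i<j. q i * fps_nth f (j - i)) + q j * fps_nth f 0"
      unfolding fps_mult_nth by (simp add: atLeast0AtMost lessThan_Suc_atMost[symmetric])
    then show ?thesis using q[of j] by (simp add: algebra_simps)
  qed
  moreover have "Abs_fps q \<in> fps_filtration F (n - 2)" using q by (simp add: fps_filtration_def)
  ultimately show "\<exists>q\<in>fps_filtration F (n - 2). a - q * f \<in> {a. \<forall>j. fps_nth a j \<in> C}" by blast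
next
  fix q assume q: "q * f \<in> {a. \<forall>j. fps_nth a j \<in> C}"
  have "fps_nth q j = 0" for j
  proof (induction j rule: less_induct)
    case (less j)
    have "fps_nth (q * f) j = (\<Sum>i<j. fps_nth q i * fps_nth f (j - i)) + fps_nth q j * fps_nth f 0"
      unfolding fps_mult_nth by (simp add: atLeast0AtMost lessThan_Suc_atMost[symmetric])
    also have "(\<Sum>i<j. fps_nth q i * fps_nth f (j - i)) = 0" using less by (intro sum.neutral) auto
    finally have "fps_nth q j * fps_nth f 0 = fps_nth (q * f) j" by simp
    also have "\<dots> \<in> C" using q by blast
    finally have "fps_nth q j * fps_nth f 0 \<in> C" .
    then show ?case using div unfolding has_division_def by blast
  qed
  then show "q = 0" by (simp add: fps_eq_iff)
qed

definition field_filtration :: "nat \<Rightarrow> 'k::field set" where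
  "field_filtration n = (if n = 0 then UNIV else {0})"

lemma filtration_field: "filtration field_filtration"
  by (auto simp: filtration_def field_filtration_def)

lemma has_division_base:
  fixes f :: "'k::field fps"
  assumes "fps_nth f 0 = 0" "fps_nth f 1 = 0" "fps_nth f 2 \<noteq> 0"
  shows "has_division (fps_filtration field_filtration) {r. \<forall>i\<ge>2. fps_nth r i = 0} f"
proof -
  define u where "u = fps_shift 2 f"
  have f: "f = fps_X ^ 2 * u"
  proof (rule fps_ext)
    fix n
    have "Suc (Suc (n - 2)) = n" if "n \<noteq> 0" "n \<noteq> 1" using that by arith
    then show "fps_nth f n = fps_nth (fps_X ^ 2 * u) n"
      using assms by (cases "n = 0 \<or> n = 1") (auto simp: fps_X_power_mult_nth u_def)
  qed
  have u0: "fps_nth u 0 \<noteq> 0" using assms(3) by (simp add: u_def numeral_2_eq_2)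
  have u: "inverse u * u = 1" using inverse_mult_eq_1[OF u0] .
  show ?thesis unfolding has_division_def
  proof (intro conjI allI ballI impI)
    fix n and a :: "'k fps" assume a: "a \<in> fps_filtration field_filtration n"
    have z: "fps_nth a i = 0" if "i < n" for i
      using a that by (auto simp: fps_filtration_def field_filtration_def dest!: spec[of _ i])
    let ?q = "fps_shift 2 a * inverse u"
    have "?q * f = fps_X ^ 2 * fps_shift 2 a" unfolding f using u by (simp add: mult_ac)
    then have "fps_nth (?q * f) i = fps_nth a i" if "i \<ge> 2" for i
      using that le_add_diff_inverse2[OF that] by (simp only: fps_X_power_mult_nth fps_shift_nth) simp
    then have "a - ?q * f \<in> {r. \<forall>i\<ge>2. fps_nth r i = 0}" by simp
    moreover have "fps_nth ?q j \<in> field_filtration (n - 2 - j)" for j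
    proof (cases "n - 2 - j = 0")
      case False
      then have "fps_nth ?q j = 0"
        unfolding fps_mult_nth by (intro sum.neutral) (auto simp: z)
      then show ?thesis by (simp add: field_filtration_def)
    qed (simp add: field_filtration_def)
    ultimately show "\<exists>q\<in>fps_filtration field_filtration (n - 2). a - q * f \<in> {r. \<forall>i\<ge>2. fps_nth r i = 0}"
      unfolding fps_filtration_def by blast
  next
    fix q assume q: "q * f \<in> {r. \<forall>i\<ge>2. fps_nth r i = 0}"
    have "fps_nth (q * u) n = 0" for n
    proof -
      have "fps_nth (fps_X ^ 2 * (q * u)) (n + 2) = fps_nth (q * u) n" by (simp only: fps_X_power_mult_nth) simp
      moreover have "fps_X ^ 2 * (q * u) = q * f" unfolding f by (simp add: mult_ac)
      ultimately show ?thesis using q by simp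
    qed
    then have "q * u = 0" by (simp add: fps_eq_iff)
    moreover have "u \<noteq> 0" using u0 by auto
    ultimately show "q = 0" by simp
  qed
qed

section \<open>The powers of the maximal ideal of \<open>K[[x,y,z]]\<close>\<close>

text \<open>The n-th power of the maximal ideal is taken to be the series of order at least
  \<open>n\<close>, which makes order estimates immediate. The link with products of ideals is
  \<open>max_power_Suc_decompose\<close>.\<close>

definition max_power :: "nat \<Rightarrow> 'k::field ps3 set" where
  "max_power = fps_filtration (fps_filtration (fps_filtration field_filtration))"

lemma filtration_max_power: "filtration max_power"
  unfolding max_power_def by (intro filtration_fps filtration_field)

lemmas max_power_0 = filtrationD(1)[OF filtration_max_power]
  and max_power_mono = filtrationD(2)[OF filtration_max_power]
  and max_power_zero = filtrationD(3)[OF filtration_max_power]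
  and max_power_diff = filtrationD(4)[OF filtration_max_power]
  and max_power_add = filtrationD(5)[OF filtration_max_power]
  and max_power_uminus = filtrationD(6)[OF filtration_max_power]
  and max_power_mult = filtrationD(7)[OF filtration_max_power]
  and max_power_mult_le = filtration_mult_le[OF filtration_max_power]

lemma max_power_mult_right: "a \<in> max_power n \<Longrightarrow> a * r \<in> max_power n"
  using max_power_mult_le[of a n r 0] max_power_0 by auto

lemma max_power_mult_left: "a \<in> max_power n \<Longrightarrow> r * a \<in> max_power n"
  using max_power_mult_le[of r 0 a n] max_power_0 by auto

lemma max_power_iff: "f \<in> max_power n \<longleftrightarrow> (\<forall>i j l. i + j + l < n \<longrightarrow> ps3_coeff f i j l = 0)"
proof -
  have "f \<in> max_power n \<longleftrightarrow> (\<forall>l j i. ps3_coeff f i j l \<in> field_filtration (n - l - j - i))"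
    by (simp add: max_power_def fps_filtration_def ps3_coeff_def)
  also have "\<dots> \<longleftrightarrow> (\<forall>i j l. i + j + l < n \<longrightarrow> ps3_coeff f i j l = 0)"
    by (auto simp: field_filtration_def split: if_splits)
  finally show ?thesis .
qed

lemma ps3_eq_iff: "f = g \<longleftrightarrow> (\<forall>i j l. ps3_coeff f i j l = ps3_coeff g i j l)"
  by (auto simp: ps3_coeff_def fps_eq_iff)

lemma ps3_coeff_arith [simp]:
  "ps3_coeff (f + g) i j l = ps3_coeff f i j l + ps3_coeff g i j l"
  "ps3_coeff (f - g) i j l = ps3_coeff f i j l - ps3_coeff g i j l"
  "ps3_coeff (- f) i j l = - ps3_coeff f i j l"
  "ps3_coeff 0 i j l = 0"
  by (simp_all add: ps3_coeff_def)

lemma ps3_coeff_const_mult [simp]: "ps3_coeff (ps3_const c * f) i j l = c * ps3_coeff f i j l"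
  by (simp add: ps3_coeff_def ps3_const_def)

abbreviation "var_x \<equiv> (fps_const (fps_const fps_X) :: 'k::field ps3)"
abbreviation "var_y \<equiv> (fps_const fps_X :: 'k::field ps3)"
abbreviation "var_z \<equiv> (fps_X :: 'k::field ps3)"

lemma ps3_coeff_var_mult:
  "ps3_coeff (var_x * f) i j l = (if i = 0 then 0 else ps3_coeff f (i - 1) j l)"
  "ps3_coeff (var_y * f) i j l = (if j = 0 then 0 else ps3_coeff f i (j - 1) l)"
  "ps3_coeff (var_z * f) i j l = (if l = 0 then 0 else ps3_coeff f i j (l - 1))"
  by (simp_all add: ps3_coeff_def)

lemma var_max_power: "var_x \<in> max_power 1" "var_y \<in> max_power 1" "var_z \<in> max_power 1"
  by (auto simp: max_power_iff ps3_coeff_def)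

definition ps3_of :: "(nat \<Rightarrow> nat \<Rightarrow> nat \<Rightarrow> 'k) \<Rightarrow> 'k::field ps3" where
  "ps3_of c = Abs_fps (\<lambda>l. Abs_fps (\<lambda>j. Abs_fps (\<lambda>i. c i j l)))"

lemma ps3_coeff_of [simp]: "ps3_coeff (ps3_of c) i j l = c i j l"
  by (simp add: ps3_of_def ps3_coeff_def)

text \<open>Each monomial is charged to z if z divides it, otherwise to y if y does, and otherwise
  to x.\<close>

lemma max_power_Suc_decompose:
  assumes "f \<in> max_power (Suc n)"
  shows "\<exists>a\<in>max_power n. \<exists>b\<in>max_power n. \<exists>c\<in>max_power n. f = var_x * a + var_y * b + var_z * c"
proof -
  define c where "c = ps3_of (\<lambda>i j l. ps3_coeff f i j (Suc l))"
  define b where "b = ps3_of (\<lambda>i j l. if l = 0 then ps3_coeff f i (Suc j) 0 else 0)"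
  define a where "a = ps3_of (\<lambda>i j l. if l = 0 \<and> j = 0 then ps3_coeff f (Suc i) 0 0 else 0)"
  have z: "ps3_coeff f i j l = 0" if "i + j + l < Suc n" for i j l
    using assms that by (simp add: max_power_iff)
  have "a \<in> max_power n" "b \<in> max_power n" "c \<in> max_power n"
    by (auto simp: max_power_iff a_def b_def c_def z)
  moreover have "f = var_x * a + var_y * b + var_z * c"
    unfolding ps3_eq_iff using z[of 0 0 0]
    by (auto simp: ps3_coeff_var_mult a_def b_def c_def)
  ultimately show ?thesis by blast
qed

lemma ps3_max_ideal_eq: "ps3_max_ideal = (max_power 1 :: 'k::field ps3 set)"
proof -
  interpret R: cring "ps3_ring :: 'k ps3 ring" by (rule cring_from_type_algebra)
  have sub: "{var_x, var_y, var_z :: 'k ps3} \<subseteq> carrier ps3_ring" by (simp add: ring_of_type_algebra_def)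
  interpret M: ideal "ps3_max_ideal :: 'k ps3 set" ps3_ring
    unfolding ps3_max_ideal_def by (rule R.genideal_ideal[OF sub])
  have mem: "var_x \<in> (ps3_max_ideal :: 'k ps3 set)" "var_y \<in> (ps3_max_ideal :: 'k ps3 set)"
    "var_z \<in> (ps3_max_ideal :: 'k ps3 set)"
    using R.genideal_self[OF sub] by (auto simp: ps3_max_ideal_def)
  have add: "a + b \<in> ps3_max_ideal" if "a \<in> ps3_max_ideal" "b \<in> ps3_max_ideal" for a b :: "'k ps3"
    using M.a_closed[OF that] by (simp add: ring_of_type_algebra_def)
  have mult: "a * b \<in> ps3_max_ideal" if "a \<in> ps3_max_ideal" for a b :: "'k ps3"
    using M.I_r_closed[OF that, of b] by (simp add: ring_of_type_algebra_def)
  show ?thesis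
  proof
    have "ideal (max_power 1 :: 'k ps3 set) ps3_ring"
    proof (rule idealI[OF R.ring_axioms])
      show "subgroup (max_power 1 :: 'k ps3 set) (add_monoid ps3_ring)"
      proof (rule R.add.subgroupI)
        fix a :: "'k ps3" assume a: "a \<in> max_power 1"
        have "\<ominus>\<^bsub>ps3_ring\<^esub> a = - a"
          by (rule R.minus_equality) (simp_all add: ring_of_type_algebra_def)
        then show "\<ominus>\<^bsub>ps3_ring\<^esub> a \<in> max_power 1" using max_power_uminus[OF a] by simp
      qed (use max_power_zero[of 1] max_power_add[of _ 1] in \<open>auto simp: ring_of_type_algebra_def\<close>)
    qed (auto simp: ring_of_type_algebra_def max_power_mult_left max_power_mult_right)
    then show "ps3_max_ideal \<subseteq> (max_power 1 :: 'k ps3 set)"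
      unfolding ps3_max_ideal_def by (rule R.genideal_minimal) (use var_max_power in auto)
    show "(max_power 1 :: 'k ps3 set) \<subseteq> ps3_max_ideal"
    proof
      fix f :: "'k ps3" assume "f \<in> max_power 1"
      then obtain a b c where "f = var_x * a + var_y * b + var_z * c"
        using max_power_Suc_decompose[of f 0] by auto
      then show "f \<in> ps3_max_ideal" by (auto intro!: add mult mem)
    qed
  qed
qed

definition x_linear :: "'k::field ps3 set" where
  "x_linear = {r. \<forall>i\<ge>2. \<forall>j l. ps3_coeff r i j l = 0}"

text \<open>The base case is K[[x]], where \<open>f\<close> at y = z = 0 is a unit times x^2; then y
  and z are adjoined. The order bound on the quotient later makes normal forms respect powers of the
  maximal ideal.\<close>

theorem weierstrass_division:
  fixes f :: "'k::field ps3"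
  assumes "f \<in> max_power 2" "ps3_coeff f 2 0 0 \<noteq> 0"
  shows "a \<in> max_power n \<Longrightarrow> \<exists>q\<in>max_power (n - 2). a - q * f \<in> x_linear"
    and "q * f \<in> x_linear \<Longrightarrow> q = 0"
proof -
  let ?F1 = "fps_filtration field_filtration :: nat \<Rightarrow> 'k fps set"
  let ?C1 = "{r. \<forall>i\<ge>2. fps_nth r i = 0} :: 'k fps set"
  let ?C2 = "{a. \<forall>j. fps_nth a j \<in> ?C1}"
  note F1 = filtration_fps[OF filtration_field]
  have c: "ps3_coeff f i j l = 0" if "i + j + l < 2" for i j l
    using assms(1) that by (simp add: max_power_iff)
  have "has_division ?F1 ?C1 (fps_nth (fps_nth f 0) 0)"
    by (rule has_division_base) (use assms(2) c[of 0 0 0] c[of 1 0 0] in \<open>simp_all add: ps3_coeff_def\<close>)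
  moreover have "f \<in> fps_filtration (fps_filtration ?F1) 2"
    using assms(1) by (simp add: max_power_def)
  moreover from this have "fps_nth f 0 \<in> fps_filtration ?F1 2"
    unfolding fps_filtration_def[of "fps_filtration ?F1"] by (auto dest: spec[of _ 0])
  ultimately have "has_division (fps_filtration (fps_filtration ?F1)) {a. \<forall>j. fps_nth a j \<in> ?C2} f"
    by (intro has_division_fps filtration_fps F1) auto
  moreover have "{a. \<forall>j. fps_nth a j \<in> ?C2} = x_linear"
    by (auto simp: x_linear_def ps3_coeff_def)
  ultimately have "has_division max_power x_linear f" by (simp add: max_power_def)
  then show "a \<in> max_power n \<Longrightarrow> \<exists>q\<in>max_power (n - 2). a - q * f \<in> x_linear"
    and "q * f \<in> x_linear \<Longrightarrow> q = 0" unfolding has_division_def by blast+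
qed

section \<open>Automorphisms of \<open>K[[x,y,z]]\<close>\<close>

lemma fps_nth_sum2: "fps_nth (sum g A) n = (\<Sum>a\<in>A. fps_nth (g a) n)"
  by (induction A rule: infinite_finite_induct) auto

lemma ps3_coeff_mult:
  "ps3_coeff (f * g) i j l =
     (\<Sum>l'\<le>l. \<Sum>j'\<le>j. \<Sum>i'\<le>i. ps3_coeff f i' j' l' * ps3_coeff g (i - i') (j - j') (l - l'))"
  by (simp add: ps3_coeff_def fps_mult_nth fps_nth_sum2 atLeast0AtMost)

lemma ps3_coeff_sum: "ps3_coeff (sum g A) i j l = (\<Sum>a\<in>A. ps3_coeff (g a) i j l)"
  by (induction A rule: infinite_finite_induct) auto

lemma ps3_coeff_const: "ps3_coeff (ps3_const c) i j l = (if i = 0 \<and> j = 0 \<and> l = 0 then c else 0)"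
  by (simp add: ps3_coeff_def ps3_const_def)

definition ps3_aut :: "('k::field ps3 \<Rightarrow> 'k ps3) \<Rightarrow> bool" where
  "ps3_aut \<sigma> \<longleftrightarrow> bij \<sigma> \<and> (\<forall>f g. \<sigma> (f + g) = \<sigma> f + \<sigma> g) \<and> (\<forall>f g. \<sigma> (f * g) = \<sigma> f * \<sigma> g) \<and>
     (\<forall>c. \<sigma> (ps3_const c) = ps3_const c) \<and> (\<forall>n f. \<sigma> f \<in> max_power n \<longleftrightarrow> f \<in> max_power n)"

lemma ps3_autD:
  assumes "ps3_aut \<sigma>"
  shows "bij \<sigma>" "\<sigma> (f + g) = \<sigma> f + \<sigma> g" "\<sigma> (f * g) = \<sigma> f * \<sigma> g" "\<sigma> (ps3_const c) = ps3_const c"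
    and "\<sigma> f \<in> max_power n \<longleftrightarrow> f \<in> max_power n" "\<sigma> 0 = 0" "\<sigma> (- f) = - \<sigma> f" "\<sigma> (f - g) = \<sigma> f - \<sigma> g"
proof -
  show add: "\<sigma> (f + g) = \<sigma> f + \<sigma> g" for f g using assms by (simp add: ps3_aut_def)
  show 0: "\<sigma> 0 = 0" using add[of 0 0] by (metis add.right_neutral add_left_cancel)
  show um: "\<sigma> (- f) = - \<sigma> f" for f using add[of f "- f"] 0 by (simp add: eq_neg_iff_add_eq_0 add.commute)
  show "\<sigma> (f - g) = \<sigma> f - \<sigma> g" using add[of f "- g"] um[of g] by simp
qed (use assms in \<open>auto simp: ps3_aut_def\<close>)

lemma ps3_aut_comp: "ps3_aut \<sigma> \<Longrightarrow> ps3_aut \<tau> \<Longrightarrow> ps3_aut (\<sigma> \<circ> \<tau>)"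
  by (auto simp: ps3_aut_def bij_comp)

lemma ps3_aut_id: "ps3_aut id"
  by (auto simp: ps3_aut_def)

definition swap_xy :: "'k::field ps3 \<Rightarrow> 'k ps3" where
  "swap_xy f = ps3_of (\<lambda>i j l. ps3_coeff f j i l)"

definition swap_xz :: "'k::field ps3 \<Rightarrow> 'k ps3" where
  "swap_xz f = ps3_of (\<lambda>i j l. ps3_coeff f l j i)"

lemma ps3_aut_swap_xy: "ps3_aut (swap_xy :: 'k::field ps3 \<Rightarrow> _)"
proof -
  have inv: "swap_xy (swap_xy f) = f" for f :: "'k ps3" by (simp add: swap_xy_def ps3_eq_iff)
  have "bij (swap_xy :: 'k ps3 \<Rightarrow> _)"
    by (rule bij_betw_byWitness[of _ swap_xy]) (auto simp: inv)
  moreover have "swap_xy (f * g) = swap_xy f * swap_xy g" for f g :: "'k ps3"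
    unfolding ps3_eq_iff swap_xy_def ps3_coeff_of ps3_coeff_mult
    by (intro allI sum.cong refl sum.swap)
  moreover have "swap_xy f \<in> max_power n \<longleftrightarrow> f \<in> max_power n" for f :: "'k ps3" and n
    unfolding max_power_iff swap_xy_def by (simp, metis add.commute)
  ultimately show ?thesis
    by (auto simp: ps3_aut_def ps3_eq_iff swap_xy_def ps3_coeff_const)
qed

lemma ps3_aut_swap_xz: "ps3_aut (swap_xz :: 'k::field ps3 \<Rightarrow> _)"
proof -
  have inv: "swap_xz (swap_xz f) = f" for f :: "'k ps3" by (simp add: swap_xz_def ps3_eq_iff)
  have "bij (swap_xz :: 'k ps3 \<Rightarrow> _)"
    by (rule bij_betw_byWitness[of _ swap_xz]) (auto simp: inv)
  moreover have "swap_xz (f * g) = swap_xz f * swap_xz g" for f g :: "'k ps3"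
    unfolding ps3_eq_iff
  proof (intro allI)
    fix i j l
    let ?t = "\<lambda>i' j' l'. ps3_coeff f i' j' l' * ps3_coeff g (l - i') (j - j') (i - l')"
    have "(\<Sum>l'\<le>i. \<Sum>j'\<le>j. \<Sum>i'\<le>l. ?t i' j' l') = (\<Sum>j'\<le>j. \<Sum>l'\<le>i. \<Sum>i'\<le>l. ?t i' j' l')"
      by (rule sum.swap)
    also have "\<dots> = (\<Sum>j'\<le>j. \<Sum>i'\<le>l. \<Sum>l'\<le>i. ?t i' j' l')"
      by (intro sum.cong refl sum.swap)
    also have "\<dots> = (\<Sum>i'\<le>l. \<Sum>j'\<le>j. \<Sum>l'\<le>i. ?t i' j' l')"
      by (rule sum.swap)
    finally show "ps3_coeff (swap_xz (f * g)) i j l = ps3_coeff (swap_xz f * swap_xz g) i j l"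
      unfolding swap_xz_def ps3_coeff_of ps3_coeff_mult .
  qed
  moreover have "swap_xz f \<in> max_power n \<longleftrightarrow> f \<in> max_power n" for f :: "'k ps3" and n
    unfolding max_power_iff swap_xz_def by (simp, metis add.commute add.left_commute)
  ultimately show ?thesis
    by (auto simp: ps3_aut_def ps3_eq_iff swap_xz_def ps3_coeff_const)
qed

text \<open>The substitution \<open>y \<mapsto> y + \<alpha> z\<close> is \<open>exp (\<alpha> z \<partial>/\<partial>y)\<close>; \<open>taylor_coeff \<alpha> m\<close> is \<open>\<alpha>\<^sup>m/m! (\<partial>/\<partial>y)\<^sup>m\<close>.\<close>

definition taylor_coeff :: "'k::field \<Rightarrow> nat \<Rightarrow> 'k fps fps \<Rightarrow> 'k fps fps" where
  "taylor_coeff \<alpha> m g =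
     Abs_fps (\<lambda>j. fps_const (of_nat ((j + m) choose m) * \<alpha> ^ m) * fps_nth g (j + m))"

definition shear :: "'k::field \<Rightarrow> 'k ps3 \<Rightarrow> 'k ps3" where
  "shear \<alpha> f = Abs_fps (\<lambda>l. \<Sum>m\<le>l. taylor_coeff \<alpha> m (fps_nth f (l - m)))"

lemma ps3_coeff_shear:
  "ps3_coeff (shear \<alpha> f) i j l =
     (\<Sum>m\<le>l. of_nat ((j + m) choose m) * \<alpha> ^ m * ps3_coeff f i (j + m) (l - m))"
  by (simp add: ps3_coeff_def shear_def taylor_coeff_def fps_nth_sum2)

lemma taylor_coeff_Suc:
  "of_nat (Suc m) * taylor_coeff \<alpha> (Suc m) g =
     fps_const (fps_const \<alpha>) * fps_deriv (taylor_coeff \<alpha> m g)"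
proof (rule fps_ext)
  fix j
  have "Suc m * (Suc (j + m) choose Suc m) = Suc j * ((Suc j + m) choose m)"
    using Suc_times_binomial_add[of m j] by (simp add: add_ac)
  then have "of_nat (Suc m) * (of_nat (Suc (j + m) choose Suc m) :: 'a) = of_nat (Suc j) * of_nat ((Suc j + m) choose m)"
    by (metis of_nat_mult)
  then show "fps_nth (of_nat (Suc m) * taylor_coeff \<alpha> (Suc m) g) j =
    fps_nth (fps_const (fps_const \<alpha>) * fps_deriv (taylor_coeff \<alpha> m g)) j"
    by (simp add: taylor_coeff_def fps_of_nat[symmetric] mult.assoc[symmetric] del: of_nat_Suc binomial_Suc_Suc)
qed

lemma taylor_coeff_add: "taylor_coeff \<alpha> m (g + h) = taylor_coeff \<alpha> m g + taylor_coeff \<alpha> m h"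
  by (rule fps_ext) (simp add: taylor_coeff_def algebra_simps)

lemma taylor_coeff_sum: "taylor_coeff \<alpha> m (sum g A) = (\<Sum>a\<in>A. taylor_coeff \<alpha> m (g a))"
proof -
  have "taylor_coeff \<alpha> m 0 = 0" by (rule fps_ext) (simp add: taylor_coeff_def)
  then show ?thesis
    by (induction A rule: infinite_finite_induct) (simp_all add: taylor_coeff_add)
qed

text \<open>This is the Leibniz rule for divided powers. In the induction, differentiating once more
  costs a factor \<open>Suc m\<close> by \<open>taylor_coeff_Suc\<close>, and characteristic zero
  cancels it.\<close>

lemma taylor_coeff_mult:
  fixes g h :: "'k::field_char_0 fps fps"
  shows "taylor_coeff \<alpha> m (g * h) = (\<Sum>i\<le>m. taylor_coeff \<alpha> i g * taylor_coeff \<alpha> (m - i) h)"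
proof (induction m)
  case 0
  have "taylor_coeff \<alpha> 0 g = g" for g by (rule fps_ext) (simp add: taylor_coeff_def)
  then show ?case by simp
next
  case (Suc m)
  let ?d = "taylor_coeff \<alpha>" and ?a = "fps_const (fps_const \<alpha>) :: 'k fps fps"
  have S: "?a * fps_deriv (?d i u) = of_nat (Suc i) * ?d (Suc i) u" for i u
    by (rule taylor_coeff_Suc[symmetric])
  have "of_nat (Suc m) * ?d (Suc m) (g * h) = ?a * fps_deriv (\<Sum>i\<le>m. ?d i g * ?d (m - i) h)"
    unfolding taylor_coeff_Suc Suc.IH ..
  also have "\<dots> = (\<Sum>i\<le>m. (?a * fps_deriv (?d i g)) * ?d (m - i) h + ?d i g * (?a * fps_deriv (?d (m - i) h)))"
    by (simp add: fps_deriv_sum sum_distrib_left algebra_simps)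
  also have "\<dots> = (\<Sum>i\<le>m. of_nat (Suc i) * (?d (Suc i) g * ?d (m - i) h)) +
      (\<Sum>i\<le>m. of_nat (Suc (m - i)) * (?d i g * ?d (Suc (m - i)) h))"
    unfolding S sum.distrib by (simp add: mult_ac)
  also have "(\<Sum>i\<le>m. of_nat (Suc i) * (?d (Suc i) g * ?d (m - i) h)) =
      (\<Sum>i\<le>Suc m. of_nat i * (?d i g * ?d (Suc m - i) h))"
    unfolding sum.atMost_Suc_shift by simp
  also have "(\<Sum>i\<le>m. of_nat (Suc (m - i)) * (?d i g * ?d (Suc (m - i)) h)) =
      (\<Sum>i\<le>Suc m. of_nat (Suc m - i) * (?d i g * ?d (Suc m - i) h))"
    unfolding sum.atMost_Suc by (simp add: Suc_diff_le)
  also have "(\<Sum>i\<le>Suc m. of_nat i * (?d i g * ?d (Suc m - i) h)) +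
      (\<Sum>i\<le>Suc m. of_nat (Suc m - i) * (?d i g * ?d (Suc m - i) h)) =
      (\<Sum>i\<le>Suc m. of_nat (Suc m) * (?d i g * ?d (Suc m - i) h))"
    unfolding sum.distrib[symmetric]
  proof (rule sum.cong[OF refl])
    fix i assume "i \<in> {..Suc m}"
    then have "(of_nat (Suc m) :: 'k fps fps) = of_nat i + of_nat (Suc m - i)"
      by (metis atMost_iff le_add_diff_inverse of_nat_add)
    then show "of_nat i * (?d i g * ?d (Suc m - i) h) + of_nat (Suc m - i) * (?d i g * ?d (Suc m - i) h) =
      of_nat (Suc m) * (?d i g * ?d (Suc m - i) h)" by (simp only: distrib_right)
  qed
  finally have "of_nat (Suc m) * ?d (Suc m) (g * h) =
    of_nat (Suc m) * (\<Sum>i\<le>Suc m. ?d i g * ?d (Suc m - i) h)"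
    by (simp only: sum_distrib_left)
  then show ?case unfolding mult_cancel_left of_nat_eq_0_iff by simp
qed

lemma shear_mult:
  fixes f g :: "'k::field_char_0 ps3"
  shows "shear \<alpha> (f * g) = shear \<alpha> f * shear \<alpha> g"
proof (rule fps_ext)
  fix l
  let ?d = "taylor_coeff \<alpha>"
  have "fps_nth (shear \<alpha> (f * g)) l =
    (\<Sum>m\<le>l. \<Sum>i\<le>l - m. \<Sum>p\<le>m. ?d p (fps_nth f i) * ?d (m - p) (fps_nth g (l - m - i)))"
    by (simp add: shear_def fps_mult_nth taylor_coeff_sum taylor_coeff_mult atLeast0AtMost)
  also have "\<dots> = (\<Sum>(m, i, p) \<in> (SIGMA m:{..l}. SIGMA i:{..l-m}. {..m}).
      ?d p (fps_nth f i) * ?d (m - p) (fps_nth g (l - m - i)))"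
    by (simp add: sum.Sigma)
  \<comment> \<open>\<open>s = p + i\<close> is the degree in z contributed by the factor
    \<open>f\<close>: \<open>p\<close> comes from the substitution and \<open>i\<close> from
    \<open>f\<close> itself.\<close>
  also have "\<dots> = (\<Sum>(s, p, q) \<in> (SIGMA s:{..l}. SIGMA p:{..s}. {..l-s}).
      ?d p (fps_nth f (s - p)) * ?d q (fps_nth g (l - s - q)))"
    by (rule sum.reindex_bij_witness[where i = "\<lambda>(s, p, q). (p + q, s - p, p)"
        and j = "\<lambda>(m, i, p). (p + i, p, m - p)"]) (auto simp: algebra_simps)
  also have "\<dots> = (\<Sum>s\<le>l. \<Sum>p\<le>s. \<Sum>q\<le>l-s. ?d p (fps_nth f (s - p)) * ?d q (fps_nth g (l - s - q)))"
    by (simp add: sum.Sigma)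
  also have "\<dots> = fps_nth (shear \<alpha> f * shear \<alpha> g) l"
    by (simp add: shear_def fps_mult_nth sum_product atLeast0AtMost)
  finally show "fps_nth (shear \<alpha> (f * g)) l = fps_nth (shear \<alpha> f * shear \<alpha> g) l" .
qed

text \<open>Collecting the double sum by \<open>s = m + k\<close> produces the binomial expansion of
  the s-th power of \<open>\<alpha> + \<beta>\<close>. The purpose is to have
  \<open>shear (- \<alpha>)\<close> as inverse of \<open>shear \<alpha>\<close>.\<close>

lemma shear_shear: "shear \<alpha> (shear \<beta> f) = shear (\<alpha> + \<beta>) (f :: 'k::field_char_0 ps3)"
  unfolding ps3_eq_iff
proof (intro allI)
  fix i j l
  have ch: "((j + m) choose m) * ((j + m + k) choose k) = ((j + (m + k)) choose (m + k)) * ((m + k) choose m)" for m k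
  proof -
    have "(j + (m + k) choose (m + k)) * ((m + k) choose m) = (j + (m + k) choose m) * ((j + (m + k) - m) choose ((m + k) - m))"
      by (rule choose_mult) auto
    also have "\<dots> = (j + m + k choose m) * ((j + k) choose k)" by (simp add: add_ac)
    also have "\<dots> = ((j + m + k) choose k) * ((j + m) choose m)"
      using choose_mult[of k "k + m" "j + m + k"] choose_mult[of m "k + m" "j + m + k"]
      by (simp add: add_ac binomial_symmetric[of k "k + m"])
    finally show ?thesis by simp
  qed
  let ?T = "\<lambda>m k. of_nat ((j + (m + k)) choose (m + k)) * (of_nat ((m + k) choose m) * \<alpha> ^ m * \<beta> ^ k) * ps3_coeff f i (j + (m + k)) (l - (m + k))"
  have "ps3_coeff (shear \<alpha> (shear \<beta> f)) i j l = (\<Sum>m\<le>l. \<Sum>k\<le>l-m. ?T m k)"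
    unfolding ps3_coeff_shear sum_distrib_left
  proof (intro sum.cong refl)
    fix m k
    have "(of_nat ((j + m) choose m) :: 'k) * of_nat ((j + m + k) choose k) = of_nat ((j + (m + k)) choose (m + k)) * of_nat ((m + k) choose m)"
      using ch[of m k] by (metis of_nat_mult)
    then show "of_nat (j + m choose m) * \<alpha> ^ m * (of_nat (j + m + k choose k) * \<beta> ^ k * ps3_coeff f i (j + m + k) (l - m - k)) = ?T m k"
      by (simp add: add.assoc diff_diff_eq)
  qed
  also have "\<dots> = (\<Sum>(m, k) \<in> {(m, k). m + k \<le> l}. ?T m k)"
    by (subst sum.Sigma) (auto intro!: sum.cong)
  also have "\<dots> = (\<Sum>s\<le>l. \<Sum>m\<le>s. ?T m (s - m))" by (rule sum.triangle_reindex_eq)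
  also have "\<dots> = ps3_coeff (shear (\<alpha> + \<beta>) f) i j l"
    unfolding ps3_coeff_shear binomial_ring sum_distrib_left sum_distrib_right
    by (intro sum.cong refl) simp
  finally show "ps3_coeff (shear \<alpha> (shear \<beta> f)) i j l = ps3_coeff (shear (\<alpha> + \<beta>) f) i j l" .
qed

lemma shear_0: "shear 0 f = f"
  unfolding ps3_eq_iff ps3_coeff_shear
proof (intro allI)
  fix i j l
  have "(\<Sum>m\<le>l. of_nat ((j + m) choose m) * 0 ^ m * ps3_coeff f i (j + m) (l - m)) =
    (\<Sum>m\<in>{0}. of_nat ((j + m) choose m) * 0 ^ m * ps3_coeff f i (j + m) (l - m))"
    by (rule sum.mono_neutral_right) auto
  then show "(\<Sum>m\<le>l. of_nat ((j + m) choose m) * 0 ^ m * ps3_coeff f i (j + m) (l - m)) = ps3_coeff f i j l"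
    by simp
qed

lemma ps3_aut_shear: "ps3_aut (shear \<alpha> :: 'k::field_char_0 ps3 \<Rightarrow> _)"
proof -
  have "bij (shear \<alpha> :: 'k ps3 \<Rightarrow> _)"
    by (rule bij_betw_byWitness[of _ "shear (- \<alpha>)"]) (auto simp: shear_shear shear_0)
  moreover have "shear \<alpha> (f + g) = shear \<alpha> f + shear \<alpha> g" for f g :: "'k ps3"
    unfolding ps3_eq_iff by (simp add: ps3_coeff_shear algebra_simps sum.distrib)
  moreover have mp: "shear \<beta> f \<in> max_power n" if "f \<in> max_power n" for f :: "'k ps3" and \<beta> n
    using that unfolding max_power_iff ps3_coeff_shear by (intro allI impI sum.neutral ballI) simp
  have "shear \<alpha> f \<in> max_power n \<longleftrightarrow> f \<in> max_power n" for f :: "'k ps3" and n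
    using mp[of f n \<alpha>] mp[of "shear \<alpha> f" n "- \<alpha>"] by (auto simp: shear_shear shear_0)
  moreover have "shear \<alpha> (ps3_const c) = (ps3_const c :: 'k ps3)" for c
  proof -
    have "(\<Sum>m\<le>l. of_nat ((j + m) choose m) * \<alpha> ^ m * ps3_coeff (ps3_const c :: 'k ps3) i (j + m) (l - m)) =
      (\<Sum>m\<in>{0}. of_nat ((j + m) choose m) * \<alpha> ^ m * ps3_coeff (ps3_const c :: 'k ps3) i (j + m) (l - m))" for i j l
      by (rule sum.mono_neutral_right) (auto simp: ps3_coeff_const)
    then show ?thesis unfolding ps3_eq_iff ps3_coeff_shear by simp
  qed
  ultimately show ?thesis by (simp add: ps3_aut_def shear_mult)
qed

section \<open>A parameter transversal to the tangent cone\<close>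

text \<open>In terms of \<open>A = K[[x,y,z]]/I\<close> with maximal ideal \<open>m\<close>: \<open>l\<close> is a nonzerodivisor on \<open>A\<close>;
  \<open>m\<^sup>N\<^sup>+\<^sup>1 = l m\<^sup>N\<close> for some \<open>N\<close>; the map \<open>m\<^sup>n\<^sup>-\<^sup>1/m\<^sup>n \<rightarrow> m\<^sup>n/m\<^sup>n\<^sup>+\<^sup>1\<close> given by \<open>l\<close> has corank at most \<open>1\<close>
  for \<open>n \<ge> b\<close>; and it is injective for \<open>n < b\<close>.\<close>

definition transversal_parameter :: "'k::field ps3 set \<Rightarrow> nat \<Rightarrow> 'k ps3 \<Rightarrow> bool" where
  "transversal_parameter I b l \<longleftrightarrow> l \<in> max_power 1 \<and> (\<forall>a. l * a \<in> I \<longrightarrow> a \<in> I) \<and>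
     (\<exists>N. \<forall>a\<in>max_power (Suc N). \<exists>c\<in>max_power N. a - l * c \<in> I) \<and>
     (\<forall>n\<ge>b. \<exists>w\<in>max_power n. \<forall>a\<in>max_power n. \<exists>c\<in>max_power (n - 1). \<exists>k. \<exists>i\<in>I.
        a - l * c - ps3_const k * w - i \<in> max_power (Suc n)) \<and>
     (\<forall>n. Suc n < b \<longrightarrow> (\<forall>a\<in>max_power n. \<forall>i\<in>I. l * a - i \<in> max_power (n + 2) \<longrightarrow>
        (\<exists>i'\<in>I. a - i' \<in> max_power (Suc n))))"

lemma transversal_parameter_aut:
  assumes s: "ps3_aut \<sigma>" and t: "transversal_parameter (\<sigma> ` I) b (\<sigma> l)"
  shows "transversal_parameter I b l"
proof -
  note D = ps3_autD[OF s]
  have inj: "\<sigma> u \<in> \<sigma> ` I \<longleftrightarrow> u \<in> I" for u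
    using D(1) by (simp add: bij_is_inj inj_image_mem_iff)
  have surj: "\<exists>u. v = \<sigma> u" for v using D(1) by (meson bij_is_surj surjD)
  note T = t[unfolded transversal_parameter_def]
  show ?thesis
    unfolding transversal_parameter_def
  proof (intro conjI allI impI ballI)
    show "l \<in> max_power 1" using T D(5) by blast
    show "a \<in> I" if "l * a \<in> I" for a
      using T that inj D(3) by metis
    obtain N where N: "\<forall>a\<in>max_power (Suc N). \<exists>c\<in>max_power N. a - \<sigma> l * c \<in> \<sigma> ` I" using T by blast
    have "\<exists>c\<in>max_power N. a - l * c \<in> I" if a: "a \<in> max_power (Suc N)" for a
    proof -
      obtain c where c: "\<sigma> c \<in> max_power N" "\<sigma> a - \<sigma> l * \<sigma> c \<in> \<sigma> ` I"
        using N[rule_format, of "\<sigma> a"] D(5) a surj by metis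
      have "\<sigma> (a - l * c) \<in> \<sigma> ` I" unfolding D(8) D(3) by (rule c(2))
      then show ?thesis using c(1) D(5) inj by blast
    qed
    then show "\<exists>N. \<forall>a\<in>max_power (Suc N). \<exists>c\<in>max_power N. a - l * c \<in> I" by blast
  next
    fix n assume "b \<le> n"
    then obtain w where w: "\<sigma> w \<in> max_power n" and *: "\<forall>a\<in>max_power n. \<exists>c\<in>max_power (n - 1). \<exists>k. \<exists>i\<in>\<sigma> ` I.
        a - \<sigma> l * c - ps3_const k * \<sigma> w - i \<in> max_power (Suc n)"
      using T surj by metis
    have "\<exists>c\<in>max_power (n - 1). \<exists>k. \<exists>i\<in>I. a - l * c - ps3_const k * w - i \<in> max_power (Suc n)"
      if a: "a \<in> max_power n" for a
    proof -
      obtain c k i where c: "\<sigma> c \<in> max_power (n - 1)" "\<sigma> i \<in> \<sigma> ` I"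
        "\<sigma> a - \<sigma> l * \<sigma> c - ps3_const k * \<sigma> w - \<sigma> i \<in> max_power (Suc n)"
        using *[rule_format, of "\<sigma> a"] D(5) a surj by metis
      have "\<sigma> (a - l * c - ps3_const k * w - i) \<in> max_power (Suc n)"
        unfolding D(8) D(3) D(4) by (rule c(3))
      then show ?thesis using c(1,2) D(5) inj by blast
    qed
    then show "\<exists>w\<in>max_power n. \<forall>a\<in>max_power n. \<exists>c\<in>max_power (n - 1). \<exists>k. \<exists>i\<in>I.
      a - l * c - ps3_const k * w - i \<in> max_power (Suc n)" using w D(5) by blast
  next
    fix n a i assume n: "Suc n < b" and a: "a \<in> max_power n" and i: "i \<in> I" "l * a - i \<in> max_power (n + 2)"
    have "\<sigma> (l * a - i) \<in> max_power (n + 2)" using i(2) D(5) by blast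
    then have "\<sigma> l * \<sigma> a - \<sigma> i \<in> max_power (n + 2)" unfolding D(8) D(3) .
    moreover have "\<sigma> a \<in> max_power n" "\<sigma> i \<in> \<sigma> ` I" using a i(1) D(5) by auto
    ultimately have "\<exists>i'\<in>\<sigma> ` I. \<sigma> a - i' \<in> max_power (Suc n)" using T n by blast
    then obtain i' where "i' \<in> I" "\<sigma> (a - i') \<in> max_power (Suc n)" unfolding D(8) by blast
    then show "\<exists>i'\<in>I. a - i' \<in> max_power (Suc n)" using D(5) by blast
  qed
qed

section \<open>Normal forms over K[[y,z]] and division in K[[z]]\<close>

definition x_free :: "'k::field ps3 set" where
  "x_free = {s. \<forall>i\<ge>1. \<forall>j l. ps3_coeff s i j l = 0}"

lemma x_free_arith:
  assumes "s \<in> x_free" "t \<in> x_free"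
  shows "s + t \<in> x_free" "s - t \<in> x_free" "s * t \<in> x_free"
proof -
  show "s * t \<in> x_free"
    unfolding x_free_def
  proof (intro CollectI allI impI)
    fix i j l :: nat assume "1 \<le> i"
    have "ps3_coeff s i' j' l' * ps3_coeff t (i - i') (j - j') (l - l') = 0" for i' j' l'
      using assms \<open>1 \<le> i\<close> unfolding x_free_def by (cases "i' = 0") auto
    then show "ps3_coeff (s * t) i j l = 0" unfolding ps3_coeff_mult by (intro sum.neutral ballI)
  qed
qed (use assms in \<open>auto simp: x_free_def\<close>)

lemma ps3_coeff_mult_var_x:
  "ps3_coeff (f * var_x) i j l = (if i = 0 then 0 else ps3_coeff f (i - 1) j l)"
  by (subst mult.commute) (rule ps3_coeff_var_mult)

lemma x_linear_decompose:
  assumes "r \<in> x_linear" "r \<in> max_power n"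
  shows "\<exists>s\<in>x_free \<inter> max_power n. \<exists>t\<in>x_free \<inter> max_power (n - 1). r = s + t * var_x"
proof -
  define s where "s = ps3_of (\<lambda>i j l. if i = 0 then ps3_coeff r 0 j l else 0)"
  define t where "t = ps3_of (\<lambda>i j l. if i = 0 then ps3_coeff r 1 j l else 0)"
  have z: "ps3_coeff r i j l = 0" if "i + j + l < n" for i j l
    using assms(2) that by (simp add: max_power_iff)
  have "s \<in> x_free \<inter> max_power n" "t \<in> x_free \<inter> max_power (n - 1)"
    by (auto simp: x_free_def max_power_iff s_def t_def z)
  moreover have "r = s + t * var_x"
    unfolding ps3_eq_iff
  proof (intro allI)
    fix i j l :: nat
    consider "i = 0" | "i = 1" | "i \<ge> 2" by linarith
    then show "ps3_coeff r i j l = ps3_coeff (s + t * var_x) i j l"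
      using assms(1) by cases (auto simp: ps3_coeff_mult_var_x s_def t_def x_linear_def)
  qed
  ultimately show ?thesis by blast
qed

lemma x_free_linear:
  assumes "s \<in> x_free" "t \<in> x_free"
  shows "s + t * var_x \<in> x_linear"
    and "s + t * var_x = 0 \<Longrightarrow> s = 0 \<and> t = 0"
proof -
  have c: "ps3_coeff (s + t * var_x) i j l = ps3_coeff s i j l + (if i = 0 then 0 else ps3_coeff t (i - 1) j l)" for i j l
    by (simp add: ps3_coeff_mult_var_x)
  show "s + t * var_x \<in> x_linear" using assms by (auto simp: x_linear_def ps3_coeff_mult_var_x x_free_def)
  assume *: "s + t * var_x = 0"
  have "ps3_coeff s i j l = 0" for i j l
    using c[of 0 j l] assms(1) * by (cases "i = 0") (auto simp: x_free_def)
  moreover have "ps3_coeff t i j l = 0" for i j l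
    using c[of 1 j l] assms * by (cases "i = 0") (auto simp: x_free_def)
  ultimately show "s = 0 \<and> t = 0" by (simp add: ps3_eq_iff)
qed

lemma weierstrass_normal_form:
  fixes f :: "'k::field ps3"
  assumes f: "f \<in> max_power 2" "ps3_coeff f 2 0 0 \<noteq> 0" and v: "v \<in> max_power m"
  shows "\<exists>s\<in>x_free \<inter> max_power m. \<exists>t\<in>x_free \<inter> max_power (m - 1). \<exists>u\<in>max_power (m - 2).
    v = u * f + s + t * var_x"
proof -
  obtain u where u: "u \<in> max_power (m - 2)" "v - u * f \<in> x_linear"
    using weierstrass_division(1)[OF f v] by blast
  have "u * f \<in> max_power m" by (rule max_power_mult_le[OF u(1) f(1)]) simp
  then have "v - u * f \<in> max_power m" using max_power_diff v by blast
  from x_linear_decompose[OF u(2) this] obtain s t where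
    "s \<in> x_free \<inter> max_power m" "t \<in> x_free \<inter> max_power (m - 1)" "v - u * f = s + t * var_x" by blast
  moreover from this(3) have "v = u * f + s + t * var_x" by (simp add: algebra_simps)
  ultimately show ?thesis using u(1) by blast
qed

definition z_only :: "'k::field ps3 set" where
  "z_only = {s. \<forall>i j l. (i, j) \<noteq> (0, 0) \<longrightarrow> ps3_coeff s i j l = 0}"

lemma x_free_decompose:
  assumes "s \<in> x_free" "s \<in> max_power n"
  shows "\<exists>t\<in>max_power (n - 1). \<exists>u\<in>z_only \<inter> max_power n.
    s = var_y * t + u \<and> (\<forall>l. ps3_coeff u 0 0 l = ps3_coeff s 0 0 l)"
proof -
  define t where "t = ps3_of (\<lambda>i j l. ps3_coeff s i (Suc j) l)"
  define u where "u = ps3_of (\<lambda>i j l. if i = 0 \<and> j = 0 then ps3_coeff s 0 0 l else 0)"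
  have z: "ps3_coeff s i j l = 0" if "i + j + l < n" for i j l
    using assms(2) that by (simp add: max_power_iff)
  have "t \<in> max_power (n - 1)" "u \<in> z_only \<inter> max_power n"
    by (auto simp: z_only_def max_power_iff t_def u_def z)
  moreover have "s = var_y * t + u"
    unfolding ps3_eq_iff using assms(1) by (auto simp: ps3_coeff_var_mult x_free_def t_def u_def)
  moreover have "\<forall>l. ps3_coeff u 0 0 l = ps3_coeff s 0 0 l" by (simp add: u_def)
  ultimately show ?thesis by blast
qed

definition z_embed :: "'k::field fps \<Rightarrow> 'k ps3" where
  "z_embed u = Abs_fps (\<lambda>l. fps_const (fps_const (fps_nth u l)))"

lemma z_embed_mult: "z_embed (u * v) = z_embed u * z_embed v"
proof (rule fps_ext)
  fix n
  have s: "fps_const (fps_const (sum g A)) = (\<Sum>a\<in>A. fps_const (fps_const (g a)))" for g :: "nat \<Rightarrow> 'a" and A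
    by (induction A rule: infinite_finite_induct) (auto simp flip: fps_const_add)
  show "fps_nth (z_embed (u * v)) n = fps_nth (z_embed u * z_embed v) n"
    by (simp add: z_embed_def fps_mult_nth s)
qed

lemma ps3_coeff_z_embed: "ps3_coeff (z_embed u) i j l = (if i = 0 \<and> j = 0 then fps_nth u l else 0)"
  by (simp add: z_embed_def ps3_coeff_def)

text \<open>In K[[z]] a series of exact order \<open>n\<close> is a unit times z^n. The computation
  is carried out in \<open>'k fps\<close>, where units can be inverted, and brought back by
  \<open>z_embed\<close>.\<close>

lemma z_only_divide:
  assumes "s \<in> z_only \<inter> max_power m" "h \<in> z_only \<inter> max_power n" "ps3_coeff h 0 0 n \<noteq> 0" "n \<le> m"
  shows "\<exists>w\<in>max_power (m - n). s = w * h"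
proof -
  have e: "r = z_embed (Abs_fps (\<lambda>l. ps3_coeff r 0 0 l))" if "r \<in> z_only" for r :: "'a ps3"
    using that unfolding ps3_eq_iff by (auto simp: ps3_coeff_z_embed z_only_def)
  define u where "u = Abs_fps (\<lambda>l. ps3_coeff s 0 0 l)"
  define v where "v = Abs_fps (\<lambda>l. ps3_coeff h 0 0 l)"
  have u: "fps_nth u l = 0" if "l < m" for l using assms(1) that by (simp add: u_def max_power_iff)
  have v: "fps_nth v l = 0" if "l < n" for l using assms(2) that by (simp add: v_def max_power_iff)
  have v0: "fps_nth (fps_shift n v) 0 \<noteq> 0" using assms(3) by (simp add: v_def)
  define w where "w = fps_X ^ (m - n) * fps_shift m u * inverse (fps_shift n v)"
  have vX: "v = fps_X ^ n * fps_shift n v"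
    by (rule fps_ext) (auto simp: fps_X_power_mult_nth v)
  have uX: "u = fps_X ^ m * fps_shift m u"
    by (rule fps_ext) (auto simp: fps_X_power_mult_nth u)
  have "w * v = (fps_X ^ (m - n) * fps_X ^ n) * fps_shift m u * (inverse (fps_shift n v) * fps_shift n v)"
    unfolding w_def by (subst (2) vX) (simp add: mult_ac)
  also have "inverse (fps_shift n v) * fps_shift n v = 1" by (rule inverse_mult_eq_1[OF v0])
  also have "fps_X ^ (m - n) * fps_X ^ n = (fps_X ^ m :: 'a fps)" using assms(4) by (simp add: power_add[symmetric])
  finally have "u = w * v" using uX by simp
  moreover have "s = z_embed u" "h = z_embed v" using e assms unfolding u_def v_def by auto
  ultimately have "s = z_embed w * h" by (simp add: z_embed_mult)
  moreover have "fps_nth w l = 0" if "l < m - n" for l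
    using that unfolding w_def by (simp add: mult.assoc fps_X_power_mult_nth)
  then have "z_embed w \<in> max_power (m - n)" unfolding max_power_iff ps3_coeff_z_embed by auto
  ultimately show ?thesis by blast
qed

lemma var_y_dvd_iff: "(\<exists>t. s = var_y * t) \<longleftrightarrow> (\<forall>i l. ps3_coeff s i 0 l = 0)"
proof
  assume "\<forall>i l. ps3_coeff s i 0 l = 0"
  then have "s = var_y * ps3_of (\<lambda>i j l. ps3_coeff s i (Suc j) l)"
    unfolding ps3_eq_iff by (auto simp: ps3_coeff_var_mult)
  then show "\<exists>t. s = var_y * t" by blast
qed (auto simp: ps3_coeff_var_mult)

text \<open>\<open>\<rho>\<close> sets y = 0 and lands in the domain K[[x,z]]. The second hypothesis
  says that y does not divide \<open>h\<close>, so \<open>\<rho> w\<close> must vanish.\<close>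

lemma var_y_prime:
  assumes "var_y * t = w * h" "ps3_coeff h i 0 l \<noteq> 0"
  shows "\<exists>t. w = var_y * t"
proof -
  define \<rho> :: "'a ps3 \<Rightarrow> 'a fps fps" where "\<rho> s = Abs_fps (\<lambda>l. fps_nth (fps_nth s l) 0)" for s
  have mult: "\<rho> (s * u) = \<rho> s * \<rho> u" for s u
    by (rule fps_ext) (simp add: \<rho>_def fps_mult_nth fps_nth_sum2)
  have zero: "\<rho> s = 0 \<longleftrightarrow> (\<forall>i l. ps3_coeff s i 0 l = 0)" for s
    by (auto simp: \<rho>_def ps3_coeff_def fps_eq_iff)
  have "\<rho> (var_y * t) = 0" by (simp add: zero ps3_coeff_var_mult)
  then have "\<rho> w * \<rho> h = 0" using assms(1) mult by metis
  moreover have "\<rho> h \<noteq> 0" using assms(2) zero by blast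
  ultimately have "\<rho> w = 0" by simp
  then show ?thesis using zero var_y_dvd_iff by blast
qed

lemma var_y_mult_max_power: "var_y * s \<in> max_power (Suc n) \<Longrightarrow> s \<in> max_power n"
proof -
  assume s: "var_y * s \<in> max_power (Suc n)"
  show "s \<in> max_power n"
    unfolding max_power_iff
  proof (intro allI impI)
    fix i j l assume "i + j + l < n"
    then have "ps3_coeff (var_y * s) i (Suc j) l = 0" using s by (simp add: max_power_iff)
    then show "ps3_coeff s i j l = 0" by (simp add: ps3_coeff_var_mult)
  qed
qed

lemma ps3_const_arith:
  "ps3_const (c + d) = ps3_const c + ps3_const d" "ps3_const (c - d) = ps3_const c - ps3_const d"
  "ps3_const (c * d) = ps3_const c * ps3_const d" "ps3_const 0 = 0" "ps3_const 1 = 1"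
  by (simp_all add: ps3_const_def)

lemma z_only_leading:
  assumes "s \<in> z_only" "s \<in> max_power n"
  shows "\<exists>e\<in>max_power (Suc n). s = ps3_const (ps3_coeff s 0 0 n) * var_z ^ n + e"
proof -
  have c: "ps3_coeff (var_z ^ n) i j l = (if i = 0 \<and> j = 0 \<and> l = n then 1 else 0)" for i j l
    by (simp add: ps3_coeff_def fps_X_power_nth)
  have "s - ps3_const (ps3_coeff s 0 0 n) * var_z ^ n \<in> max_power (Suc n)"
    using assms unfolding max_power_iff by (auto simp: c z_only_def less_Suc_eq)
  then show ?thesis by (intro bexI) auto
qed

text \<open>The ring \<open>K[[x,y,z]]/(f)\<close> is free over \<open>K[[y,z]]\<close> with basis \<open>1, x\<close>, multiplication by \<open>g\<close>
  has columns \<open>(a, b)\<close> and \<open>(bc, a + bd)\<close>, and \<open>h\<close> is its determinant. The conditions on the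
  leading coefficients say that \<open>y\<close> is transversal to \<open>h\<close> and to \<open>g\<close> modulo \<open>f\<close>.\<close>

locale weierstrass_coordinates =
  fixes f g a b c d q q' h :: "'k::field ps3" and \<beta> n :: nat
  assumes f: "f \<in> max_power 2" "ps3_coeff f 2 0 0 \<noteq> 0"
    and x_free: "a \<in> x_free" "b \<in> x_free" "c \<in> x_free" "d \<in> x_free"
    and x_square: "var_x * var_x = c + d * var_x + q' * f"
    and g: "g = q * f + a + b * var_x"
    and g_order: "a \<in> max_power \<beta>" "b \<in> max_power (\<beta> - 1)" "2 \<le> \<beta>"
    and g_lead: "ps3_coeff a 0 0 \<beta> \<noteq> 0 \<or> ps3_coeff b 0 0 (\<beta> - 1) \<noteq> 0"
    and h: "h = a * (a + b * d) - b * b * c" "h \<in> max_power n" "ps3_coeff h 0 0 n \<noteq> 0"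
begin

definition I :: "'k ps3 set" where "I = {u * f + v * g | u v. True}"

lemma I_add: "i \<in> I \<Longrightarrow> j \<in> I \<Longrightarrow> i + j \<in> I"
proof -
  assume "i \<in> I" "j \<in> I"
  then obtain u v u' v' where "i = u * f + v * g" "j = u' * f + v' * g" unfolding I_def by blast
  then have "i + j = (u + u') * f + (v + v') * g" by (simp add: algebra_simps)
  then show ?thesis unfolding I_def by blast
qed

lemma I_mult: "i \<in> I \<Longrightarrow> r * i \<in> I"
proof -
  assume "i \<in> I"
  then obtain u v where "i = u * f + v * g" unfolding I_def by blast
  then have "r * i = (r * u) * f + (r * v) * g" by (simp add: algebra_simps)
  then show ?thesis unfolding I_def by blast
qed

lemma f_in_I: "f \<in> I" and g_in_I: "g \<in> I"
proof -
  have "f = 1 * f + 0 * g" "g = 0 * f + 1 * g" by simp_all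
  then show "f \<in> I" "g \<in> I" unfolding I_def by blast+
qed

lemma normal_form:
  assumes "v \<in> max_power m"
  shows "\<exists>s\<in>x_free \<inter> max_power m. \<exists>t\<in>x_free \<inter> max_power (m - 1). \<exists>u. v = u * f + s + t * var_x"
  using weierstrass_normal_form[OF f assms] by blast

lemma normal_form_unique:
  assumes "s \<in> x_free" "t \<in> x_free" "s' \<in> x_free" "t' \<in> x_free"
    and "s + t * var_x = s' + t' * var_x + u * f"
  shows "s = s'" "t = t'"
proof -
  have eq: "(s - s') + (t - t') * var_x = u * f" using assms(5) by Groebner_Basis.algebra
  have st: "s - s' \<in> x_free" "t - t' \<in> x_free" using x_free_arith assms by blast+
  have "u * f \<in> x_linear" using x_free_linear(1)[OF st] eq by simp
  then have "u = 0" using weierstrass_division(2)[OF f] by blast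
  then have "(s - s') + (t - t') * var_x = 0" using eq by simp
  from x_free_linear(2)[OF st this] show "s = s'" "t = t'" by auto
qed

text \<open>Division respects orders and normal forms are unique, so adding a multiple of
  \<open>f\<close> cannot cancel a low-order term of \<open>s\<close> or \<open>t\<close>.\<close>

lemma normal_form_max_power:
  assumes "s \<in> x_free" "t \<in> x_free" "s + t * var_x - u * f \<in> max_power m"
  shows "s \<in> max_power m" "t \<in> max_power (m - 1)"
proof -
  obtain s' t' u' where *: "s' \<in> x_free \<inter> max_power m" "t' \<in> x_free \<inter> max_power (m - 1)"
    "s + t * var_x - u * f = u' * f + s' + t' * var_x" using normal_form[OF assms(3)] by blast
  have "s + t * var_x = s' + t' * var_x + (u + u') * f" using *(3) by Groebner_Basis.algebra
  from normal_form_unique[OF assms(1,2) _ _ this] * show "s \<in> max_power m" "t \<in> max_power (m - 1)"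
    by auto
qed

lemma h_in_I: "h \<in> I"
proof -
  \<comment> \<open>\<open>a + b * d - b * var_x\<close> is the conjugate of
    \<open>a + b * var_x\<close> over K[[y,z]]; their product is the norm \<open>h\<close> modulo
    \<open>f\<close>.\<close>
  have "h = (a + b * d - b * var_x) * g + (b * b * q' - (a + b * d - b * var_x) * q) * f"
    unfolding h(1) g using x_square by Groebner_Basis.algebra
  then have "h = (b * b * q' - (a + b * d - b * var_x) * q) * f + (a + b * d - b * var_x) * g"
    by (simp add: add.commute)
  then show ?thesis unfolding I_def by blast
qed

text \<open>In the basis 1, x the relation says that y times the coordinates of \<open>v\<close> is
  the matrix of \<open>g\<close> applied to \<open>(w0, w1)\<close>. By Cramer's rule y divides
  \<open>w0 * h\<close> and \<open>w1 * h\<close>; it is prime and does not divide \<open>h\<close>,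
  which contains z^n. So y divides \<open>w0\<close> and \<open>w1\<close> and can be
  cancelled.\<close>

lemma var_y_nonzerodivisor:
  assumes "var_y * v \<in> I"
  shows "v \<in> I"
proof -
  obtain u t where ut: "var_y * v = u * f + t * g" using assms unfolding I_def by blast
  obtain s0 s1 p where v: "v = p * f + s0 + s1 * var_x" "s0 \<in> x_free" "s1 \<in> x_free"
    using normal_form[of v 0] max_power_0 by blast
  obtain w0 w1 r where t: "t = r * f + w0 + w1 * var_x" "w0 \<in> x_free" "w1 \<in> x_free"
    using normal_form[of t 0] max_power_0 by blast
  have y: "var_y \<in> x_free" by (auto simp: x_free_def ps3_coeff_def)
  have eq: "var_y * s0 + (var_y * s1) * var_x = (w0 * a + w1 * b * c) + (w0 * b + w1 * (a + b * d)) * var_x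
     + (u + r * g + w0 * q + w1 * var_x * q + w1 * b * q' - var_y * p) * f"
    using ut x_square unfolding v(1) t(1) g by Groebner_Basis.algebra
  have "var_y * s0 = w0 * a + w1 * b * c" "var_y * s1 = w0 * b + w1 * (a + b * d)"
    by (rule normal_form_unique[OF _ _ _ _ eq]; intro x_free_arith y v t x_free)+
  note e = this
  have "var_y * (s0 * (a + b * d) - s1 * b * c) = w0 * h"
    unfolding h(1) using e by Groebner_Basis.algebra
  then obtain w0' where w0: "w0 = var_y * w0'" using var_y_prime h(3) by blast
  have "var_y * (s1 * a - s0 * b) = w1 * h" unfolding h(1) using e by Groebner_Basis.algebra
  then obtain w1' where w1: "w1 = var_y * w1'" using var_y_prime h(3) by blast
  have "var_y \<noteq> (0 :: 'k ps3)" by simp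
  moreover have "var_y * s0 = var_y * (w0' * a + w1' * b * c)"
    "var_y * s1 = var_y * (w0' * b + w1' * (a + b * d))"
    using e unfolding w0 w1 by Groebner_Basis.algebra+
  ultimately have s: "s0 = w0' * a + w1' * b * c" "s1 = w0' * b + w1' * (a + b * d)"
    by (metis mult_left_cancel)+
  have "v = (p - (w0' + w1' * var_x) * q - w1' * b * q') * f + (w0' + w1' * var_x) * g"
    unfolding v(1) s g using x_square by Groebner_Basis.algebra
  then show ?thesis unfolding I_def by blast
qed

text \<open>Split \<open>h = var_y * h1 + h0\<close> with \<open>h0\<close> of exact order
  \<open>n\<close> in z. Since \<open>h\<close> lies in \<open>I\<close>, \<open>h0\<close> is
  congruent to a multiple of y, and every \<open>s\<close> of order at least \<open>n\<close> in z
  is a multiple of \<open>h0\<close>.\<close>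

lemma z_only_reduce:
  assumes "s \<in> z_only \<inter> max_power m" "n \<le> m"
  shows "\<exists>t\<in>max_power (m - 1). s - var_y * t \<in> I"
proof -
  have "h \<in> x_free" unfolding h(1) by (intro x_free_arith x_free)
  from x_free_decompose[OF this h(2)] obtain h1 h0 where
    h1: "h1 \<in> max_power (n - 1)" "h0 \<in> z_only \<inter> max_power n" "h = var_y * h1 + h0"
      "\<forall>l. ps3_coeff h0 0 0 l = ps3_coeff h 0 0 l" by blast
  have "ps3_coeff h0 0 0 n \<noteq> 0" using h1(4) h(3) by simp
  from z_only_divide[OF assms(1) h1(2) this assms(2)] obtain w where
    w: "w \<in> max_power (m - n)" "s = w * h0" by blast
  have "s - var_y * (- (w * h1)) = w * h" unfolding w(2) h1(3) by (simp add: algebra_simps)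
  also have "w * h \<in> I" by (rule I_mult[OF h_in_I])
  finally have "s - var_y * (- (w * h1)) \<in> I" .
  moreover have "w * h1 \<in> max_power (m - 1)"
    by (rule max_power_mult_le[OF w(1) h1(1)]) (use assms(2) in auto)
  ultimately show ?thesis using max_power_uminus by blast
qed

lemma x_free_reduce:
  assumes "s \<in> x_free \<inter> max_power m" "n \<le> m"
  shows "\<exists>t\<in>max_power (m - 1). s - var_y * t \<in> I"
proof -
  obtain t u where t: "t \<in> max_power (m - 1)" "u \<in> z_only \<inter> max_power m" "s = var_y * t + u"
    using x_free_decompose assms(1) by blast
  from z_only_reduce[OF t(2) assms(2)] obtain t' where
    t': "t' \<in> max_power (m - 1)" "u - var_y * t' \<in> I" by blast
  have "s - var_y * (t + t') = u - var_y * t'" unfolding t(3) by (simp add: algebra_simps)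
  with t' t max_power_add show ?thesis by metis
qed

text \<open>The two coordinates of the normal form are reduced separately. The coordinate at x has
  order one less than \<open>v\<close>, which is why the threshold is \<open>Suc n\<close> rather
  than \<open>n\<close>.\<close>

lemma reduction:
  assumes "v \<in> max_power (Suc n)"
  shows "\<exists>t\<in>max_power n. v - var_y * t \<in> I"
proof -
  obtain s0 s1 u where s: "s0 \<in> x_free \<inter> max_power (Suc n)" "s1 \<in> x_free \<inter> max_power n"
    "v = u * f + s0 + s1 * var_x" using normal_form[OF assms] by auto
  obtain t0 where t0: "t0 \<in> max_power n" "s0 - var_y * t0 \<in> I" using x_free_reduce[OF s(1)] by auto
  obtain t1 where t1: "t1 \<in> max_power (n - 1)" "s1 - var_y * t1 \<in> I" using x_free_reduce[OF s(2)] by auto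
  have "v - var_y * (t0 + t1 * var_x) = u * f + (s0 - var_y * t0) + var_x * (s1 - var_y * t1)"
    unfolding s(3) by (simp add: algebra_simps)
  also have "\<dots> \<in> I" using t0 t1 I_add I_mult f_in_I by blast
  finally have "v - var_y * (t0 + t1 * var_x) \<in> I" .
  moreover have "t1 * var_x \<in> max_power n"
    by (rule max_power_mult_le[OF t1(1) var_max_power(1)]) simp
  then have "t0 + t1 * var_x \<in> max_power n" using t0 max_power_add by blast
  ultimately show ?thesis by blast
qed

lemma x_free_leading:
  assumes "s \<in> x_free" "s \<in> max_power m"
  shows "\<exists>t\<in>max_power (m - 1). \<exists>e\<in>max_power (Suc m).
    s = var_y * t + ps3_const (ps3_coeff s 0 0 m) * var_z ^ m + e"
proof -
  obtain t u where t: "t \<in> max_power (m - 1)" "u \<in> z_only \<inter> max_power m" "s = var_y * t + u"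
    "ps3_coeff u 0 0 m = ps3_coeff s 0 0 m" using x_free_decompose[OF assms] by blast
  from z_only_leading[of u m] t(2,4) obtain e where
    "e \<in> max_power (Suc m)" "u = ps3_const (ps3_coeff s 0 0 m) * var_z ^ m + e" by auto
  with t show ?thesis by (metis add.assoc)
qed

text \<open>Modulo \<open>f\<close>, y and order above \<open>m\<close>, everything is a combination
  of \<open>A = z^m\<close> and \<open>B = z^(m-1) x\<close>. Multiplying \<open>g\<close> by
  z^(m-\<beta>) gives the relation \<open>p A + r B = 0\<close> there, and \<open>g_lead\<close>
  says that \<open>p\<close> or \<open>r\<close> is nonzero. One of \<open>A\<close>,
  \<open>B\<close> is eliminated and the other serves as \<open>w\<close>.\<close>

lemma corank_le_1:
  assumes "\<beta> \<le> m"
  shows "\<exists>w\<in>max_power m. \<forall>v\<in>max_power m. \<exists>t\<in>max_power (m - 1). \<exists>k. \<exists>i\<in>I.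
    v - var_y * t - ps3_const k * w - i \<in> max_power (Suc m)"
proof -
  let ?Z = "var_z ^ (m - \<beta>) :: 'k ps3"
  define p where "p = ps3_coeff a 0 0 \<beta>"
  define r where "r = ps3_coeff b 0 0 (\<beta> - 1)"
  have zp: "var_z ^ k \<in> (max_power k :: 'k ps3 set)" for k
    by (auto simp: max_power_iff ps3_coeff_def fps_X_power_nth)
  have zm: "var_z ^ m = ?Z * var_z ^ \<beta>" "var_z ^ (m - 1) = ?Z * var_z ^ (\<beta> - 1)"
    using assms g_order(3) by (simp_all add: power_add[symmetric])
  obtain ta ea where ta: "ta \<in> max_power (\<beta> - 1)" "ea \<in> max_power (Suc \<beta>)"
    "a = var_y * ta + ps3_const p * var_z ^ \<beta> + ea"
    using x_free_leading[OF x_free(1) g_order(1)] unfolding p_def by blast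
  obtain tb eb where tb: "tb \<in> max_power (\<beta> - 1 - 1)" "eb \<in> max_power (Suc (\<beta> - 1))"
    "b = var_y * tb + ps3_const r * var_z ^ (\<beta> - 1) + eb"
    using x_free_leading[OF x_free(2) g_order(2)] unfolding r_def by blast
  define t2 where "t2 = ?Z * (ta + tb * var_x)"
  define e2 where "e2 = ?Z * (ea + eb * var_x)"
  define i2 where "i2 = ?Z * (g + (- q) * f)"
  have t2: "t2 \<in> max_power (m - 1)" unfolding t2_def
  proof (rule max_power_mult_le[OF zp max_power_add[OF ta(1)]])
    show "tb * var_x \<in> max_power (\<beta> - 1)"
      by (rule max_power_mult_le[OF tb(1) var_max_power(1)]) simp
  qed (use assms g_order(3) in simp)
  have e2: "e2 \<in> max_power (Suc m)" unfolding e2_def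
  proof (rule max_power_mult_le[OF zp max_power_add[OF ta(2)]])
    show "eb * var_x \<in> max_power (Suc \<beta>)"
      by (rule max_power_mult_le[OF tb(2) var_max_power(1)]) (use g_order(3) in simp)
  qed (use assms g_order(3) in simp)
  have i2: "i2 \<in> I" unfolding i2_def by (intro I_mult I_add g_in_I f_in_I)
  define A where "A = (var_z ^ m :: 'k ps3)"
  define B where "B = (var_z ^ (m - 1) * var_x :: 'k ps3)"
  have rel: "ps3_const p * A + ps3_const r * B = i2 - var_y * t2 - e2"
  proof -
    have "g = q * f + (var_y * ta + ps3_const p * var_z ^ \<beta> + ea)
        + (var_y * tb + ps3_const r * var_z ^ (\<beta> - 1) + eb) * var_x"
      using g ta(3) tb(3) by simp
    then show ?thesis unfolding A_def B_def zm i2_def t2_def e2_def by (simp add: algebra_simps)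
  qed
  have lead: "\<exists>t\<in>max_power (m - 1). \<exists>e\<in>max_power (Suc m). \<exists>i\<in>I. \<exists>k l.
      v = var_y * t + ps3_const k * A + ps3_const l * B + i + e"
    if v: "v \<in> max_power m" for v
  proof -
    obtain s0 s1 u where s: "s0 \<in> x_free \<inter> max_power m" "s1 \<in> x_free \<inter> max_power (m - 1)"
      "v = u * f + s0 + s1 * var_x" using normal_form[OF v] by auto
    obtain t0 e0 k where t0: "t0 \<in> max_power (m - 1)" "e0 \<in> max_power (Suc m)"
      "s0 = var_y * t0 + ps3_const k * var_z ^ m + e0"
      using x_free_leading s(1) by blast
    obtain t1 e1 l where t1: "t1 \<in> max_power (m - 1 - 1)" "e1 \<in> max_power (Suc (m - 1))"
      "s1 = var_y * t1 + ps3_const l * var_z ^ (m - 1) + e1"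
      using x_free_leading s(2) by blast
    have "v = var_y * (t0 + t1 * var_x) + ps3_const k * A + ps3_const l * B + u * f + (e0 + e1 * var_x)"
      unfolding A_def B_def s(3) t0(3) t1(3) by (simp add: algebra_simps)
    moreover have "t1 * var_x \<in> max_power (m - 1)" "e1 * var_x \<in> max_power (Suc m)"
      using assms g_order(3)
      by (auto intro!: max_power_mult_le[OF t1(1) var_max_power(1)] max_power_mult_le[OF t1(2) var_max_power(1)])
    then have "t0 + t1 * var_x \<in> max_power (m - 1)" "e0 + e1 * var_x \<in> max_power (Suc m)"
      using t0 max_power_add by blast+
    ultimately show ?thesis using I_mult[OF f_in_I] by blast
  qed
  have close: "\<exists>t\<in>max_power (m - 1). \<exists>k. \<exists>i\<in>I. v - var_y * t - ps3_const k * w - i \<in> max_power (Suc m)"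
    if "t \<in> max_power (m - 1)" "e \<in> max_power (Suc m)" "i \<in> I"
      "v = var_y * (t - ps3_const k * t2) + ps3_const k' * w + (i + ps3_const k * i2) + (e - ps3_const k * e2)"
    for v w t e i k k'
  proof -
    have "t - ps3_const k * t2 \<in> max_power (m - 1)" "i + ps3_const k * i2 \<in> I"
      "e - ps3_const k * e2 \<in> max_power (Suc m)"
      using that t2 e2 i2 by (auto intro!: max_power_diff max_power_mult_left I_add I_mult)
    moreover have "v - var_y * (t - ps3_const k * t2) - ps3_const k' * w - (i + ps3_const k * i2)
        = e - ps3_const k * e2" unfolding that(4) by (simp add: algebra_simps)
    ultimately show ?thesis by metis
  qed
  show ?thesis
  proof (cases "p = 0")
    \<comment> \<open>For \<open>p \<noteq> 0\<close> the relation eliminates \<open>A\<close>, with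
      coefficient \<open>k / p\<close>, and \<open>B\<close> remains.\<close>
    case False
    show ?thesis
    proof (rule bexI[of _ B], rule ballI)
      show "B \<in> max_power m" unfolding B_def
        by (rule max_power_mult_le[OF zp var_max_power(1)]) simp
      fix v :: "'k ps3" assume "v \<in> max_power m"
      from lead[OF this] obtain t e i k l where
        *: "t \<in> max_power (m - 1)" "e \<in> max_power (Suc m)" "i \<in> I"
        "v = var_y * t + ps3_const k * A + ps3_const l * B + i + e" by blast
      have k: "ps3_const k = ps3_const (k / p) * ps3_const p"
        using False by (simp flip: ps3_const_arith)
      have "v = var_y * (t - ps3_const (k / p) * t2) + ps3_const (l - k / p * r) * B
         + (i + ps3_const (k / p) * i2) + (e - ps3_const (k / p) * e2)"
        unfolding *(4) k ps3_const_arith(2,3) using rel by Groebner_Basis.algebra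
      from close[OF *(1-3) this] show "\<exists>t\<in>max_power (m - 1). \<exists>k. \<exists>i\<in>I.
        v - var_y * t - ps3_const k * B - i \<in> max_power (Suc m)" .
    qed
  next
    case True
    then have "r \<noteq> 0" using g_lead by (simp add: p_def r_def)
    show ?thesis
    proof (rule bexI[of _ A], rule ballI)
      show "A \<in> max_power m" unfolding A_def by (rule zp)
      fix v :: "'k ps3" assume "v \<in> max_power m"
      from lead[OF this] obtain t e i k l where
        *: "t \<in> max_power (m - 1)" "e \<in> max_power (Suc m)" "i \<in> I"
        "v = var_y * t + ps3_const k * A + ps3_const l * B + i + e" by blast
      have k: "ps3_const l = ps3_const (l / r) * ps3_const r"
        using \<open>r \<noteq> 0\<close> by (simp flip: ps3_const_arith)
      have rel': "ps3_const r * B = i2 - var_y * t2 - e2"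
        using rel True by (simp add: ps3_const_arith)
      have "v = var_y * (t - ps3_const (l / r) * t2) + ps3_const k * A
         + (i + ps3_const (l / r) * i2) + (e - ps3_const (l / r) * e2)"
        unfolding *(4) k using rel' by Groebner_Basis.algebra
      from close[OF *(1-3) this] show "\<exists>t\<in>max_power (m - 1). \<exists>k. \<exists>i\<in>I.
        v - var_y * t - ps3_const k * A - i \<in> max_power (Suc m)" .
    qed
  qed
qed

text \<open>Multiples of \<open>g\<close> agree with multiples of \<open>f\<close> up to order
  \<beta> \<ge> m + 2, so in this range \<open>I\<close> behaves like the ideal of \<open>f\<close>.
  There the order is read off the normal form, and removing a factor y lowers the order of each
  coordinate by exactly 1.\<close>

lemma injective_below:
  assumes m: "Suc m < \<beta>" and v: "v \<in> max_power m" and i: "i \<in> I" "var_y * v - i \<in> max_power (m + 2)"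
  shows "\<exists>i'\<in>I. v - i' \<in> max_power (Suc m)"
proof -
  obtain u t where ut: "i = u * f + t * g" using i(1) unfolding I_def by blast
  have "b * var_x \<in> max_power \<beta>"
    by (rule max_power_mult_le[OF g_order(2) var_max_power(1)]) (use g_order(3) in simp)
  then have "a + b * var_x \<in> max_power (m + 2)"
    using max_power_add[OF g_order(1)] max_power_mono[of "m + 2" \<beta>] m by auto
  then have "t * (a + b * var_x) \<in> max_power (m + 2)" by (rule max_power_mult_left)
  from max_power_add[OF i(2) this] have 1: "var_y * v - (u + t * q) * f \<in> max_power (m + 2)"
    unfolding ut g by (simp add: algebra_simps)
  obtain s0 s1 p where s: "v = p * f + s0 + s1 * var_x" "s0 \<in> x_free" "s1 \<in> x_free"
    using normal_form[OF v] by blast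
  have y: "var_y \<in> x_free" by (auto simp: x_free_def ps3_coeff_def)
  have "var_y * s0 + (var_y * s1) * var_x - (u + t * q - var_y * p) * f \<in> max_power (m + 2)"
    using 1 unfolding s(1) by (simp add: algebra_simps)
  from normal_form_max_power[OF _ _ this] have "s0 \<in> max_power (Suc m)" "s1 \<in> max_power m"
    using var_y_mult_max_power[of s0 "Suc m"] var_y_mult_max_power[of s1 m] x_free_arith(3)[OF y] s
    by auto
  moreover have "s1 * var_x \<in> max_power (Suc m)"
    by (rule max_power_mult_le[OF calculation(2) var_max_power(1)]) simp
  ultimately have "v - p * f \<in> max_power (Suc m)" unfolding s(1) using max_power_add by simp
  then show ?thesis using I_mult[OF f_in_I] by blast
qed

theorem transversal_parameter_var_y: "transversal_parameter I \<beta> var_y"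
  unfolding transversal_parameter_def
  using var_max_power(2) var_y_nonzerodivisor reduction corank_le_1 injective_below by blast

end

section \<open>Choice of coordinates\<close>

lemma shear_fixed:
  assumes "\<And>i j l. 0 < j \<Longrightarrow> ps3_coeff s i j l = 0"
  shows "shear \<alpha> s = s"
  unfolding ps3_eq_iff ps3_coeff_shear
proof (intro allI)
  fix i j l
  have "(\<Sum>m\<le>l. of_nat ((j + m) choose m) * \<alpha> ^ m * ps3_coeff s i (j + m) (l - m)) =
    (\<Sum>m\<in>{0}. of_nat ((j + m) choose m) * \<alpha> ^ m * ps3_coeff s i (j + m) (l - m))"
    by (rule sum.mono_neutral_right) (auto simp: assms)
  then show "(\<Sum>m\<le>l. of_nat ((j + m) choose m) * \<alpha> ^ m * ps3_coeff s i (j + m) (l - m)) = ps3_coeff s i j l"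
    by simp
qed

lemma shear_x_free: "s \<in> x_free \<Longrightarrow> shear \<alpha> s \<in> x_free"
  by (auto simp: x_free_def ps3_coeff_shear)

text \<open>\<open>p\<close> is the initial form of \<open>s\<close> at y = \<alpha>, z = 1. It is a
  nonzero polynomial in \<alpha> because \<open>s\<close> has exact order \<open>n\<close>; its
  roots are the tangent directions to be avoided.\<close>

lemma shear_leading_coeff:
  fixes s :: "'k::field ps3"
  assumes "s \<in> x_free" "s \<in> max_power n" "s \<notin> max_power (Suc n)"
  shows "\<exists>p. p \<noteq> 0 \<and> (\<forall>\<alpha>. ps3_coeff (shear \<alpha> s) 0 0 n = poly p \<alpha>)"
proof -
  define p where "p = (\<Sum>m\<le>n. monom (ps3_coeff s 0 m (n - m)) m)"
  obtain i j l where "i + j + l < Suc n" and nz: "ps3_coeff s i j l \<noteq> 0"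
    using assms(3) unfolding max_power_iff by blast
  moreover have "i = 0" using assms(1) nz unfolding x_free_def by (cases i) auto
  moreover have "\<not> i + j + l < n" using assms(2) nz unfolding max_power_iff by blast
  ultimately have l: "i = 0" "j \<le> n" "l = n - j" by auto
  have "coeff p j = ps3_coeff s 0 j (n - j)"
    unfolding p_def coeff_sum using l by (simp add: sum.delta')
  then have "p \<noteq> 0" using nz l by auto
  moreover have "ps3_coeff (shear \<alpha> s) 0 0 n = poly p \<alpha>" for \<alpha>
    unfolding p_def ps3_coeff_shear poly_sum by (simp add: poly_monom mult.commute)
  ultimately show ?thesis by blast
qed

lemma exists_transversal_parameter_x_regular:
  fixes f g :: "'k::field_char_0 ps3"
  assumes f: "f \<in> max_power 2" "ps3_coeff f 2 0 0 \<noteq> 0" and g: "g \<in> max_power \<beta>" "2 \<le> \<beta>"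
    and nd: "\<And>s. s \<in> max_power (\<beta> - 2) \<Longrightarrow> g - s * f \<notin> max_power (Suc \<beta>)"
    and nzd: "\<And>a u. g * a = u * f \<Longrightarrow> \<exists>u. a = u * f"
  shows "\<exists>l. transversal_parameter {u * f + v * g | u v. True} \<beta> l"
proof -
  note nf = weierstrass_normal_form[OF f]
  obtain a b q where ab: "a \<in> x_free" "a \<in> max_power \<beta>" "b \<in> x_free" "b \<in> max_power (\<beta> - 1)"
    "q \<in> max_power (\<beta> - 2)" "g = q * f + a + b * var_x" using nf[OF g(1)] by blast
  obtain c d q' where cd: "c \<in> x_free" "d \<in> x_free" "var_x * var_x = q' * f + c + d * var_x"
    using nf[of "var_x * var_x" 0] max_power_0 by blast
  define h where "h = a * (a + b * d) - b * b * c"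
  have hx: "h \<in> x_free" unfolding h_def by (intro x_free_arith ab cd)
  \<comment> \<open>Otherwise \<open>g - q * f\<close> would have order above \<beta>, contrary to
    the condition on initial forms.\<close>
  have lead: "a \<notin> max_power (Suc \<beta>) \<or> b \<notin> max_power (Suc (\<beta> - 1))"
  proof (rule ccontr)
    assume *: "\<not> ?thesis"
    have "b * var_x \<in> max_power (Suc \<beta>)"
      using * by (intro max_power_mult_le[OF _ var_max_power(1)]) (auto simp: g(2))
    then have "a + b * var_x \<in> max_power (Suc \<beta>)" using * max_power_add by blast
    moreover have "g - q * f = a + b * var_x" using ab(6) by (simp add: algebra_simps)
    ultimately show False using nd[OF ab(5)] by simp
  qed
  \<comment> \<open>If the norm vanished, \<open>g\<close> times the conjugate would be a multiple
    of \<open>f\<close>, hence so would the conjugate, because \<open>g\<close> is a nonzerodivisor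
    modulo \<open>f\<close>. Uniqueness of normal forms would then give \<open>a = b = 0\<close>,
    against \<open>lead\<close>.\<close>
  have "h \<noteq> 0"
  proof
    assume "h = 0"
    then have h0: "a * (a + b * d) = b * b * c" by (simp add: h_def)
    have "g * (a + b * d - b * var_x) = (q * (a + b * d - b * var_x) - b * b * q') * f"
      using h0 cd(3) unfolding ab(6) by Groebner_Basis.algebra
    from nzd[OF this] obtain u where u: "a + b * d - b * var_x = u * f" by blast
    have "0 - b \<in> x_free" using ab(3) by (simp add: x_free_def)
    moreover have "a + b * d \<in> x_free" by (intro x_free_arith ab cd)
    ultimately have mb: "0 - b \<in> x_free" "a + b * d \<in> x_free" by blast+
    have eq: "(a + b * d) + (0 - b) * var_x = u * f" using u by (simp add: algebra_simps)
    have "u * f \<in> x_linear" using x_free_linear(1)[OF mb(2,1)] eq by simp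
    then have "u = 0" using weierstrass_division(2)[OF f] by blast
    then have "a + b * d = 0 \<and> 0 - b = 0" using x_free_linear(2)[OF mb(2,1)] eq by simp
    then have "b = 0" "a = 0" by auto
    then show False using lead max_power_zero by blast
  qed
  define n where "n = (LEAST n. \<exists>i j l. i + j + l = n \<and> ps3_coeff h i j l \<noteq> 0)"
  have "\<exists>n i j l. i + j + l = n \<and> ps3_coeff h i j l \<noteq> 0" using \<open>h \<noteq> 0\<close> by (auto simp: ps3_eq_iff)
  from LeastI_ex[OF this] have "h \<notin> max_power (Suc n)"
    unfolding n_def[symmetric] max_power_iff by force
  moreover have hn: "h \<in> max_power n"
    unfolding max_power_iff n_def using not_less_Least by blast
  ultimately obtain p1 where p1: "p1 \<noteq> 0" "\<And>\<alpha>. ps3_coeff (shear \<alpha> h) 0 0 n = poly p1 \<alpha>"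
    using shear_leading_coeff[OF hx] by blast
  have "\<exists>p. p \<noteq> 0 \<and> (\<forall>\<alpha>. poly p \<alpha> \<noteq> 0 \<longrightarrow>
      ps3_coeff (shear \<alpha> a) 0 0 \<beta> \<noteq> 0 \<or> ps3_coeff (shear \<alpha> b) 0 0 (\<beta> - 1) \<noteq> 0)"
    using lead shear_leading_coeff[OF ab(1,2)] shear_leading_coeff[OF ab(3,4)] by metis
  then obtain p2 where p2: "p2 \<noteq> 0" "\<And>\<alpha>. poly p2 \<alpha> \<noteq> 0 \<Longrightarrow>
      ps3_coeff (shear \<alpha> a) 0 0 \<beta> \<noteq> 0 \<or> ps3_coeff (shear \<alpha> b) 0 0 (\<beta> - 1) \<noteq> 0" by blast
  \<comment> \<open>A bad parameter is a root of \<open>p1\<close> (the direction is tangent to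
    \<open>h\<close>) or of \<open>p2\<close> (the leading coefficients from \<open>a\<close> and
    \<open>b\<close> may both vanish). An infinite field leaves a good one.\<close>
  have "finite {\<alpha>. poly (p1 * p2) \<alpha> = 0}" using p1 p2 by (intro poly_roots_finite) simp
  then obtain \<alpha> where "poly (p1 * p2) \<alpha> \<noteq> 0"
    using ex_new_if_finite[OF infinite_UNIV_char_0] by blast
  then have \<alpha>: "poly p1 \<alpha> \<noteq> 0" "poly p2 \<alpha> \<noteq> 0" by auto
  let ?s = "shear \<alpha> :: 'k ps3 \<Rightarrow> _"
  note aut = ps3_aut_shear[of \<alpha>]
  note D = ps3_autD[OF aut]
  have vx: "?s var_x = var_x" by (rule shear_fixed) (simp add: ps3_coeff_def)
  interpret weierstrass_coordinates "?s f" "?s g" "?s a" "?s b" "?s c" "?s d" "?s q" "?s q'" "?s h" \<beta> n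
  proof
    show "?s f \<in> max_power 2" "?s a \<in> max_power \<beta>" "?s b \<in> max_power (\<beta> - 1)" "?s h \<in> max_power n"
      using D(5) f(1) ab hn by blast+
    show "ps3_coeff (?s f) 2 0 0 \<noteq> 0" using f(2) by (simp add: ps3_coeff_shear)
    show "?s a \<in> x_free" "?s b \<in> x_free" "?s c \<in> x_free" "?s d \<in> x_free"
      using shear_x_free ab cd by blast+
    have "?s (var_x * var_x) = ?s (q' * f + c + d * var_x)" by (rule arg_cong[OF cd(3)])
    then show "var_x * var_x = ?s c + ?s d * var_x + ?s q' * ?s f"
      unfolding D(3) D(2) vx by (simp only: add_ac)
    show "?s g = ?s q * ?s f + ?s a + ?s b * var_x"
      using ab(6) by (metis D(2,3) vx)
    show "?s h = ?s a * (?s a + ?s b * ?s d) - ?s b * ?s b * ?s c"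
      unfolding h_def D(8) D(3) D(2) ..
    show "ps3_coeff (?s a) 0 0 \<beta> \<noteq> 0 \<or> ps3_coeff (?s b) 0 0 (\<beta> - 1) \<noteq> 0" using p2(2) \<alpha> by blast
    show "ps3_coeff (?s h) 0 0 n \<noteq> 0" using p1(2) \<alpha> by simp
  qed (rule g(2))
  have surj: "\<exists>u. v = ?s u" for v using D(1) by (meson bij_is_surj surjD)
  have "?s ` {u * f + v * g | u v. True} = I"
  proof
    show "?s ` {u * f + v * g | u v. True} \<subseteq> I" unfolding I_def by (auto simp: D(2,3)) blast
    show "I \<subseteq> ?s ` {u * f + v * g | u v. True}"
    proof
      fix w assume "w \<in> I"
      then obtain u' v' where w: "w = u' * ?s f + v' * ?s g" unfolding I_def by blast
      obtain u v where "u' = ?s u" "v' = ?s v" using surj by metis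
      then have "w = ?s u * ?s f + ?s v * ?s g" using w by simp
      then have "w = ?s (u * f + v * g)" by (simp add: D(2,3))
      then show "w \<in> ?s ` {u * f + v * g | u v. True}" by blast
    qed
  qed
  moreover obtain l where "?s l = var_y" using surj by metis
  ultimately show ?thesis
    using transversal_parameter_aut[OF aut, of "{u * f + v * g | u v. True}" \<beta> l]
      transversal_parameter_var_y by auto
qed

text \<open>A square among the terms of degree 2 is moved to x^2 by swapping variables. If only
  mixed terms are available, the mixed term is moved to y z, and the substitution of y + z for y
  turns it into z^2.\<close>

lemma exists_aut_x_regular:
  fixes f :: "'k::field_char_0 ps3"
  assumes "f \<in> max_power 2" "f \<notin> max_power 3"
  shows "\<exists>\<sigma>. ps3_aut \<sigma> \<and> ps3_coeff (\<sigma> f) 2 0 0 \<noteq> 0"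
proof -
  let ?ok = "\<lambda>f :: 'k ps3. \<exists>\<sigma>. ps3_aut \<sigma> \<and> ps3_coeff (\<sigma> f) 2 0 0 \<noteq> 0"
  have comp: "?ok f" if t: "?ok (\<tau> f)" "ps3_aut \<tau>" for f \<tau>
  proof -
    obtain \<sigma> where "ps3_aut \<sigma>" "ps3_coeff (\<sigma> (\<tau> f)) 2 0 0 \<noteq> 0" using t(1) by blast
    with ps3_aut_comp[OF this(1) t(2)] show ?thesis by (intro exI[of _ "\<sigma> \<circ> \<tau>"]) simp
  qed
  note xy = comp[OF _ ps3_aut_swap_xy] and xz = comp[OF _ ps3_aut_swap_xz]
  have 1: "?ok f" if "ps3_coeff f 2 0 0 \<noteq> 0" for f using that ps3_aut_id by (metis id_apply)
  have 2: "?ok f" if "ps3_coeff f 0 2 0 \<noteq> 0" for f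
    by (rule xy, rule 1) (use that in \<open>simp add: swap_xy_def\<close>)
  have 3: "?ok f" if "ps3_coeff f 0 0 2 \<noteq> 0" for f
    by (rule xz, rule 1) (use that in \<open>simp add: swap_xz_def\<close>)
  have 4: "?ok f" if "ps3_coeff f 0 1 1 \<noteq> 0" for f
  proof (cases "ps3_coeff f 0 2 0 = 0 \<and> ps3_coeff f 0 0 2 = 0")
    case True
    have "ps3_coeff (shear 1 f) 0 0 2 = ps3_coeff f 0 1 1"
      using True by (simp add: ps3_coeff_shear numeral_2_eq_2)
    then show ?thesis using comp[OF 3 ps3_aut_shear[of 1], of f] that by simp
  qed (use 2 3 in auto)
  have 5: "?ok f" if "ps3_coeff f 1 0 1 \<noteq> 0" for f
    by (rule xy, rule 4) (use that in \<open>simp add: swap_xy_def\<close>)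
  have 6: "?ok f" if "ps3_coeff f 1 1 0 \<noteq> 0" for f
    by (rule xz, rule 4) (use that in \<open>simp add: swap_xz_def\<close>)
  obtain i j l where "i + j + l < 3" "ps3_coeff f i j l \<noteq> 0"
    using assms(2) unfolding max_power_iff by blast
  moreover from this have "\<not> i + j + l < 2" using assms(1) unfolding max_power_iff by blast
  ultimately have "i + j + l = 2" by simp
  then have "i \<in> {0, 1, 2}" "j \<in> {0, 1, 2}" "l = 2 - i - j" by auto
  then have "(i, j, l) \<in> {(2,0,0), (0,2,0), (0,0,2), (0,1,1), (1,0,1), (1,1,0)}"
    using \<open>i + j + l = 2\<close> by (elim insertE emptyE) simp_all
  then show ?thesis using \<open>ps3_coeff f i j l \<noteq> 0\<close> 1 2 3 4 5 6 by auto
qed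

lemma exists_transversal_parameter:
  fixes f g :: "'k::field_char_0 ps3"
  assumes f: "f \<in> max_power 2" "f \<notin> max_power 3" and g: "g \<in> max_power \<beta>" "2 \<le> \<beta>"
    and nd: "\<And>s. s \<in> max_power (\<beta> - 2) \<Longrightarrow> g - s * f \<notin> max_power (Suc \<beta>)"
    and nzd: "\<And>a u. g * a = u * f \<Longrightarrow> \<exists>u. a = u * f"
  shows "\<exists>l. transversal_parameter {u * f + v * g | u v. True} \<beta> l"
proof -
  obtain \<sigma> where s: "ps3_aut \<sigma>" "ps3_coeff (\<sigma> f) 2 0 0 \<noteq> 0" using exists_aut_x_regular[OF f] by blast
  note D = ps3_autD[OF s(1)]
  have surj: "\<exists>u. v = \<sigma> u" for v using D(1) by (meson bij_is_surj surjD)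
  have inj: "\<sigma> u = \<sigma> v \<longleftrightarrow> u = v" for u v using D(1) by (simp add: bij_is_inj inj_eq)
  have "\<exists>l. transversal_parameter {u * \<sigma> f + v * \<sigma> g | u v. True} \<beta> l"
  proof (rule exists_transversal_parameter_x_regular)
    show "\<sigma> f \<in> max_power 2" "\<sigma> g \<in> max_power \<beta>" using D(5) f g by auto
    show "\<sigma> g - t * \<sigma> f \<notin> max_power (Suc \<beta>)" if t: "t \<in> max_power (\<beta> - 2)" for t
    proof -
      obtain u where "t = \<sigma> u" using surj by blast
      then show ?thesis using nd[of u] t D(3,5,8) by metis
    qed
    show "\<exists>u. a = u * \<sigma> f" if *: "\<sigma> g * a = u * \<sigma> f" for a u
    proof -
      obtain a' u' where au: "a = \<sigma> a'" "u = \<sigma> u'" using surj by blast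
      have "\<sigma> (g * a') = \<sigma> (u' * f)" using * au D(3) by simp
      then have "g * a' = u' * f" by (simp only: inj)
      from nzd[OF this] show ?thesis using au D(3) by metis
    qed
  qed (use s g in auto)
  moreover have "{u * \<sigma> f + v * \<sigma> g | u v. True} = \<sigma> ` {u * f + v * g | u v. True}"
  proof
    show "\<sigma> ` {u * f + v * g | u v. True} \<subseteq> {u * \<sigma> f + v * \<sigma> g | u v. True}" by (auto simp: D(2,3)) blast
    show "{u * \<sigma> f + v * \<sigma> g | u v. True} \<subseteq> \<sigma> ` {u * f + v * g | u v. True}"
    proof
      fix w assume "w \<in> {u * \<sigma> f + v * \<sigma> g | u v. True}"
      then obtain u' v' where w: "w = u' * \<sigma> f + v' * \<sigma> g" by blast
      obtain u v where "u' = \<sigma> u" "v' = \<sigma> v" using surj by metis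
      then have "w = \<sigma> u * \<sigma> f + \<sigma> v * \<sigma> g" using w by simp
      then have "w = \<sigma> (u * f + v * g)" by (simp add: D(2,3))
      then show "w \<in> \<sigma> ` {u * f + v * g | u v. True}" by blast
    qed
  qed
  ultimately obtain l where "transversal_parameter (\<sigma> ` {u * f + v * g | u v. True}) \<beta> l" by auto
  moreover obtain l' where "l = \<sigma> l'" using surj by blast
  ultimately show ?thesis using transversal_parameter_aut[OF s(1)] by blast
qed

section \<open>Initial forms\<close>

definition poly3_coeff :: "'k::field poly3 \<Rightarrow> nat \<Rightarrow> nat \<Rightarrow> nat \<Rightarrow> 'k" where
  "poly3_coeff p i j l = coeff (coeff (coeff p l) j) i"

lemma poly3_eq_iff: "p = q \<longleftrightarrow> (\<forall>i j l. poly3_coeff p i j l = poly3_coeff q i j l)"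
  by (auto simp: poly3_coeff_def poly_eq_iff)

lemma poly3_coeff_mult:
  "poly3_coeff (p * q) i j l =
     (\<Sum>l'\<le>l. \<Sum>j'\<le>j. \<Sum>i'\<le>i. poly3_coeff p i' j' l' * poly3_coeff q (i - i') (j - j') (l - l'))"
  by (simp add: poly3_coeff_def coeff_mult coeff_sum)

definition homogeneous_part :: "nat \<Rightarrow> 'k::field ps3 \<Rightarrow> 'k poly3" where
  "homogeneous_part n f = (\<Sum>(i, j, l) \<in> {(i, j, l). i + j + l = n}. poly3_monom (ps3_coeff f i j l) i j l)"

lemma poly3_coeff_homogeneous_part:
  "poly3_coeff (homogeneous_part n f) i j l = (if i + j + l = n then ps3_coeff f i j l else 0)"
proof -
  have fin: "finite {(i, j, l). i + j + l = n}"
    by (rule finite_subset[of _ "{..n} \<times> {..n} \<times> {..n}"]) auto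
  have "poly3_coeff (homogeneous_part n f) i j l =
    (\<Sum>t \<in> {(i, j, l). i + j + l = n}. if t = (i, j, l) then ps3_coeff f i j l else 0)"
    unfolding homogeneous_part_def poly3_coeff_def coeff_sum
    by (intro sum.cong refl) (auto simp: poly3_monom_def split: prod.splits)
  also have "\<dots> = (if i + j + l = n then ps3_coeff f i j l else 0)"
    using fin by (simp add: sum.delta)
  finally show ?thesis .
qed

text \<open>Below the degrees \<open>m\<close> and \<open>n\<close> the factors vanish, so only
  their lowest parts contribute in degree \<open>m + n\<close>.\<close>

lemma homogeneous_part_mult:
  assumes "s \<in> max_power m" "f \<in> max_power n"
  shows "homogeneous_part (m + n) (s * f) = homogeneous_part m s * homogeneous_part n f"
  unfolding poly3_eq_iff
proof (intro allI)
  fix i j l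
  have "poly3_coeff (homogeneous_part m s) i' j' l' * poly3_coeff (homogeneous_part n f) (i - i') (j - j') (l - l')
    = (if i + j + l = m + n then ps3_coeff s i' j' l' * ps3_coeff f (i - i') (j - j') (l - l') else 0)"
    if "i' \<le> i" "j' \<le> j" "l' \<le> l" for i' j' l'
  proof (cases "i' + j' + l' = m")
    case False
    have "ps3_coeff s i' j' l' * ps3_coeff f (i - i') (j - j') (l - l') = 0" if "i + j + l = m + n"
    proof (cases "i' + j' + l' < m")
      case True
      then show ?thesis using assms(1) by (simp add: max_power_iff)
    next
      case F: False
      then have "(i - i') + (j - j') + (l - l') < n"
        using that False \<open>i' \<le> i\<close> \<open>j' \<le> j\<close> \<open>l' \<le> l\<close> by linarith
      then show ?thesis using assms(2) by (simp add: max_power_iff)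
    qed
    then show ?thesis using False by (simp add: poly3_coeff_homogeneous_part)
  next
    case True
    then have "(i - i') + (j - j') + (l - l') = n \<longleftrightarrow> i + j + l = m + n" using that by linarith
    then show ?thesis using True by (simp add: poly3_coeff_homogeneous_part)
  qed
  then have "poly3_coeff (homogeneous_part m s * homogeneous_part n f) i j l =
    (\<Sum>l'\<le>l. \<Sum>j'\<le>j. \<Sum>i'\<le>i. if i + j + l = m + n
       then ps3_coeff s i' j' l' * ps3_coeff f (i - i') (j - j') (l - l') else 0)"
    unfolding poly3_coeff_mult by (intro sum.cong refl) auto
  then show "poly3_coeff (homogeneous_part (m + n) (s * f)) i j l =
    poly3_coeff (homogeneous_part m s * homogeneous_part n f) i j l"
    by (auto simp: poly3_coeff_homogeneous_part ps3_coeff_mult)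
qed

lemma ps3_order:
  assumes "f \<noteq> 0"
  shows "f \<in> max_power (ps3_order f)" "f \<notin> max_power (Suc (ps3_order f))"
proof -
  have "\<exists>n i j l. i + j + l = n \<and> ps3_coeff f i j l \<noteq> 0" using assms by (auto simp: ps3_eq_iff)
  from LeastI_ex[OF this] show "f \<notin> max_power (Suc (ps3_order f))"
    unfolding ps3_order_def[symmetric] max_power_iff by force
  show "f \<in> max_power (ps3_order f)"
    unfolding max_power_iff ps3_order_def using not_less_Least by blast
qed

lemma ps3_Idl_pair:
  fixes f g :: "'k::field ps3"
  shows "Idl\<^bsub>ps3_ring\<^esub> {f, g} = {u * f + v * g | u v. True}" (is "_ = ?I")
proof -
  interpret R: cring "ps3_ring :: 'k ps3 ring" by (rule cring_from_type_algebra)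
  have sub: "{f, g} \<subseteq> carrier ps3_ring" by (simp add: ring_of_type_algebra_def)
  interpret J: ideal "Idl\<^bsub>ps3_ring\<^esub> {f, g}" ps3_ring by (rule R.genideal_ideal[OF sub])
  have fg: "f \<in> Idl\<^bsub>ps3_ring\<^esub> {f, g}" "g \<in> Idl\<^bsub>ps3_ring\<^esub> {f, g}" using R.genideal_self[OF sub] by auto
  have "?I \<subseteq> Idl\<^bsub>ps3_ring\<^esub> {f, g}"
  proof
    fix w assume "w \<in> ?I"
    then obtain u v where w: "w = u * f + v * g" by blast
    have "u * f \<in> Idl\<^bsub>ps3_ring\<^esub> {f, g}" "v * g \<in> Idl\<^bsub>ps3_ring\<^esub> {f, g}"
      using J.I_l_closed[OF fg(1), of u] J.I_l_closed[OF fg(2), of v] by (simp_all add: ring_of_type_algebra_def)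
    from J.a_closed[OF this] show "w \<in> Idl\<^bsub>ps3_ring\<^esub> {f, g}" by (simp add: ring_of_type_algebra_def w)
  qed
  moreover have "ideal ?I ps3_ring"
  proof (rule idealI[OF R.ring_axioms])
    show "subgroup ?I (add_monoid ps3_ring)"
    proof (rule R.add.subgroupI)
      fix a assume "a \<in> ?I"
      then obtain u v where a: "a = u * f + v * g" by blast
      have "\<ominus>\<^bsub>ps3_ring\<^esub> a = - a"
        by (rule R.minus_equality) (simp_all add: ring_of_type_algebra_def)
      also have "\<dots> = (- u) * f + (- v) * g" unfolding a by (simp add: algebra_simps)
      finally show "\<ominus>\<^bsub>ps3_ring\<^esub> a \<in> ?I" by blast
      fix b assume "b \<in> ?I"
      then obtain u' v' where b: "b = u' * f + v' * g" by blast
      have "a \<oplus>\<^bsub>ps3_ring\<^esub> b = (u + u') * f + (v + v') * g"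
        unfolding a b by (simp add: ring_of_type_algebra_def algebra_simps)
      then show "a \<oplus>\<^bsub>ps3_ring\<^esub> b \<in> ?I" by blast
    qed (auto simp: ring_of_type_algebra_def)
    fix a r assume "a \<in> ?I"
    then obtain u v where a: "a = u * f + v * g" by blast
    have "r * a = (r * u) * f + (r * v) * g" unfolding a by (simp add: algebra_simps)
    then show "r \<otimes>\<^bsub>ps3_ring\<^esub> a \<in> ?I" "a \<otimes>\<^bsub>ps3_ring\<^esub> r \<in> ?I"
      by (auto simp: ring_of_type_algebra_def mult.commute[of _ r])
  qed
  then have "Idl\<^bsub>ps3_ring\<^esub> {f, g} \<subseteq> ?I"
  proof (rule R.genideal_minimal)
    have "f = 1 * f + 0 * g" "g = 0 * f + 1 * g" by simp_all
    then show "{f, g} \<subseteq> ?I" by blast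
  qed
  ultimately show ?thesis by blast
qed

text \<open>The condition on initial forms is translated into orders: if \<open>g - s * f\<close>
  had order above \<open>b\<close>, comparing parts of degree \<open>b\<close> would make the
  initial form of \<open>g\<close> a multiple of that of \<open>f\<close>. The regular sequence says
  that \<open>g\<close> is a nonzerodivisor modulo \<open>f\<close>.\<close>

theorem ideal_of_type_2_transversal_parameter:
  fixes I :: "'k::field_char_0 ps3 set"
  assumes "ideal_of_type 2 b I"
  shows "\<exists>l. transversal_parameter I b l"
proof -
  obtain f g where fg: "f \<noteq> 0" "g \<noteq> 0" "regular_sequence ps3_ring [f, g]" "I = Idl\<^bsub>ps3_ring\<^esub> {f, g}"
    "ps3_order f = 2" "ps3_order g = b" "initial_form g \<notin> PIdl\<^bsub>poly3_ring\<^esub> (initial_form f)" and b: "2 \<le> b"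
    using assms unfolding ideal_of_type_def by blast
  have f: "f \<in> max_power 2" "f \<notin> max_power 3" using ps3_order[OF fg(1)] fg(5) by (auto simp: eval_nat_numeral)
  have g: "g \<in> max_power b" using ps3_order[OF fg(2)] fg(6) by auto
  have hp: "initial_form f = homogeneous_part 2 f" "initial_form g = homogeneous_part b g"
    unfolding initial_form_def homogeneous_part_def using fg(5,6) by auto
  have Idl1: "Idl\<^bsub>ps3_ring\<^esub> {f} = {u * f | u. True}"
    using ps3_Idl_pair[of f f] by (auto simp: distrib_right[symmetric]) (metis add.right_neutral)
  have "\<exists>l. transversal_parameter {u * f + v * g | u v. True} b l"
  proof (rule exists_transversal_parameter[OF f g b])
    fix s :: "'k ps3" assume s: "s \<in> max_power (b - 2)"
    show "g - s * f \<notin> max_power (Suc b)"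
    proof
      assume "g - s * f \<in> max_power (Suc b)"
      then have "homogeneous_part b g = homogeneous_part b (s * f)"
        unfolding poly3_eq_iff poly3_coeff_homogeneous_part max_power_iff by auto
      also have "\<dots> = homogeneous_part (b - 2) s * homogeneous_part 2 f"
        using homogeneous_part_mult[OF s f(1)] le_add_diff_inverse2[OF b] by (simp only:)
      finally have "initial_form g \<in> PIdl\<^bsub>poly3_ring\<^esub> (initial_form f)"
        unfolding hp cgenideal_def by (auto simp: ring_of_type_algebra_def)
      with fg(7) show False ..
    qed
  next
    fix a u :: "'k ps3" assume *: "g * a = u * f"
    have "\<forall>i<length [f, g]. \<forall>a\<in>carrier ps3_ring.
        [f, g] ! i \<otimes>\<^bsub>ps3_ring\<^esub> a \<in> Idl\<^bsub>ps3_ring\<^esub> (set (take i [f, g])) \<longrightarrow> a \<in> Idl\<^bsub>ps3_ring\<^esub> (set (take i [f, g]))"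
      using fg(3) unfolding regular_sequence_def by blast
    moreover have "a \<in> carrier ps3_ring" "g \<otimes>\<^bsub>ps3_ring\<^esub> a = u * f"
      using * by (simp_all add: ring_of_type_algebra_def)
    ultimately show "\<exists>u. a = u * f" by (force simp: Idl1)
  qed
  then show ?thesis unfolding fg(4) ps3_Idl_pair .
qed

section \<open>Hilbert functions and injectivity\<close>

interpretation ps3: kspace "\<lambda>c f. ps3_const c * f :: 'k::field ps3"
  by unfold_locales (simp_all add: ps3_const_arith algebra_simps)

lemma max_power_span:
  "\<exists>A\<subseteq>max_power n. finite A \<and> (max_power n :: 'k::field ps3 set) \<subseteq> max_power (Suc n) + ps3.span A"
proof -
  define D where "D = {(i, j, l). i + j + l = n}"
  have fin: "finite D"
    unfolding D_def by (rule finite_subset[of _ "{..n} \<times> {..n} \<times> {..n}"]) auto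
  define mono :: "nat \<times> nat \<times> nat \<Rightarrow> 'k ps3" where
    "mono = (\<lambda>(i, j, l). ps3_of (\<lambda>i' j' l'. if (i', j', l') = (i, j, l) then 1 else 0))"
  have "f \<in> max_power (Suc n) + ps3.span (mono ` D)" if f: "f \<in> max_power n" for f :: "'k ps3"
  proof -
    define g where "g = (\<Sum>(i, j, l)\<in>D. ps3_const (ps3_coeff f i j l) * mono (i, j, l))"
    have "g \<in> ps3.span (mono ` D)"
      unfolding g_def
      by (rule ps3.span_sum) (auto simp: case_prod_beta intro!: ps3.span_scale[OF ps3.span_base])
    moreover have "f - g \<in> max_power (Suc n)"
      unfolding max_power_iff
    proof (intro allI impI)
      fix i j l assume "i + j + l < Suc n"
      have "ps3_coeff g i j l = (\<Sum>t\<in>D. if t = (i, j, l) then ps3_coeff f i j l else 0)"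
        unfolding g_def ps3_coeff_sum by (intro sum.cong refl) (auto simp: mono_def split: if_splits)
      also have "\<dots> = (if i + j + l = n then ps3_coeff f i j l else 0)"
        using fin by (simp add: sum.delta D_def)
      finally show "ps3_coeff (f - g) i j l = 0"
        using f \<open>i + j + l < Suc n\<close> by (auto simp: max_power_iff)
    qed
    ultimately have "(f - g) + g \<in> max_power (Suc n) + ps3.span (mono ` D)" by (rule set_plus_intro[rotated])
    then show ?thesis by simp
  qed
  moreover have "mono ` D \<subseteq> max_power n" by (auto simp: mono_def D_def max_power_iff)
  ultimately show ?thesis using fin by blast
qed

lemma ps3_plus_subset: "ps3.subspace C \<Longrightarrow> A \<subseteq> C \<Longrightarrow> B \<subseteq> C \<Longrightarrow> A + B \<subseteq> C"
  by (auto simp: set_plus_def intro!: ps3.subspace_add)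

lemma subspace_max_power: "ps3.subspace (max_power n)"
  by (rule ps3.subspaceI) (auto intro: max_power_zero max_power_add max_power_mult_left)

text \<open>Turns the fact that M^(n+1) is M times M^n into a rule: inclusions pass from degree n to
  n+1 by checking products with elements of order at least 1.\<close>

lemma max_power_Suc_subset:
  fixes W W' :: "'k::field ps3 set"
  assumes "max_power n \<subseteq> W" "\<And>v w. v \<in> W' \<Longrightarrow> w \<in> W' \<Longrightarrow> v + w \<in> W'"
    and "\<And>v r. v \<in> W \<Longrightarrow> r \<in> max_power 1 \<Longrightarrow> r * v \<in> W'"
  shows "max_power (Suc n) \<subseteq> W'"
proof
  fix f :: "'k ps3" assume "f \<in> max_power (Suc n)"
  then obtain a b c where abc: "a \<in> max_power n" "b \<in> max_power n" "c \<in> max_power n"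
    "f = var_x * a + var_y * b + var_z * c" using max_power_Suc_decompose by blast
  have "r * v \<in> W'" if "v \<in> max_power n" "r \<in> max_power 1" for v r
    using assms(1,3) that by blast
  note this[OF abc(1) var_max_power(1)] this[OF abc(2) var_max_power(2)] this[OF abc(3) var_max_power(3)]
  then show "f \<in> W'" unfolding abc(4) by (intro assms(2))
qed

locale transversal =
  fixes I :: "'k::field ps3 set" and b :: nat and l :: "'k ps3"
  assumes I_0: "0 \<in> I" and I_add: "\<And>i j. i \<in> I \<Longrightarrow> j \<in> I \<Longrightarrow> i + j \<in> I"
    and I_mult: "\<And>i r. i \<in> I \<Longrightarrow> r * i \<in> I"
    and I_proper: "I \<subseteq> max_power 1"
    and param: "transversal_parameter I b l"
begin

text \<open>\<open>J n\<close> and \<open>L n\<close> are the preimages of \<open>m\<^sup>n\<close> and of \<open>l m\<^sup>n\<close> in \<open>K[[x,y,z]]\<close>.\<close>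

definition J :: "nat \<Rightarrow> 'k ps3 set" where "J n = max_power n + I"

definition L :: "nat \<Rightarrow> 'k ps3 set" where "L n = (\<lambda>a. l * a) ` J n + I"

lemma J_iff: "a \<in> J n \<longleftrightarrow> (\<exists>i\<in>I. a - i \<in> max_power n)"
proof
  assume "a \<in> J n"
  then obtain u i where "u \<in> max_power n" "i \<in> I" "a = u + i" unfolding J_def by (auto simp: set_plus_def)
  then show "\<exists>i\<in>I. a - i \<in> max_power n" by (intro bexI[of _ i]) auto
next
  assume "\<exists>i\<in>I. a - i \<in> max_power n"
  then obtain i where "i \<in> I" "a - i \<in> max_power n" by blast
  then have "(a - i) + i \<in> J n" unfolding J_def by (intro set_plus_intro)
  then show "a \<in> J n" by simp
qed

lemma subspace_I: "ps3.subspace I"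
  by (rule ps3.subspaceI) (auto intro: I_0 I_add I_mult)

lemma subspace_J: "ps3.subspace (J n)"
  unfolding J_def by (intro ps3.subspace_plus subspace_max_power subspace_I)

lemmas J_add = ps3.subspace_add[OF subspace_J] and J_diff = ps3.subspace_diff[OF subspace_J]

lemma J_mult: "r \<in> max_power m \<Longrightarrow> a \<in> J n \<Longrightarrow> r * a \<in> J (m + n)"
proof -
  assume r: "r \<in> max_power m" and "a \<in> J n"
  then obtain i where i: "i \<in> I" "a - i \<in> max_power n" using J_iff by blast
  have "r * a - r * i \<in> max_power (m + n)" using max_power_mult[OF r i(2)] by (simp add: algebra_simps)
  then show ?thesis unfolding J_iff using I_mult[OF i(1)] by blast
qed

lemma J_mult_left: "a \<in> J n \<Longrightarrow> r * a \<in> J n"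
  using J_mult[OF max_power_0, of a n r] by simp

lemma J_mono: "m \<le> n \<Longrightarrow> J n \<subseteq> J m"
  unfolding subset_iff J_iff using max_power_mono by blast

lemma max_power_J: "max_power n \<subseteq> J n"
  unfolding subset_iff J_iff using I_0 by (metis diff_zero)

lemma I_J: "I \<subseteq> J n"
  unfolding subset_iff J_iff using max_power_zero by (metis cancel_comm_monoid_add_class.diff_cancel)

lemma J_0: "J 0 = UNIV"
  using max_power_J[of 0] max_power_0 by blast

lemma J_1: "J 1 = max_power 1"
proof
  show "J 1 \<subseteq> max_power 1"
  proof
    fix a assume "a \<in> J 1"
    then obtain i where "i \<in> I" "a - i \<in> max_power 1" using J_iff by blast
    then have "(a - i) + i \<in> max_power 1" using I_proper max_power_add by blast
    then show "a \<in> max_power 1" by simp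
  qed
qed (rule max_power_J)

lemma l_max_power: "l \<in> max_power 1"
  using param unfolding transversal_parameter_def by blast

lemma l_cancel: "l * a \<in> I \<Longrightarrow> a \<in> I"
  using param unfolding transversal_parameter_def by blast

lemma subspace_mult_image: "ps3.subspace A \<Longrightarrow> ps3.subspace ((\<lambda>a. r * a) ` A)"
proof (rule ps3.subspaceI)
  assume A: "ps3.subspace A"
  show "0 \<in> (\<lambda>a. r * a) ` A" using ps3.subspace_0[OF A] by force
  show "x + y \<in> (\<lambda>a. r * a) ` A" if "x \<in> (\<lambda>a. r * a) ` A" "y \<in> (\<lambda>a. r * a) ` A" for x y
    using that ps3.subspace_add[OF A] by (auto simp: distrib_left[symmetric])
  show "ps3_const c * x \<in> (\<lambda>a. r * a) ` A" if "x \<in> (\<lambda>a. r * a) ` A" for c x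
    using that ps3.subspace_scale[OF A] by (auto simp: mult.left_commute)
qed

lemma subspace_L: "ps3.subspace (L n)"
  unfolding L_def by (intro ps3.subspace_plus subspace_mult_image subspace_J subspace_I)

lemma L_iff: "v \<in> L n \<longleftrightarrow> (\<exists>a\<in>J n. v - l * a \<in> I)"
proof
  assume "v \<in> L n"
  then obtain a i where "a \<in> J n" "i \<in> I" "v = l * a + i" unfolding L_def by (auto simp: set_plus_def)
  then show "\<exists>a\<in>J n. v - l * a \<in> I" by (intro bexI[of _ a]) auto
next
  assume "\<exists>a\<in>J n. v - l * a \<in> I"
  then obtain a where "a \<in> J n" "v - l * a \<in> I" by blast
  then have "l * a + (v - l * a) \<in> L n" unfolding L_def by (intro set_plus_intro imageI)
  then show "v \<in> L n" by simp
qed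

lemma L_J: "L n \<subseteq> J (Suc n)"
proof
  fix v assume "v \<in> L n"
  then obtain a where a: "a \<in> J n" "v - l * a \<in> I" unfolding L_iff by blast
  have "l * a \<in> J (Suc n)" using J_mult[OF l_max_power a(1)] by simp
  moreover have "v - l * a \<in> J (Suc n)" using a(2) I_J by blast
  ultimately have "l * a + (v - l * a) \<in> J (Suc n)" by (rule J_add)
  then show "v \<in> J (Suc n)" by simp
qed

lemma L_mono: "m \<le> n \<Longrightarrow> L n \<subseteq> L m"
  unfolding subset_iff L_iff using J_mono by blast

lemma L_mult_left: "v \<in> L n \<Longrightarrow> r \<in> max_power m \<Longrightarrow> r * v \<in> L (m + n)"
proof -
  assume "v \<in> L n" and r: "r \<in> max_power m"
  then obtain a where a: "a \<in> J n" "v - l * a \<in> I" unfolding L_iff by blast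
  have "r * v - l * (r * a) \<in> I" using I_mult[OF a(2), of r] by (simp add: algebra_simps)
  then show ?thesis unfolding L_iff using J_mult[OF r a(1)] by blast
qed

lemma L_eq_J_Suc:
  assumes "L n = J (Suc n)"
  shows "L (Suc n) = J (Suc (Suc n))"
proof
  have "max_power (Suc (Suc n)) \<subseteq> L (Suc n)"
  proof (rule max_power_Suc_subset)
    show "max_power (Suc n) \<subseteq> L n" unfolding assms by (rule max_power_J)
    show "r * v \<in> L (Suc n)" if "v \<in> L n" "r \<in> max_power 1" for v r
      using L_mult_left[OF that] by simp
  qed (rule ps3.subspace_add[OF subspace_L])
  moreover have "I \<subseteq> L (Suc n)"
    unfolding subset_iff L_iff using ps3.subspace_0[OF subspace_J] by (metis diff_zero mult_zero_right)
  ultimately show "J (Suc (Suc n)) \<subseteq> L (Suc n)"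
    unfolding J_def by (rule ps3_plus_subset[OF subspace_L])
qed (rule L_J)

lemma L_eq_J_mono:
  assumes "L n = J (Suc n)" "n \<le> m"
  shows "L m = J (Suc m)"
  using assms(2)
proof (induction rule: dec_induct)
  case base
  show ?case by (rule assms(1))
next
  case (step k)
  show ?case by (rule L_eq_J_Suc[OF step.IH])
qed

lemma L_eq_J_eventually: "\<exists>N. \<forall>n\<ge>N. L n = J (Suc n)"
proof -
  obtain N where N: "\<And>a. a \<in> max_power (Suc N) \<Longrightarrow> \<exists>c\<in>max_power N. a - l * c \<in> I"
    using param unfolding transversal_parameter_def by blast
  have "J (Suc N) \<subseteq> L N"
  proof
    fix a assume "a \<in> J (Suc N)"
    then obtain i where i: "i \<in> I" "a - i \<in> max_power (Suc N)" unfolding J_iff by blast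
    then obtain c where c: "c \<in> max_power N" "a - i - l * c \<in> I" using N by blast
    have "i + (a - i - l * c) \<in> I" using i c I_add by blast
    moreover have "i + (a - i - l * c) = a - l * c" by simp
    ultimately have "a - l * c \<in> I" by simp
    then show "a \<in> L N" unfolding L_iff using c(1) max_power_J by blast
  qed
  then have "L N = J (Suc N)" using L_J by blast
  then show ?thesis using L_eq_J_mono by blast
qed

definition hf :: "nat \<Rightarrow> nat" where "hf n = (SOME d. ps3.reldim (J (Suc n)) d (J n))"

text \<open>Measures how far m^(n+1) is from l m^n. Finiteness is shown in
  \<open>reldim_defect\<close>: l m^n contains a high power of m.\<close>

definition defect :: "nat \<Rightarrow> nat" where "defect n = (SOME d. ps3.reldim (L n) d (J (Suc n)))"

lemma reldim_hf: "ps3.reldim (J (Suc n)) (hf n) (J n)"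
proof -
  obtain A where A: "finite A" "(max_power n :: 'k ps3 set) \<subseteq> max_power (Suc n) + ps3.span A"
    using max_power_span by blast
  have "J n \<subseteq> (max_power (Suc n) + ps3.span A) + I" unfolding J_def by (intro set_plus_mono2 A) auto
  also have "\<dots> = J (Suc n) + ps3.span A" unfolding J_def by (simp add: ac_simps)
  finally have "\<exists>d. ps3.reldim (J (Suc n)) d (J n)"
    by (intro ps3.reldim_exists[OF subspace_J subspace_J J_mono A(1)]) auto
  then show ?thesis unfolding hf_def by (rule someI_ex)
qed

lemma reldim_J: "m \<le> n \<Longrightarrow> \<exists>d. ps3.reldim (J n) d (J m)"
proof (induction rule: dec_induct)
  case base
  then show ?case using ps3.reldim_0 by blast
next
  case (step n)
  then show ?case using ps3.reldim_trans[OF _ reldim_hf[of n]] by blast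
qed

lemma reldim_defect: "ps3.reldim (L n) (defect n) (J (Suc n))"
proof -
  obtain N where N: "\<And>n. n \<ge> N \<Longrightarrow> L n = J (Suc n)" using L_eq_J_eventually by blast
  let ?m = "max n N"
  have "J (Suc ?m) \<subseteq> L n" using N[of ?m] L_mono[of n ?m] by simp
  moreover obtain d where "ps3.reldim (J (Suc ?m)) d (J (Suc n))" using reldim_J[of "Suc n" "Suc ?m"] by auto
  ultimately have "\<exists>d. ps3.reldim (L n) d (J (Suc n))"
    using ps3.reldim_split[OF _ subspace_J subspace_L _ L_J] by blast
  then show ?thesis unfolding defect_def by (rule someI_ex)
qed

lemma defect_0_iff: "defect n = 0 \<longleftrightarrow> L n = J (Suc n)"
proof
  assume "defect n = 0"
  then have "ps3.reldim (L n) 0 (J (Suc n))" using reldim_defect[of n] by simp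
  then show "L n = J (Suc n)" by (auto elim: ps3.reldim.cases)
next
  assume "L n = J (Suc n)"
  then have "ps3.reldim (L n) (defect n) (L n)" using reldim_defect[of n] by simp
  then show "defect n = 0" using ps3.reldim_0_iff[OF subspace_L] by blast
qed

text \<open>As l is a nonzerodivisor on A, multiplication by l identifies m^n/m^(n+1) with l m^n/l
  m^(n+1).\<close>

lemma reldim_L: "ps3.reldim (L (Suc n)) (hf n) (L n)"
proof -
  have "ps3.reldim (L (Suc n)) (hf n) ((\<lambda>a. l * a) ` J n + L (Suc n))"
  proof (rule ps3.reldim_map[OF reldim_hf subspace_J subspace_L])
    fix a assume "a \<in> J n"
    show "l * a \<in> L (Suc n) \<longleftrightarrow> a \<in> J (Suc n)"
    proof
      assume "l * a \<in> L (Suc n)"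
      then obtain c where c: "c \<in> J (Suc n)" "l * a - l * c \<in> I" unfolding L_iff by blast
      have "a - c \<in> I" by (rule l_cancel) (use c(2) in \<open>simp add: algebra_simps\<close>)
      then have "(a - c) + c \<in> J (Suc n)" using c(1) J_add I_J by blast
      then show "a \<in> J (Suc n)" by simp
    next
      assume "a \<in> J (Suc n)"
      then show "l * a \<in> L (Suc n)" unfolding L_iff using I_0 by (intro bexI[of _ a]) auto
    qed
  qed (simp_all add: algebra_simps)
  moreover have "(\<lambda>a. l * a) ` J n + L (Suc n) = L n"
  proof
    have "(\<lambda>a. l * a) ` J n \<subseteq> L n" unfolding L_iff image_subset_iff using I_0 by (metis cancel_comm_monoid_add_class.diff_cancel)
    then show "(\<lambda>a. l * a) ` J n + L (Suc n) \<subseteq> L n"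
      by (rule ps3_plus_subset[OF subspace_L _ L_mono]) simp
    have "I \<subseteq> L (Suc n)"
      unfolding subset_iff L_iff using ps3.subspace_0[OF subspace_J] by (metis diff_zero mult_zero_right)
    then show "L n \<subseteq> (\<lambda>a. l * a) ` J n + L (Suc n)" unfolding L_def[of n] by (intro set_plus_mono2) auto
  qed
  ultimately show ?thesis by simp
qed

text \<open>Both sides are the dimension of \<open>A/lA\<close>: this is where the one-dimensional Cohen--Macaulay
  property of \<open>A\<close> enters.\<close>

lemma hf_defect_Suc: "hf (Suc n) + defect (Suc n) = hf n + defect n"
proof -
  have "ps3.reldim (L (Suc n)) (hf n + (defect n + hf n)) (J n)"
    by (rule ps3.reldim_trans[OF ps3.reldim_trans[OF reldim_hf reldim_defect] reldim_L])
  moreover have "ps3.reldim (L (Suc n)) (defect (Suc n) + (hf (Suc n) + hf n)) (J n)"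
    by (rule ps3.reldim_trans[OF ps3.reldim_trans[OF reldim_hf reldim_hf] reldim_defect])
  ultimately have "hf n + (defect n + hf n) = defect (Suc n) + (hf (Suc n) + hf n)"
    using ps3.reldim_unique[OF _ _ subspace_L] by blast
  then show ?thesis by simp
qed

lemma hf_defect: "hf n + defect n = hf m + defect m"
proof -
  have "hf n + defect n = hf 0 + defect 0" for n
    by (induction n) (simp_all add: hf_defect_Suc)
  then show ?thesis by metis
qed

lemma defect_mono_0: "defect n = 0 \<Longrightarrow> n \<le> m \<Longrightarrow> defect m = 0"
  unfolding defect_0_iff by (rule L_eq_J_mono)

lemma eventual_value_hf: "\<exists>N. (\<forall>n\<ge>N. defect n = 0 \<and> hf n = eventual_value hf)"
proof -
  obtain N where N: "\<And>n. n \<ge> N \<Longrightarrow> defect n = 0" using L_eq_J_eventually defect_0_iff by blast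
  have c: "hf n = hf N" if "n \<ge> N" for n using hf_defect[of n N] N[OF that] N[of N] by simp
  have "eventual_value hf = hf N"
    unfolding eventual_value_def
  proof (rule the_equality)
    show "\<forall>\<^sub>F t in sequentially. hf t = hf N" unfolding eventually_sequentially using c by blast
    fix e assume "\<forall>\<^sub>F t in sequentially. hf t = e"
    then obtain M where "\<forall>t\<ge>M. hf t = e" unfolding eventually_sequentially by blast
    then have "hf (max M N) = e" by simp
    then show "e = hf N" using c[of "max M N"] by simp
  qed
  then show ?thesis using N c by (intro exI[of _ N]) metis
qed

lemma hf_eq_eventual_value_iff: "hf n = eventual_value hf \<longleftrightarrow> defect n = 0"
proof -
  obtain N where "defect N = 0" "hf N = eventual_value hf" using eventual_value_hf by blast
  then show ?thesis using hf_defect[of n N] by auto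
qed

text \<open>The constant sum \<open>hf n + defect n\<close> equals the eventual value for large
  \<open>n\<close>, and at \<open>n = 0\<close> it is at least \<open>hf 0\<close>, which is
  positive because 1 is not in M.\<close>

lemma eventual_value_pos: "eventual_value hf > 0"
proof -
  have "hf 0 \<noteq> 0"
  proof
    assume "hf 0 = 0"
    then have "ps3.reldim (J (Suc 0)) 0 (J 0)" using reldim_hf[of 0] by simp
    then have "J (Suc 0) = J 0" by (auto elim: ps3.reldim.cases)
    then have "(1 :: 'k ps3) \<in> max_power 1" using J_0 J_1 by auto
    then have "ps3_coeff (1 :: 'k ps3) 0 0 0 = 0" unfolding max_power_iff by simp
    then show False by (simp add: ps3_coeff_def)
  qed
  moreover obtain N where "defect N = 0" "hf N = eventual_value hf" using eventual_value_hf by blast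
  ultimately show ?thesis using hf_defect[of N 0] by simp
qed

section \<open>Multiplication by l on the associated graded ring\<close>

definition inj_at :: "nat \<Rightarrow> bool" where
  "inj_at n \<longleftrightarrow> (\<forall>a\<in>J n. l * a \<in> J (n + 2) \<longrightarrow> a \<in> J (Suc n))"

definition surj_at :: "nat \<Rightarrow> bool" where
  "surj_at n \<longleftrightarrow> J (Suc n) = (\<lambda>a. l * a) ` J n + J (n + 2)"

lemma image_J_subset: "(\<lambda>a. l * a) ` J n + J (n + 2) \<subseteq> J (Suc n)"
proof -
  have "l * a \<in> J (Suc n)" if "a \<in> J n" for a using J_mult[OF l_max_power that] by simp
  then show ?thesis by (intro ps3_plus_subset[OF subspace_J _ J_mono]) auto
qed

text \<open>Here \<open>k\<close>, \<open>a\<close> and \<open>c\<close> are nullity, rank and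
  corank of l from degree \<open>n\<close> to \<open>n + 1\<close>. The bound on \<open>c\<close>
  holds because the image together with the single vector \<open>w\<close> fills degree
  \<open>n + 1\<close>.\<close>

lemma rank_nullity:
  obtains k a c where "hf n = k + a" "hf (Suc n) = a + c" "k = 0 \<longleftrightarrow> inj_at n" "c = 0 \<longleftrightarrow> surj_at n"
    "b \<le> Suc n \<Longrightarrow> c \<le> 1"
proof -
  define K where "K = {a \<in> J n. l * a \<in> J (n + 2)}"
  have K: "ps3.subspace K"
  proof (rule ps3.subspaceI)
    show "0 \<in> K" unfolding K_def using ps3.subspace_0[OF subspace_J] by simp
    show "x + y \<in> K" if "x \<in> K" "y \<in> K" for x y
      using that J_add unfolding K_def by (auto simp: distrib_left)
    show "ps3_const c * x \<in> K" if "x \<in> K" for c x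
      using that J_mult_left unfolding K_def by (auto simp: mult.left_commute[of l])
  qed
  have "J (Suc n) \<subseteq> K"
    unfolding K_def using J_mono[of n "Suc n"] J_mult[OF l_max_power, of _ "Suc n"] by auto
  from ps3.reldim_split[OF reldim_hf subspace_J K this] obtain k a where
    ka: "hf n = k + a" "ps3.reldim (J (Suc n)) k K" "ps3.reldim K a (J n)" unfolding K_def by blast
  let ?T = "(\<lambda>a. l * a) ` J n + J (n + 2)"
  have T: "ps3.subspace ?T" by (intro ps3.subspace_plus subspace_mult_image subspace_J)
  have rT: "ps3.reldim (J (n + 2)) a ?T"
    by (rule ps3.reldim_map[OF ka(3) K subspace_J]) (auto simp: K_def algebra_simps)
  have "J (n + 2) \<subseteq> ?T"
  proof -
    have "0 \<in> (\<lambda>a. l * a) ` J n" using ps3.subspace_0[OF subspace_J[of n]] by force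
    then show ?thesis by (rule set_zero_plus2)
  qed
  moreover have "ps3.reldim (J (n + 2)) (hf (Suc n)) (J (Suc n))" using reldim_hf[of "Suc n"] by simp
  ultimately obtain a' c where c: "hf (Suc n) = a' + c" "ps3.reldim (J (n + 2)) a' ?T" "ps3.reldim ?T c (J (Suc n))"
    using ps3.reldim_split[OF _ subspace_J T _ image_J_subset] by blast
  have "a' = a" using ps3.reldim_unique[OF c(2) rT subspace_J] .
  have "k = 0 \<longleftrightarrow> K = J (Suc n)"
    using ka(2) ps3.reldim_0_iff[OF subspace_J] by (auto elim: ps3.reldim.cases)
  also have "\<dots> \<longleftrightarrow> inj_at n" unfolding inj_at_def using \<open>J (Suc n) \<subseteq> K\<close> unfolding K_def by blast
  finally have k: "k = 0 \<longleftrightarrow> inj_at n" .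
  have c0: "c = 0 \<longleftrightarrow> surj_at n"
    unfolding surj_at_def using c(3) ps3.reldim_0_iff[OF T] by (auto elim: ps3.reldim.cases)
  have c1: "c \<le> 1" if bn: "b \<le> Suc n"
  proof -
    obtain w where w: "\<forall>a\<in>max_power (Suc n). \<exists>c\<in>max_power n. \<exists>k. \<exists>i\<in>I.
        a - l * c - ps3_const k * w - i \<in> max_power (Suc (Suc n))"
      using param bn unfolding transversal_parameter_def by (metis diff_Suc_1)
    have sub: "J (Suc n) \<subseteq> ?T + range (\<lambda>c. ps3_const c * w)"
    proof
      fix v assume "v \<in> J (Suc n)"
      then obtain j where j: "j \<in> I" "v - j \<in> max_power (Suc n)" unfolding J_iff by blast
      from w j(2) obtain u k i where u: "u \<in> max_power n" "i \<in> I"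
        "v - j - l * u - ps3_const k * w - i \<in> max_power (Suc (Suc n))" by blast
      have "v - l * u - ps3_const k * w - (j + i) \<in> max_power (n + 2)"
        using u(3) by (simp add: algebra_simps)
      then have "v - l * u - ps3_const k * w \<in> J (n + 2)" unfolding J_iff using I_add[OF j(1) u(2)] by blast
      moreover have "l * u \<in> (\<lambda>a. l * a) ` J n" using u(1) max_power_J by blast
      ultimately have "l * u + (v - l * u - ps3_const k * w) \<in> ?T" by (rule set_plus_intro[rotated])
      then have "(l * u + (v - l * u - ps3_const k * w)) + ps3_const k * w \<in> ?T + range (\<lambda>c. ps3_const c * w)"
        by (rule set_plus_intro) blast
      then show "v \<in> ?T + range (\<lambda>c. ps3_const c * w)" by (simp add: algebra_simps)
    qed
    show "c \<le> 1"
    proof (cases "w \<in> ?T")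
      case True
      then have "?T + range (\<lambda>c. ps3_const c * w) \<subseteq> ?T" using ps3.line_subset[OF T] by blast
      then have "J (Suc n) = ?T" using sub image_J_subset by blast
      then show ?thesis using c0 unfolding surj_at_def by simp
    next
      case False
      have "ps3.reldim ?T (Suc 0) (?T + range (\<lambda>c. ps3_const c * w))"
        by (rule ps3.reldim_Suc[OF ps3.reldim_0 False])
      from ps3.reldim_split[OF this T subspace_J image_J_subset sub] obtain i j where
        "Suc 0 = i + j" "ps3.reldim ?T i (J (Suc n))" by blast
      then show ?thesis using ps3.reldim_unique[OF c(3) _ T] by fastforce
    qed
  qed
  show ?thesis by (rule that[OF ka(1) _ k c0 c1]) (simp add: c(1) \<open>a' = a\<close>)
qed

lemma surj_at_defect: "defect n = 0 \<Longrightarrow> surj_at n"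
proof -
  assume "defect n = 0"
  then have "L n = J (Suc n)" by (simp add: defect_0_iff)
  moreover have "L n \<subseteq> (\<lambda>a. l * a) ` J n + J (n + 2)"
    unfolding L_def using I_J by (intro set_plus_mono2) auto
  ultimately show ?thesis unfolding surj_at_def using image_J_subset by blast
qed

text \<open>The Hilbert function is constant from \<open>n\<close> on, so the surjection given by l
  goes between spaces of equal dimension.\<close>

lemma inj_at_defect: "defect n = 0 \<Longrightarrow> inj_at n"
proof -
  assume d: "defect n = 0"
  then have "hf (Suc n) = hf n" using hf_defect[of n "Suc n"] defect_mono_0[OF d, of "Suc n"] by simp
  with surj_at_defect[OF d] show ?thesis by (rule_tac n = n in rank_nullity) auto
qed

text \<open>The graded ring is generated in degree 1: write a class of degree \<open>n + 2\<close>
  as a sum of products with classes of degree \<open>n + 1\<close>, which are multiples of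
  l.\<close>

lemma surj_at_Suc: "surj_at n \<Longrightarrow> surj_at (Suc n)"
proof -
  assume s: "surj_at n"
  let ?W = "(\<lambda>a. l * a) ` J (Suc n) + J (Suc n + 2)"
  have W: "ps3.subspace ?W" by (intro ps3.subspace_plus subspace_mult_image subspace_J)
  have "max_power (Suc (Suc n)) \<subseteq> ?W"
  proof (rule max_power_Suc_subset)
    show "max_power (Suc n) \<subseteq> J (Suc n)" by (rule max_power_J)
    fix v r assume v: "v \<in> J (Suc n)" and r: "r \<in> (max_power 1 :: 'k ps3 set)"
    from v s obtain a c where "v = l * a + c" "a \<in> J n" "c \<in> J (n + 2)"
      unfolding surj_at_def by (auto simp: set_plus_def)
    moreover from this have "r * a \<in> J (Suc n)" "r * c \<in> J (Suc n + 2)" using J_mult[OF r] by force+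
    moreover have "r * (l * a + c) = l * (r * a) + r * c" by (simp add: algebra_simps)
    ultimately show "r * v \<in> ?W" by (auto intro!: set_plus_intro)
  qed (rule ps3.subspace_add[OF W])
  moreover have "I \<subseteq> ?W"
  proof -
    have "0 \<in> (\<lambda>a. l * a) ` J (Suc n)" using ps3.subspace_0[OF subspace_J[of "Suc n"]] by force
    then show ?thesis using set_zero_plus2 I_J[of "Suc n + 2"] by blast
  qed
  ultimately have "J (Suc (Suc n)) \<subseteq> ?W"
    unfolding J_def[of "Suc (Suc n)"] by (rule ps3_plus_subset[OF W])
  then show ?thesis unfolding surj_at_def using image_J_subset[of "Suc n"] by blast
qed

theorem strictly_increasing_iff_inj: "strictly_increasing_HF hf \<longleftrightarrow> (\<forall>n. inj_at n)"
proof
  define r where "r = first_attained hf"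
  have "\<exists>r. hf r = eventual_value hf" using eventual_value_hf by blast
  then have r: "hf r = eventual_value hf" unfolding r_def first_attained_def by (rule LeastI_ex)
  have least: "r \<le> n" if "hf n = eventual_value hf" for n
    unfolding r_def first_attained_def using that by (rule Least_le)
  { assume inc: "strictly_increasing_HF hf"
    show "\<forall>n. inj_at n"
    proof
      fix n
      consider "Suc n < b" | "b \<le> Suc n" "n < r" | "r \<le> n" by linarith
      then show "inj_at n"
      proof cases
        case 1
        show ?thesis unfolding inj_at_def
        proof (intro ballI impI)
          fix a assume "a \<in> J n" and la: "l * a \<in> J (n + 2)"
          then obtain i where i: "i \<in> I" "a - i \<in> max_power n" unfolding J_iff by blast
          from la obtain j where j: "j \<in> I" "l * a - j \<in> max_power (n + 2)" unfolding J_iff by blast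
          have "l * (a - i) - (j + (- l) * i) \<in> max_power (n + 2)" using j(2) by (simp add: algebra_simps)
          moreover have "j + (- l) * i \<in> I" using I_add I_mult i j by blast
          ultimately obtain i' where "i' \<in> I" "a - i - i' \<in> max_power (Suc n)"
            using param 1 i(2) unfolding transversal_parameter_def by blast
          then have "a - (i + i') \<in> max_power (Suc n)" "i + i' \<in> I" using i(1) I_add by (auto simp: algebra_simps)
          then show "a \<in> J (Suc n)" unfolding J_iff by blast
        qed
      next
        case 2
        \<comment> \<open>Here \<open>hf (Suc n) - hf n = c - k\<close> is positive and
          \<open>c \<le> 1\<close>, which leaves \<open>k = 0\<close>.\<close>
        have "hf n < hf (Suc n)" using inc 2(2) unfolding strictly_increasing_HF_def r_def by blast
        with 2(1) show ?thesis by (rule_tac n = n in rank_nullity) auto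
      next
        case 3
        then have "defect n = 0" using r hf_eq_eventual_value_iff defect_mono_0 by blast
        then show ?thesis by (rule inj_at_defect)
      qed
    qed }
  { assume inj: "\<forall>n. inj_at n"
    show "strictly_increasing_HF hf"
      unfolding strictly_increasing_HF_def
    proof (intro allI impI)
      fix n assume "n < first_attained hf"
      show "hf n < hf (Suc n)"
      proof (rule ccontr)
        assume not: "\<not> hf n < hf (Suc n)"
        \<comment> \<open>With nullity 0 the difference of the two dimensions is the corank, so it
          must be 0. From here on l is bijective and the Hilbert function constant.\<close>
        have sn: "surj_at n" using inj not by (rule_tac n = n in rank_nullity) auto
        have surj: "surj_at m" if "n \<le> m" for m
          using that by (induction rule: dec_induct) (auto intro: surj_at_Suc sn)
        have const: "hf (Suc m) = hf m" if "n \<le> m" for m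
          using inj surj[OF that] by (rule_tac n = m in rank_nullity) auto
        have hfn: "hf m = hf n" if "n \<le> m" for m
          using that by (induction rule: dec_induct) (simp_all add: const)
        obtain N where "\<forall>n\<ge>N. hf n = eventual_value hf" using eventual_value_hf by blast
        then have "hf (max N n) = eventual_value hf" by simp
        then have "hf n = eventual_value hf" unfolding hfn[OF max.cobounded2] .
        then show False using least \<open>n < first_attained hf\<close> unfolding r_def by fastforce
      qed
    qed }
qed

text \<open>Let \<open>n\<close> be the largest degree in which l has a kernel and \<open>a\<close>
  a kernel element there. For \<open>r\<close> of degree 1, l kills \<open>r a\<close> as well, and
  injectivity in degree \<open>n + 1\<close> forces \<open>r a = 0\<close> in the graded
  ring.\<close>

lemma socle_element:
  assumes "\<not> (\<forall>n. inj_at n)"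
  shows "\<exists>n. \<exists>a\<in>max_power n. a \<notin> J (Suc n) \<and> (\<forall>r\<in>max_power 1. r * a \<in> J (n + 2))"
proof -
  obtain N where "\<forall>n\<ge>N. defect n = 0" using eventual_value_hf by blast
  then have N: "\<And>n. n \<ge> N \<Longrightarrow> inj_at n" using inj_at_defect by blast
  define n where "n = Max {n. \<not> inj_at n}"
  have fin: "finite {n. \<not> inj_at n}" by (rule finite_subset[of _ "{..<N}"]) (use N not_le in auto)
  have n: "\<not> inj_at n" using Max_in[OF fin] assms unfolding n_def by blast
  have S: "inj_at (Suc n)" using Max_ge[OF fin, of "Suc n"] unfolding n_def by fastforce
  from n obtain a where a: "a \<in> J n" "l * a \<in> J (n + 2)" "a \<notin> J (Suc n)" unfolding inj_at_def by blast
  then obtain i where i: "i \<in> I" "a - i \<in> max_power n" unfolding J_iff by blast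
  have iJ: "i \<in> J m" for m using i(1) I_J by blast
  have "a - i \<notin> J (Suc n)" using J_add[OF _ iJ, of "a - i" "Suc n"] a(3) by auto
  moreover have "r * (a - i) \<in> J (n + 2)" if r: "r \<in> max_power 1" for r
  proof -
    have "r * a \<in> J (Suc n)" using J_mult[OF r a(1)] by simp
    moreover have "r * (l * a) \<in> J (1 + (n + 2))" by (rule J_mult[OF r a(2)])
    then have "l * (r * a) \<in> J (Suc n + 2)" by (simp add: mult.left_commute)
    ultimately have "r * a \<in> J (Suc (Suc n))" using S unfolding inj_at_def by blast
    then have "r * a - r * i \<in> J (n + 2)" using J_diff J_mult_left[OF iJ] by simp
    then show ?thesis by (simp add: algebra_simps)
  qed
  ultimately show ?thesis using i(2) by blast
qed

text \<open>If l were nilpotent in the graded ring, then for large N the equality of m^(N+n) with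
  l^n m^N would give m^(N+n) = m^(N+n+1), so the Hilbert function would take the value 0 there,
  against \<open>eventual_value_pos\<close>. It yields positive height of the irrelevant
  ideal.\<close>

lemma l_power_notin: "l ^ n \<notin> J (Suc n)"
proof
  assume ln: "l ^ n \<in> J (Suc n)"
  obtain N where N: "\<And>n. n \<ge> N \<Longrightarrow> defect n = 0 \<and> hf n = eventual_value hf" using eventual_value_hf by blast
  have J: "\<exists>c\<in>J N. a - l ^ m * c \<in> I" if "a \<in> J (N + m)" for a m
    using that
  proof (induction m arbitrary: a)
    case 0
    then show ?case using I_0 by (intro bexI[of _ a]) auto
  next
    case (Suc m)
    have "L (N + m) = J (Suc (N + m))" using N[of "N + m"] defect_0_iff by simp
    then have "a \<in> L (N + m)" using Suc.prems by simp
    then obtain c where c: "c \<in> J (N + m)" "a - l * c \<in> I" unfolding L_iff by blast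
    from Suc.IH[OF c(1)] obtain c' where c': "c' \<in> J N" "c - l ^ m * c' \<in> I" by blast
    have "(a - l * c) + l * (c - l ^ m * c') \<in> I" using c(2) c'(2) I_add I_mult by blast
    then have "a - l ^ Suc m * c' \<in> I" by (simp add: algebra_simps)
    then show ?case using c'(1) by blast
  qed
  have "J (N + n) \<subseteq> J (Suc (N + n))"
  proof
    fix a assume "a \<in> J (N + n)"
    from J[OF this] obtain c where c: "c \<in> J N" "a - l ^ n * c \<in> I" by blast
    from c(1) obtain i where i: "i \<in> I" "c - i \<in> max_power N" unfolding J_iff by blast
    have "(c - i) * l ^ n \<in> J (N + Suc n)" by (rule J_mult[OF i(2) ln])
    moreover have "l ^ n * i + (a - l ^ n * c) \<in> J (N + Suc n)" using I_J I_add I_mult i(1) c(2) by blast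
    ultimately have "(c - i) * l ^ n + (l ^ n * i + (a - l ^ n * c)) \<in> J (N + Suc n)" by (rule J_add)
    then show "a \<in> J (Suc (N + n))" by (simp add: algebra_simps)
  qed
  then have "J (N + n) = J (Suc (N + n))" using J_mono[of "N + n" "Suc (N + n)"] by auto
  then have "hf (N + n) = 0" using reldim_hf[of "N + n"] ps3.reldim_0_iff[OF subspace_J] by metis
  then show False using N[of "N + n"] eventual_value_pos by simp
qed

end

section \<open>The graded pieces as quotients of \<open>K[[x,y,z]]\<close>\<close>

lemma ps3_ring_simps:
  "carrier ps3_ring = UNIV" "x \<otimes>\<^bsub>ps3_ring\<^esub> y = x * y" "x \<oplus>\<^bsub>ps3_ring\<^esub> y = x + y"
  "\<one>\<^bsub>ps3_ring\<^esub> = 1" "\<zero>\<^bsub>ps3_ring\<^esub> = 0"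
  by (simp_all add: ring_of_type_algebra_def)

lemma ps3_ring_minus:
  fixes x y :: "'k::field ps3"
  shows "\<ominus>\<^bsub>ps3_ring\<^esub> x = - x" "x \<ominus>\<^bsub>ps3_ring\<^esub> y = x - y"
proof -
  interpret R: cring "ps3_ring :: 'k ps3 ring" by (rule cring_from_type_algebra)
  show m: "\<ominus>\<^bsub>ps3_ring\<^esub> x = - x" for x :: "'k ps3"
    by (rule R.minus_equality) (simp_all add: ps3_ring_simps)
  show "x \<ominus>\<^bsub>ps3_ring\<^esub> y = x - y" unfolding a_minus_def m by (simp add: ps3_ring_simps)
qed

lemma ps3_idealI:
  fixes I :: "'k::field ps3 set"
  assumes "0 \<in> I" "\<And>i j. i \<in> I \<Longrightarrow> j \<in> I \<Longrightarrow> i + j \<in> I" "\<And>i r. i \<in> I \<Longrightarrow> r * i \<in> I"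
  shows "ideal I ps3_ring"
proof -
  interpret R: cring "ps3_ring :: 'k ps3 ring" by (rule cring_from_type_algebra)
  show ?thesis
  proof (rule idealI[OF R.ring_axioms])
    show "subgroup I (add_monoid ps3_ring)"
    proof (rule R.add.subgroupI)
      show "I \<noteq> {}" using assms(1) by blast
      fix a assume "a \<in> I"
      then show "\<ominus>\<^bsub>ps3_ring\<^esub> a \<in> I" using assms(3)[of a "- 1"] by (simp add: ps3_ring_minus)
    qed (simp_all add: ps3_ring_simps assms(2))
  qed (use assms(3) in \<open>simp_all add: ps3_ring_simps mult.commute\<close>)
qed

context transversal
begin

lemma ideal_I: "ideal I ps3_ring"
  by (rule ps3_idealI[OF I_0 I_add I_mult])

definition A :: "'k ps3 set ring" where "A = ps3_ring Quot I"

definition mA :: "'k ps3 set set" where "mA = quot_max_ideal I"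

definition \<pi> :: "'k ps3 \<Rightarrow> 'k ps3 set" where "\<pi> f = I +>\<^bsub>ps3_ring\<^esub> f"

lemma cring_ps3: "cring (ps3_ring :: 'k ps3 ring)"
  by (rule cring_from_type_algebra)

lemma cring_A: "cring A"
  unfolding A_def by (rule ideal.quotient_is_cring[OF ideal_I cring_ps3])

lemma pi_hom: "ring_hom_ring ps3_ring A \<pi>"
  using ideal.rcos_ring_hom_ring[OF ideal_I] unfolding A_def \<pi>_def[abs_def] .

lemma pi_simps:
  "\<pi> (f + g) = \<pi> f \<oplus>\<^bsub>A\<^esub> \<pi> g" "\<pi> (f * g) = \<pi> f \<otimes>\<^bsub>A\<^esub> \<pi> g" "\<pi> 1 = \<one>\<^bsub>A\<^esub>" "\<pi> f \<in> carrier A"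
proof -
  interpret h: ring_hom_ring ps3_ring A \<pi> by (rule pi_hom)
  show "\<pi> (f + g) = \<pi> f \<oplus>\<^bsub>A\<^esub> \<pi> g" "\<pi> (f * g) = \<pi> f \<otimes>\<^bsub>A\<^esub> \<pi> g" "\<pi> 1 = \<one>\<^bsub>A\<^esub>" "\<pi> f \<in> carrier A"
    using h.hom_add[of f g] h.hom_mult[of f g] h.hom_one h.hom_closed[of f] by (simp_all add: ps3_ring_simps)
qed

lemma carrier_A: "carrier A = range \<pi>"
  unfolding A_def FactRing_def A_RCOSETS_def' \<pi>_def by (auto simp: ps3_ring_simps)

lemma pi_eq_iff: "\<pi> f = \<pi> g \<longleftrightarrow> f - g \<in> I"
  using ring.quotient_eq_iff_same_a_r_cos[OF cring.axioms(1)[OF cring_ps3] ideal_I, of f g]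
  by (simp add: ps3_ring_simps ps3_ring_minus \<pi>_def)

lemma pi_minus: "\<pi> (f - g) = \<pi> f \<ominus>\<^bsub>A\<^esub> \<pi> g"
proof -
  interpret h: ring_hom_ring ps3_ring A \<pi> by (rule pi_hom)
  have "\<pi> (- g) = \<ominus>\<^bsub>A\<^esub> \<pi> g" using h.hom_a_inv[of g] by (simp add: ps3_ring_simps ps3_ring_minus)
  then show ?thesis using pi_simps(1)[of f "- g"] by (simp add: a_minus_def)
qed

lemma mA_eq: "mA = \<pi> ` max_power 1"
  unfolding mA_def ps3_max_ideal_eq \<pi>_def ..

lemma ideal_pow_eq: "ideal_pow A mA n = \<pi> ` max_power n"
proof (induction n)
  case 0
  have "max_power 0 = (UNIV :: 'k ps3 set)" using max_power_0 by blast
  then show ?case by (simp add: ideals_set_def carrier_A)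
next
  case (Suc n)
  have "ideal_pow A mA (Suc n) = ideal_prod A (\<pi> ` max_power n) (\<pi> ` max_power 1)"
    using Suc by (simp add: ideals_set_def mA_eq)
  also have "\<dots> = \<pi> ` max_power (Suc n)"
  proof
    show "ideal_prod A (\<pi> ` max_power n) (\<pi> ` max_power 1) \<subseteq> \<pi> ` max_power (Suc n)"
    proof
      fix u assume "u \<in> ideal_prod A (\<pi> ` max_power n) (\<pi> ` max_power 1)"
      then show "u \<in> \<pi> ` max_power (Suc n)"
      proof induction
        case (prod i j)
        then obtain f g where fg: "f \<in> max_power n" "g \<in> max_power 1" "i = \<pi> f" "j = \<pi> g" by blast
        then have "f * g \<in> max_power (Suc n)" using max_power_mult[of f n g 1] by simp
        then show ?case unfolding fg pi_simps(2)[symmetric] by blast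
      next
        case (sum s t)
        then obtain f g where fg: "f \<in> max_power (Suc n)" "g \<in> max_power (Suc n)" "s = \<pi> f" "t = \<pi> g" by blast
        then have "f + g \<in> max_power (Suc n)" using max_power_add by blast
        then show ?case unfolding fg pi_simps(1)[symmetric] by blast
      qed
    qed
    show "\<pi> ` max_power (Suc n) \<subseteq> ideal_prod A (\<pi> ` max_power n) (\<pi> ` max_power 1)"
    proof
      fix u assume "u \<in> \<pi> ` max_power (Suc n)"
      then obtain f where f: "f \<in> max_power (Suc n)" "u = \<pi> f" by blast
      then obtain a b c where abc: "a \<in> max_power n" "b \<in> max_power n" "c \<in> max_power n"
        "f = var_x * a + var_y * b + var_z * c" using max_power_Suc_decompose by blast
      have "\<pi> f = \<pi> a \<otimes>\<^bsub>A\<^esub> \<pi> var_x \<oplus>\<^bsub>A\<^esub> \<pi> b \<otimes>\<^bsub>A\<^esub> \<pi> var_y \<oplus>\<^bsub>A\<^esub> \<pi> c \<otimes>\<^bsub>A\<^esub> \<pi> var_z"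
        unfolding abc(4) pi_simps(1,2)[symmetric] by (simp add: mult.commute)
      then show "u \<in> ideal_prod A (\<pi> ` max_power n) (\<pi> ` max_power 1)"
        unfolding f(2) using abc var_max_power by (auto intro!: ideal_prod.intros)
    qed
  qed
  finally show ?case .
qed

lemma ideal_ideal_pow: "ideal (ideal_pow A mA n) A"
proof -
  interpret h: ring_hom_ring ps3_ring A \<pi> by (rule pi_hom)
  interpret R: cring "ps3_ring :: 'k ps3 ring" by (rule cring_ps3)
  have M: "ideal (max_power n :: 'k ps3 set) ps3_ring"
    by (rule ps3_idealI) (auto intro: max_power_zero max_power_add max_power_mult_left)
  show ?thesis
    unfolding ideal_pow_eq
  proof (rule idealI[OF h.S.ring_axioms])
    show "subgroup (\<pi> ` max_power n) (add_monoid A)"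
      by (rule h.img_is_add_subgroup[OF additive_subgroup.a_subgroup[OF ideal.axioms(1)[OF M]]])
    fix a x assume "a \<in> \<pi> ` max_power n" "x \<in> carrier A"
    then obtain f g where fg: "f \<in> max_power n" "a = \<pi> f" "x = \<pi> g" unfolding carrier_A by blast
    show "x \<otimes>\<^bsub>A\<^esub> a \<in> \<pi> ` max_power n" "a \<otimes>\<^bsub>A\<^esub> x \<in> \<pi> ` max_power n"
      unfolding fg(2,3) pi_simps(2)[symmetric]
      by (intro imageI max_power_mult_left max_power_mult_right fg(1))+
  qed
qed

definition \<gamma> :: "nat \<Rightarrow> 'k ps3 \<Rightarrow> 'k ps3 set set" where
  "\<gamma> n f = ideal_pow A mA (Suc n) +>\<^bsub>A\<^esub> \<pi> f"

definition Q :: "nat \<Rightarrow> 'k ps3 set set ring" where "Q n = A Quot ideal_pow A mA (Suc n)"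

lemma cring_Q: "cring (Q n)"
  unfolding Q_def by (rule ideal.quotient_is_cring[OF ideal_ideal_pow cring_A])

lemma gamma_hom: "ring_hom_ring ps3_ring (Q n) (\<gamma> n)"
proof -
  interpret h: ring_hom_ring ps3_ring A \<pi> by (rule pi_hom)
  define N where "N = ideal_pow A mA (Suc n)"
  interpret q: ring_hom_ring A "Q n" "\<lambda>a. N +>\<^bsub>A\<^esub> a"
    using ideal.rcos_ring_hom_ring[OF ideal_ideal_pow] unfolding Q_def N_def .
  show ?thesis
    unfolding \<gamma>_def[abs_def] N_def[symmetric]
    by (rule ring_hom_ringI[OF h.R.ring_axioms q.S.ring_axioms])
      (simp_all add: q.hom_add q.hom_mult)
qed

lemma gamma_simps:
  "\<gamma> n (f + g) = \<gamma> n f \<oplus>\<^bsub>Q n\<^esub> \<gamma> n g" "\<gamma> n (f * g) = \<gamma> n f \<otimes>\<^bsub>Q n\<^esub> \<gamma> n g"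
  "\<gamma> n 1 = \<one>\<^bsub>Q n\<^esub>" "\<gamma> n 0 = \<zero>\<^bsub>Q n\<^esub>" "\<gamma> n f \<in> carrier (Q n)"
proof -
  interpret h: ring_hom_ring ps3_ring "Q n" "\<gamma> n" by (rule gamma_hom)
  show "\<gamma> n (f + g) = \<gamma> n f \<oplus>\<^bsub>Q n\<^esub> \<gamma> n g" "\<gamma> n (f * g) = \<gamma> n f \<otimes>\<^bsub>Q n\<^esub> \<gamma> n g"
    "\<gamma> n 1 = \<one>\<^bsub>Q n\<^esub>" "\<gamma> n 0 = \<zero>\<^bsub>Q n\<^esub>" "\<gamma> n f \<in> carrier (Q n)"
    using h.hom_add[of f g] h.hom_mult[of f g] h.hom_one h.hom_zero h.hom_closed[of f]
    by (simp_all add: ps3_ring_simps)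
qed

lemma gamma_eq_iff: "\<gamma> n f = \<gamma> n g \<longleftrightarrow> f - g \<in> J (Suc n)"
proof -
  have "\<gamma> n f = \<gamma> n g \<longleftrightarrow> \<pi> (f - g) \<in> \<pi> ` max_power (Suc n)"
    using ring.quotient_eq_iff_same_a_r_cos[OF cring.axioms(1)[OF cring_A] ideal_ideal_pow[of "Suc n"], of "\<pi> f" "\<pi> g"]
    unfolding \<gamma>_def pi_minus ideal_pow_eq[of "Suc n"] by (simp add: pi_simps)
  also have "\<dots> \<longleftrightarrow> (\<exists>u\<in>max_power (Suc n). f - g - u \<in> I)" by (auto simp: pi_eq_iff)
  also have "\<dots> \<longleftrightarrow> f - g \<in> J (Suc n)"
    unfolding J_iff
  proof
    assume "\<exists>u\<in>max_power (Suc n). f - g - u \<in> I"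
    then obtain u where "u \<in> max_power (Suc n)" "f - g - u \<in> I" by blast
    then show "\<exists>i\<in>I. f - g - i \<in> max_power (Suc n)" by (intro bexI[of _ "f - g - u"]) auto
  next
    assume "\<exists>i\<in>I. f - g - i \<in> max_power (Suc n)"
    then obtain i where "i \<in> I" "f - g - i \<in> max_power (Suc n)" by blast
    then show "\<exists>u\<in>max_power (Suc n). f - g - u \<in> I" by (intro bexI[of _ "f - g - i"]) auto
  qed
  finally show ?thesis .
qed

lemma gamma_eq_0_iff: "\<gamma> n f = \<gamma> n 0 \<longleftrightarrow> f \<in> J (Suc n)"
  using gamma_eq_iff[of n f 0] by simp

lemma gamma_0: "\<gamma> n 0 = ideal_pow A mA (Suc n)"
  unfolding gamma_simps(4) by (simp add: Q_def FactRing_def)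

lemma graded_piece_eq: "graded_piece A mA n = \<gamma> n ` max_power n"
  unfolding graded_piece_def \<gamma>_def ideal_pow_eq[of n] image_image ..

lemma gamma_J: "\<gamma> n ` J n = \<gamma> n ` max_power n"
proof
  show "\<gamma> n ` J n \<subseteq> \<gamma> n ` max_power n"
  proof
    fix u assume "u \<in> \<gamma> n ` J n"
    then obtain f where f: "f \<in> J n" "u = \<gamma> n f" by blast
    then obtain i where "i \<in> I" "f - i \<in> max_power n" unfolding J_iff by blast
    moreover from this have "\<gamma> n f = \<gamma> n (f - i)" unfolding gamma_eq_iff using I_J by simp blast
    ultimately show "u \<in> \<gamma> n ` max_power n" using f(2) by blast
  qed
qed (use max_power_J in blast)

lemma one_notin_J: "1 \<notin> J (Suc n)"
proof
  assume "1 \<in> J (Suc n)"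
  then have "(1 :: 'k ps3) \<in> max_power 1" using J_mono[of 1 "Suc n"] J_1 by auto
  then have "ps3_coeff (1 :: 'k ps3) 0 0 0 = 0" unfolding max_power_iff by simp
  then show False by (simp add: ps3_coeff_def)
qed

lemma subfield_const: "subfield (range ps3_const) (ps3_ring :: 'k ps3 ring)"
proof -
  interpret R: cring "ps3_ring :: 'k ps3 ring" by (rule cring_ps3)
  let ?c = "ps3_const :: 'k \<Rightarrow> 'k ps3"
  have inj: "?c a = ?c b \<longleftrightarrow> a = b" for a b by (simp add: ps3_const_def)
  have "ring_hom_ring (ring_of_type_algebra :: 'k ring) ps3_ring ?c"
    by (rule ring_hom_ringI[OF ring_from_type_algebra R.ring_axioms])
      (simp_all add: ring_of_type_algebra_def ps3_const_arith)
  then interpret c: ring_hom_ring "ring_of_type_algebra :: 'k ring" ps3_ring ?c .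
  have "subfield (carrier (ring_of_type_algebra :: 'k ring)) ring_of_type_algebra"
    by (rule field.carrier_is_subfield[OF field_from_type_algebra])
  from c.img_is_subfield(2)[OF this] show ?thesis by (simp add: ring_of_type_algebra_def)
qed

lemma subfield_gamma: "subfield (\<gamma> n ` range ps3_const) (Q n)"
proof -
  interpret h: ring_hom_ring ps3_ring "Q n" "\<gamma> n" by (rule gamma_hom)
  have "\<one>\<^bsub>Q n\<^esub> \<noteq> \<zero>\<^bsub>Q n\<^esub>"
    unfolding gamma_simps(3,4)[symmetric] gamma_eq_0_iff by (rule one_notin_J)
  then show ?thesis by (rule h.img_is_subfield(2)[OF subfield_const])
qed

text \<open>\<open>reldim\<close> and \<open>ring.dimension\<close> are both built by adjoining one
  line at a time, so the chain is transported through \<open>\<gamma> n\<close> step by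
  step.\<close>

lemma dimension_reldim:
  assumes "ps3.reldim (J (Suc n)) d W"
  shows "ring.dimension (Q n) d (\<gamma> n ` range ps3_const) (\<gamma> n ` W)"
proof -
  interpret Q: cring "Q n" by (rule cring_Q)
  show ?thesis using assms
  proof induction
    case reldim_0
    have "\<gamma> n ` J (Suc n) = {\<zero>\<^bsub>Q n\<^esub>}"
      using gamma_eq_0_iff[of n] ps3.subspace_0[OF subspace_J[of "Suc n"]] unfolding gamma_simps(4) by force
    then show ?case using Q.zero_dim by simp
  next
    case (reldim_Suc d W v)
    have W: "ps3.subspace W" "J (Suc n) \<subseteq> W" using ps3.reldim_subspace[OF reldim_Suc.hyps(1) subspace_J] .
    have "\<gamma> n v \<notin> \<gamma> n ` W"
    proof
      assume "\<gamma> n v \<in> \<gamma> n ` W"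
      then obtain w where w: "w \<in> W" "v - w \<in> J (Suc n)" unfolding image_iff gamma_eq_iff by blast
      then have "(v - w) + w \<in> W" using W ps3.subspace_add by blast
      then show False using reldim_Suc.hyps(2) by simp
    qed
    from Q.Suc_dim[OF gamma_simps(5) this reldim_Suc.IH]
    have "Q.dimension (Suc d) (\<gamma> n ` range ps3_const) (Q.line_extension (\<gamma> n ` range ps3_const) (\<gamma> n v) (\<gamma> n ` W))" .
    moreover have "Q.line_extension (\<gamma> n ` range ps3_const) (\<gamma> n v) (\<gamma> n ` W) = \<gamma> n ` (W + range (\<lambda>c. ps3_const c * v))"
    proof (rule Set.set_eqI)
      fix u
      have "u \<in> Q.line_extension (\<gamma> n ` range ps3_const) (\<gamma> n v) (\<gamma> n ` W) \<longleftrightarrow>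
        (\<exists>c. \<exists>w\<in>W. u = \<gamma> n (w + ps3_const c * v))"
        unfolding Q.line_extension_mem_iff by (auto simp: gamma_simps(1,2) Q.a_comm gamma_simps(5))
      also have "\<dots> \<longleftrightarrow> u \<in> \<gamma> n ` (W + range (\<lambda>c. ps3_const c * v))"
        unfolding image_iff Bex_def ps3.in_line by blast
      finally show "u \<in> Q.line_extension (\<gamma> n ` range ps3_const) (\<gamma> n v) (\<gamma> n ` W) \<longleftrightarrow>
        u \<in> \<gamma> n ` (W + range (\<lambda>c. ps3_const c * v))" .
    qed
    ultimately show ?case by simp
  qed
qed

theorem quot_HF_eq_hf: "quot_HF I = hf"
proof
  fix n
  interpret Q: cring "Q n" by (rule cring_Q)
  have "quot_HF I n = Q.dim (\<gamma> n ` range ps3_const) (\<gamma> n ` J n)"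
    unfolding quot_HF_def hilbert_function_def A_def[symmetric] mA_def[symmetric] graded_piece_eq gamma_J[symmetric]
      Q_def[symmetric] by (simp add: \<gamma>_def \<pi>_def image_image)
  also have "\<dots> = hf n"
    using Q.dimI[OF subfield_gamma dimension_reldim[OF reldim_hf]] by (simp add: over_def)
  finally show "quot_HF I n = hf n" .
qed

section \<open>The associated graded ring as a quotient of a Rees algebra\<close>

text \<open>The Rees algebra of M, as polynomials in an auxiliary variable T. \<open>\<Phi>\<close>
  maps it onto the associated graded ring, so the ring laws and all computations with families of
  cosets reduce to polynomial arithmetic.\<close>

definition rees :: "'k ps3 poly set" where "rees = {p. \<forall>t. coeff p t \<in> max_power t}"

definition \<Phi> :: "'k ps3 poly \<Rightarrow> nat \<Rightarrow> 'k ps3 set set" where "\<Phi> p = (\<lambda>t. \<gamma> t (coeff p t))"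

definition G :: "(nat \<Rightarrow> 'k ps3 set set) ring" where "G = assoc_graded_ring A mA"

lemma Phi_eq_iff: "\<Phi> p = \<Phi> q \<longleftrightarrow> (\<forall>t. coeff p t - coeff q t \<in> J (Suc t))"
  unfolding \<Phi>_def fun_eq_iff gamma_eq_iff ..

lemma Phi_eq_0_iff: "\<Phi> p = \<Phi> 0 \<longleftrightarrow> (\<forall>t. coeff p t \<in> J (Suc t))"
  unfolding Phi_eq_iff by simp

lemma rees_closed:
  "0 \<in> rees" "1 \<in> rees" "p \<in> rees \<Longrightarrow> q \<in> rees \<Longrightarrow> p + q \<in> rees" "p \<in> rees \<Longrightarrow> - p \<in> rees"
  "p \<in> rees \<Longrightarrow> q \<in> rees \<Longrightarrow> p * q \<in> rees" "a \<in> max_power t \<Longrightarrow> monom a t \<in> rees"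
proof -
  show "p * q \<in> rees" if "p \<in> rees" "q \<in> rees"
  proof -
    have "coeff (p * q) t \<in> max_power t" for t
      unfolding coeff_mult
    proof (rule filtration_sum[OF filtration_max_power])
      fix i assume "i \<in> {..t}"
      then show "coeff p i * coeff q (t - i) \<in> max_power t"
        using that by (intro max_power_mult_le[of _ i _ "t - i"]) (auto simp: rees_def)
    qed
    then show ?thesis by (simp add: rees_def)
  qed
  show "1 \<in> rees" by (auto simp: rees_def max_power_0 max_power_zero)
qed (auto simp: rees_def max_power_zero max_power_add max_power_uminus)

lemma carrier_G: "carrier G = \<Phi> ` rees"
proof
  show "carrier G \<subseteq> \<Phi> ` rees"
  proof
    fix u assume "u \<in> carrier G"
    then have u: "\<And>t. u t \<in> \<gamma> t ` max_power t" "finite {t. u t \<noteq> \<gamma> t 0}"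
      by (auto simp: G_def assoc_graded_ring_def graded_piece_eq gamma_0)
    \<comment> \<open>A zero class gets the representative 0, so that only finitely many
      coefficients are nonzero and \<open>Abs_poly\<close> applies.\<close>
    have "\<exists>a\<in>max_power t. u t = \<gamma> t a \<and> (u t = \<gamma> t 0 \<longrightarrow> a = 0)" for t
      using u(1)[of t] max_power_zero[of t] by (cases "u t = \<gamma> t 0") auto
    then obtain a where a: "\<And>t. a t \<in> max_power t" "\<And>t. u t = \<gamma> t (a t)" "\<And>t. u t = \<gamma> t 0 \<Longrightarrow> a t = 0"
      by metis
    have "finite {t. a t \<noteq> 0}" by (rule finite_subset[OF _ u(2)]) (use a(3) in auto)
    then have c: "coeff (Abs_poly a) t = a t" for t
      by (subst Abs_poly_inverse) (simp_all add: MOST_iff_cofinite)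
    have "u = \<Phi> (Abs_poly a)" unfolding \<Phi>_def c using a(2) by auto
    moreover have "Abs_poly a \<in> rees" using a(1) by (simp add: rees_def c)
    ultimately show "u \<in> \<Phi> ` rees" by blast
  qed
  show "\<Phi> ` rees \<subseteq> carrier G"
  proof
    fix u assume "u \<in> \<Phi> ` rees"
    then obtain p where p: "p \<in> rees" "u = \<Phi> p" by blast
    have "{t. u t \<noteq> \<gamma> t 0} \<subseteq> {..degree p}"
      unfolding p(2) \<Phi>_def using coeff_eq_0[of p] not_le by auto
    then have "finite {t. u t \<noteq> \<gamma> t 0}" by (rule finite_subset) simp
    moreover have "u t \<in> \<gamma> t ` max_power t" for t using p by (auto simp: \<Phi>_def rees_def)
    ultimately show "u \<in> carrier G"
      by (auto simp: G_def assoc_graded_ring_def graded_piece_eq gamma_0)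
  qed
qed

text \<open>The factors are cosets of two different ideals. Changing their representatives alters
  the product by \<open>(c - a) d + a (d - b')\<close>, which lies in m^(i+j+1); so the union
  defining \<open>rcoset_mult\<close> is a union of one and the same coset.\<close>

lemma rcoset_mult_gamma:
  assumes "a \<in> max_power i" "b' \<in> max_power j"
  shows "rcoset_mult A (ideal_pow A mA (Suc (i + j))) (\<gamma> i a) (\<gamma> j b') = \<gamma> (i + j) (a * b')"
proof -
  have mem: "u \<in> \<gamma> n f \<longleftrightarrow> (\<exists>g. u = \<pi> g \<and> g - f \<in> J (Suc n))" for u n f
  proof -
    have "u \<in> \<gamma> n f \<longleftrightarrow> (\<exists>h\<in>max_power (Suc n). u = \<pi> (h + f))"
      unfolding \<gamma>_def ideal_pow_eq a_r_coset_def' by (auto simp: pi_simps)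
    also have "\<dots> \<longleftrightarrow> (\<exists>g. u = \<pi> g \<and> g - f \<in> J (Suc n))"
    proof
      assume "\<exists>h\<in>max_power (Suc n). u = \<pi> (h + f)"
      then obtain h where "h \<in> max_power (Suc n)" "u = \<pi> (h + f)" by blast
      then show "\<exists>g. u = \<pi> g \<and> g - f \<in> J (Suc n)"
        using max_power_J by (intro exI[of _ "h + f"]) auto
    next
      assume "\<exists>g. u = \<pi> g \<and> g - f \<in> J (Suc n)"
      then obtain g i where "u = \<pi> g" "i \<in> I" "g - f - i \<in> max_power (Suc n)" unfolding J_iff by blast
      then show "\<exists>h\<in>max_power (Suc n). u = \<pi> (h + f)"
        by (intro bexI[of _ "g - f - i"]) (auto simp: pi_eq_iff)
    qed
    finally show ?thesis .
  qed
  have eq: "ideal_pow A mA (Suc (i + j)) +>\<^bsub>A\<^esub> (\<pi> c \<otimes>\<^bsub>A\<^esub> \<pi> d) = \<gamma> (i + j) (a * b')"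
    if "c - a \<in> J (Suc i)" "d - b' \<in> J (Suc j)" for c d
  proof -
    have "d - b' \<in> J j" using that(2) J_mono[of j "Suc j"] by auto
    then have "(d - b') + b' \<in> J j" using assms(2) max_power_J J_add by blast
    then have d: "d \<in> J j" by simp
    \<comment> \<open>\<open>J_mult\<close> wants one factor in a power of M itself, whereas
      \<open>d\<close> lies there only modulo \<open>I\<close>; \<open>e\<close> is the
      correction.\<close>
    obtain e where e: "e \<in> I" "d - e \<in> max_power j" using d unfolding J_iff by blast
    have 1: "(d - e) * (c - a) \<in> J (Suc (i + j))" using J_mult[OF e(2) that(1)] by (simp add: add.commute)
    have 2: "e * (c - a) \<in> J (Suc (i + j))" using I_mult[OF e(1), of "c - a"] I_J by (auto simp: mult.commute)
    have 3: "a * (d - b') \<in> J (Suc (i + j))" using J_mult[OF assms(1) that(2)] by simp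
    have "c * d - a * b' = ((d - e) * (c - a) + e * (c - a)) + a * (d - b')" by (simp add: algebra_simps)
    also have "\<dots> \<in> J (Suc (i + j))" by (intro J_add 1 2 3)
    finally have "\<gamma> (i + j) (c * d) = \<gamma> (i + j) (a * b')" unfolding gamma_eq_iff .
    then show ?thesis unfolding \<gamma>_def pi_simps(2) .
  qed
  have z: "0 \<in> J n" for n using ps3.subspace_0[OF subspace_J] .
  have ne: "\<pi> a \<in> \<gamma> i a" "\<pi> b' \<in> \<gamma> j b'" unfolding mem using z by (metis cancel_comm_monoid_add_class.diff_cancel)+
  have "rcoset_mult A (ideal_pow A mA (Suc (i + j))) (\<gamma> i a) (\<gamma> j b') = (\<Union>u\<in>\<gamma> i a. \<Union>v\<in>\<gamma> j b'. \<gamma> (i + j) (a * b'))"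
    unfolding rcoset_mult_def using eq by (intro SUP_cong refl) (auto simp: mem)
  also have "\<dots> = \<gamma> (i + j) (a * b')" using ne by auto
  finally show ?thesis .
qed

lemma finsum_gamma: "finsum (Q n) (\<lambda>i. \<gamma> n (f i)) {..k} = \<gamma> n (\<Sum>i\<le>k. f i)" for k :: nat
proof -
  interpret Q: cring "Q n" by (rule cring_Q)
  show ?thesis
    by (induction k) (simp_all add: Q.finsum_Suc gamma_simps(5) gamma_simps(1) Pi_def Q.a_comm)
qed

lemma G_simps:
  assumes "p \<in> rees" "q \<in> rees"
  shows "\<Phi> p \<otimes>\<^bsub>G\<^esub> \<Phi> q = \<Phi> (p * q)" "\<Phi> p \<oplus>\<^bsub>G\<^esub> \<Phi> q = \<Phi> (p + q)"
proof -
  show "\<Phi> p \<oplus>\<^bsub>G\<^esub> \<Phi> q = \<Phi> (p + q)"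
  proof
    fix t
    have "\<gamma> t (coeff p t) <+>\<^bsub>A\<^esub> \<gamma> t (coeff q t) = \<gamma> t (coeff p t) \<oplus>\<^bsub>Q t\<^esub> \<gamma> t (coeff q t)"
      by (simp add: Q_def FactRing_def)
    then show "(\<Phi> p \<oplus>\<^bsub>G\<^esub> \<Phi> q) t = \<Phi> (p + q) t"
      by (simp add: G_def assoc_graded_ring_def \<Phi>_def gamma_simps(1))
  qed
  show "\<Phi> p \<otimes>\<^bsub>G\<^esub> \<Phi> q = \<Phi> (p * q)"
  proof
    fix n
    interpret Q: cring "Q n" by (rule cring_Q)
    have "(\<Phi> p \<otimes>\<^bsub>G\<^esub> \<Phi> q) n = finsum (Q n) (\<lambda>i. rcoset_mult A (ideal_pow A mA (Suc n)) (\<gamma> i (coeff p i)) (\<gamma> (n - i) (coeff q (n - i)))) {..n}"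
      by (simp add: G_def assoc_graded_ring_def \<Phi>_def Q_def)
    also have "\<dots> = finsum (Q n) (\<lambda>i. \<gamma> n (coeff p i * coeff q (n - i))) {..n}"
    proof (rule Q.finsum_cong')
      fix i assume "i \<in> {..n}"
      then have "i + (n - i) = n" by simp
      with rcoset_mult_gamma[of "coeff p i" i "coeff q (n - i)" "n - i"] assms
      show "rcoset_mult A (ideal_pow A mA (Suc n)) (\<gamma> i (coeff p i)) (\<gamma> (n - i) (coeff q (n - i))) =
        \<gamma> n (coeff p i * coeff q (n - i))" by (simp add: rees_def)
    qed (auto simp: gamma_simps(5))
    also have "\<dots> = \<Phi> (p * q) n" unfolding finsum_gamma \<Phi>_def coeff_mult ..
    finally show "(\<Phi> p \<otimes>\<^bsub>G\<^esub> \<Phi> q) n = \<Phi> (p * q) n" .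
  qed
qed

lemma G_zero_one: "\<zero>\<^bsub>G\<^esub> = \<Phi> 0" "\<one>\<^bsub>G\<^esub> = \<Phi> 1"
proof -
  show "\<zero>\<^bsub>G\<^esub> = \<Phi> 0" by (simp add: G_def assoc_graded_ring_def \<Phi>_def gamma_0)
  have "\<gamma> 0 1 = ideal_pow A mA 1 +>\<^bsub>A\<^esub> \<one>\<^bsub>A\<^esub>" by (simp add: \<gamma>_def pi_simps(3))
  then show "\<one>\<^bsub>G\<^esub> = \<Phi> 1" by (auto simp: G_def assoc_graded_ring_def \<Phi>_def gamma_0 fun_eq_iff)
qed

lemma cring_G: "cring G"
proof (rule cringI)
  show "abelian_group G"
  proof (rule abelian_groupI)
    show "\<exists>y\<in>carrier G. y \<oplus>\<^bsub>G\<^esub> x = \<zero>\<^bsub>G\<^esub>" if "x \<in> carrier G" for x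
    proof -
      obtain p where p: "p \<in> rees" "x = \<Phi> p" using \<open>x \<in> carrier G\<close> carrier_G by blast
      have "\<Phi> (- p) \<oplus>\<^bsub>G\<^esub> x = \<zero>\<^bsub>G\<^esub>" unfolding p(2) G_simps[OF rees_closed(4)[OF p(1)] p(1)] G_zero_one by simp
      then show ?thesis unfolding carrier_G using rees_closed(4)[OF p(1)] by blast
    qed
  qed (auto simp: carrier_G G_simps G_zero_one rees_closed add_ac)
  show "Group.comm_monoid G"
    by (rule comm_monoidI) (auto simp: carrier_G G_simps G_zero_one rees_closed mult_ac)
  show "(x \<oplus>\<^bsub>G\<^esub> y) \<otimes>\<^bsub>G\<^esub> z = x \<otimes>\<^bsub>G\<^esub> z \<oplus>\<^bsub>G\<^esub> y \<otimes>\<^bsub>G\<^esub> z"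
    if "x \<in> carrier G" "y \<in> carrier G" "z \<in> carrier G" for x y z
    using that by (auto simp: carrier_G G_simps rees_closed distrib_right)
qed

end

section \<open>Cohen--Macaulayness of the associated graded ring\<close>

context transversal
begin

text \<open>Substitutes l T for the variable. Followed by \<open>\<Phi>\<close> it makes the graded
  ring an algebra over K[t], with t acting as the class of l in degree 1.\<close>

definition tpoly :: "'k poly \<Rightarrow> 'k ps3 poly" where
  "tpoly p = (\<Sum>i\<le>degree p. monom (ps3_const (coeff p i) * l ^ i) i)"

lemma coeff_tpoly: "coeff (tpoly p) t = ps3_const (coeff p t) * l ^ t"
proof -
  have "coeff (tpoly p) t = (if t \<le> degree p then ps3_const (coeff p t) * l ^ t else 0)"
    unfolding tpoly_def coeff_sum by (simp add: sum.delta')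
  then show ?thesis by (auto simp: coeff_eq_0 ps3_const_arith)
qed

lemma l_power_max_power: "l ^ n \<in> max_power n"
proof (induction n)
  case (Suc n)
  then show ?case using max_power_mult[OF l_max_power, of "l ^ n" n] by simp
qed (simp add: max_power_0)

lemma tpoly_rees: "tpoly p \<in> rees"
  by (simp add: rees_def coeff_tpoly max_power_mult_left[OF l_power_max_power])

lemma ps3_const_sum: "ps3_const (sum f S) = (\<Sum>a\<in>S. ps3_const (f a))"
  by (induction S rule: infinite_finite_induct) (auto simp: ps3_const_arith)

lemma tpoly_simps: "tpoly (p + q) = tpoly p + tpoly q" "tpoly (p * q) = tpoly p * tpoly q" "tpoly 1 = 1"
proof -
  show "tpoly (p * q) = tpoly p * tpoly q"
    unfolding poly_eq_iff
  proof
    fix n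
    have "ps3_const (coeff p i * coeff q (n - i)) * l ^ n =
      (ps3_const (coeff p i) * l ^ i) * (ps3_const (coeff q (n - i)) * l ^ (n - i))" if "i \<in> {..n}" for i
    proof -
      have "l ^ n = l ^ i * l ^ (n - i)" using that by (simp add: power_add[symmetric])
      then show ?thesis by (simp add: ps3_const_arith mult_ac)
    qed
    then show "coeff (tpoly (p * q)) n = coeff (tpoly p * tpoly q) n"
      by (simp add: coeff_tpoly coeff_mult ps3_const_sum sum_distrib_right)
  qed
qed (auto simp: poly_eq_iff coeff_tpoly ps3_const_arith distrib_right)

lemma palgebra_G: "palgebra G (\<lambda>p. \<Phi> (tpoly p))"
proof -
  interpret G: cring G by (rule cring_G)
  show ?thesis
    by unfold_locales
      (auto simp: carrier_G tpoly_rees G_simps tpoly_simps G_zero_one)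
qed

lemma tpoly_mult_monom:
  assumes "c \<in> max_power t"
  shows "\<Phi> (tpoly [:k:]) \<otimes>\<^bsub>G\<^esub> \<Phi> (monom c t) = \<Phi> (monom (ps3_const k * c) t)"
    and "\<Phi> (tpoly [:0, 1:]) \<otimes>\<^bsub>G\<^esub> \<Phi> (monom c t) = \<Phi> (monom (l * c) (Suc t))"
proof -
  have t: "tpoly [:k:] = monom (ps3_const k) 0" "tpoly [:0, 1:] = monom l 1"
    by (auto simp: poly_eq_iff coeff_tpoly coeff_pCons ps3_const_arith split: nat.splits)
  show "\<Phi> (tpoly [:k:]) \<otimes>\<^bsub>G\<^esub> \<Phi> (monom c t) = \<Phi> (monom (ps3_const k * c) t)"
    "\<Phi> (tpoly [:0, 1:]) \<otimes>\<^bsub>G\<^esub> \<Phi> (monom c t) = \<Phi> (monom (l * c) (Suc t))"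
    using G_simps(1)[OF tpoly_rees[of "[:k:]"] rees_closed(6)[OF assms]]
      G_simps(1)[OF tpoly_rees[of "[:0, 1:]"] rees_closed(6)[OF assms]]
    by (simp_all add: t mult_monom)
qed

text \<open>Beyond degree \<open>N\<close> every class is l times a class one degree lower, so
  representatives of spanning sets in the degrees up to \<open>N\<close> generate
  everything.\<close>

lemma finite_over_tpoly:
  "\<exists>gs. set gs \<subseteq> carrier G \<and> pspan G (\<lambda>p. \<Phi> (tpoly p)) {\<zero>\<^bsub>G\<^esub>} gs = carrier G"
proof -
  let ?e = "\<lambda>p. \<Phi> (tpoly p)"
  interpret G: palgebra G ?e by (rule palgebra_G)
  obtain N where N: "\<And>n. n \<ge> N \<Longrightarrow> L n = J (Suc n)" using L_eq_J_eventually by blast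
  have "\<forall>n. \<exists>B\<subseteq>max_power n. finite B \<and> (max_power n :: 'k ps3 set) \<subseteq> max_power (Suc n) + ps3.span B"
    using max_power_span by blast
  then obtain B where B: "\<And>n. B n \<subseteq> max_power n" "\<And>n. finite (B n)"
    "\<And>n. (max_power n :: 'k ps3 set) \<subseteq> max_power (Suc n) + ps3.span (B n)" by metis
  define S where "S = (\<Union>n\<le>N. (\<lambda>a. \<Phi> (monom a n)) ` B n)"
  have "finite S" unfolding S_def using B(2) by simp
  then obtain gs where gs: "set gs = S" using finite_list by blast
  have mG: "\<Phi> (monom a n) \<in> carrier G" if "a \<in> max_power n" for a n
    unfolding carrier_G using rees_closed(6)[OF that] by blast
  have gsG: "set gs \<subseteq> carrier G" unfolding gs S_def using mG B(1) by blast
  define W where "W = pspan G ?e {\<zero>\<^bsub>G\<^esub>} gs"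
  have W: "pmodule G ?e W" "set gs \<subseteq> W"
    using G.pspan_pmodule[OF G.ideal_pmodule[OF G.zeroideal] gsG] unfolding W_def by auto
  have Wadd: "\<Phi> p \<oplus>\<^bsub>G\<^esub> \<Phi> q \<in> W" if "\<Phi> p \<in> W" "\<Phi> q \<in> W" for p q
    using W(1) that unfolding pmodule_def by blast
  have We: "?e p \<otimes>\<^bsub>G\<^esub> u \<in> W" if "u \<in> W" for p u
    using W(1) that unfolding pmodule_def by blast
  have W0: "\<Phi> 0 \<in> W" using W(1) unfolding pmodule_def G_zero_one by blast
  have monom_eq: "\<Phi> (monom a n) = \<Phi> (monom c n)" if "a - c \<in> J (Suc n)" for a c n
    using that ps3.subspace_0[OF subspace_J] unfolding Phi_eq_iff by simp
  have low: "\<Phi> (monom a n) \<in> W" if n: "n \<le> N" and a: "a \<in> max_power n" for a n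
  proof -
    have "s \<in> max_power n \<and> \<Phi> (monom s n) \<in> W" if "s \<in> ps3.span (B n)" for s
      using that
    proof (induction rule: ps3.span_induct_alt)
      case base
      then show ?case using W0 by (simp add: max_power_zero)
    next
      case (step k x y)
      have x: "x \<in> max_power n" using step(1) B(1) by blast
      have "\<Phi> (monom x n) \<in> W" using W(2) gs step(1) n unfolding S_def by blast
      then have "\<Phi> (monom (ps3_const k * x) n) \<in> W"
        using We[of _ "[:k:]"] unfolding tpoly_mult_monom(1)[OF x, symmetric] by blast
      from Wadd[OF this conjunct2[OF step(2)]]
      have "\<Phi> (monom (ps3_const k * x) n + monom y n) \<in> W"
        using G_simps(2)[OF rees_closed(6)[OF max_power_mult_left[OF x]] rees_closed(6)[OF conjunct1[OF step(2)]]]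
        by simp
      then show ?case
        using x step(2) by (auto simp: add_monom intro!: max_power_add max_power_mult_left)
    qed
    moreover obtain m s where "m \<in> max_power (Suc n)" "s \<in> ps3.span (B n)" "a = m + s"
      using B(3)[of n] a by (auto simp: set_plus_def)
    moreover from this have "\<Phi> (monom a n) = \<Phi> (monom s n)" using max_power_J by (intro monom_eq) auto
    ultimately show ?thesis by simp
  qed
  have high: "\<Phi> (monom a (N + n)) \<in> W" if "a \<in> max_power (N + n)" for a n
    using that
  proof (induction n arbitrary: a)
    case 0
    then show ?case using low by simp
  next
    case (Suc n)
    have "a \<in> L (N + n)" using N[of "N + n"] Suc.prems max_power_J by auto
    then obtain c where c: "c \<in> J (N + n)" "a - l * c \<in> I" unfolding L_iff by blast
    then obtain i where i: "i \<in> I" "c - i \<in> max_power (N + n)" unfolding J_iff by blast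
    have "(a - l * c) + l * i \<in> I" using c(2) i(1) I_add I_mult by blast
    then have "a - l * (c - i) \<in> J (Suc (N + Suc n))" using I_J by (auto simp: algebra_simps)
    then have "\<Phi> (monom a (N + Suc n)) = \<Phi> (monom (l * (c - i)) (N + Suc n))" by (rule monom_eq)
    also have "\<dots> = ?e [:0, 1:] \<otimes>\<^bsub>G\<^esub> \<Phi> (monom (c - i) (N + n))"
      using tpoly_mult_monom(2)[OF i(2)] by simp
    also have "\<dots> \<in> W" by (rule We[OF Suc.IH[OF i(2)]])
    finally show ?case .
  qed
  have mono: "\<Phi> (monom a n) \<in> W" if "a \<in> max_power n" for a n
    using low[of n a] high[of a "n - N"] that by (cases "n \<le> N") auto
  have all: "\<Phi> p \<in> W" if "p \<in> rees" "\<And>i. n \<le> i \<Longrightarrow> coeff p i = 0" for n p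
    using that
  proof (induction n arbitrary: p)
    case 0
    then have "p = 0" by (simp add: poly_eq_iff)
    then show ?case using W0 by simp
  next
    case (Suc n)
    let ?m = "monom (coeff p n) n"
    have cn: "coeff p n \<in> max_power n" using Suc.prems(1) by (simp add: rees_def)
    have pm: "p - ?m \<in> rees"
      using rees_closed(3)[OF Suc.prems(1) rees_closed(4)[OF rees_closed(6)[OF cn]]] by simp
    have z: "coeff (p - ?m) i = 0" if "n \<le> i" for i
      using that Suc.prems(2)[of i] by (cases "i = n") auto
    have "\<Phi> (p - ?m) \<in> W" by (rule Suc.IH[OF pm z])
    from Wadd[OF this mono[OF cn]] show ?case
      using G_simps(2)[OF pm rees_closed(6)[OF cn]] by simp
  qed
  have "carrier G \<subseteq> W"
  proof
    fix u assume "u \<in> carrier G"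
    then obtain p where p: "p \<in> rees" "u = \<Phi> p" unfolding carrier_G by blast
    show "u \<in> W" unfolding p(2) by (rule all[OF p(1), of "Suc (degree p)"]) (simp add: coeff_eq_0)
  qed
  moreover have "W \<subseteq> carrier G" using W(1) by (simp add: pmodule_def)
  ultimately show ?thesis using gsG W_def by blast
qed

lemma inj_power:
  assumes "\<forall>n. inj_at n" "a \<in> J d" "l ^ m * a \<in> J (Suc (m + d))"
  shows "a \<in> J (Suc d)"
  using assms(3)
proof (induction m)
  case (Suc m)
  have "l ^ m * a \<in> J (m + d)" by (rule J_mult[OF l_power_max_power assms(2)])
  moreover have "l * (l ^ m * a) \<in> J (m + d + 2)" using Suc.prems by (simp add: mult_ac)
  ultimately have "l ^ m * a \<in> J (Suc (m + d))" using assms(1) unfolding inj_at_def by blast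
  then show ?case by (rule Suc.IH)
qed simp

lemma ps3_const_cancel:
  assumes "k \<noteq> 0" "ps3_const k * a \<in> J n"
  shows "a \<in> J n"
proof -
  have "ps3_const (1 / k) * (ps3_const k * a) \<in> J n" by (rule J_mult_left[OF assms(2)])
  moreover have "ps3_const (1 / k) * ps3_const k = 1"
    using assms(1) by (simp add: ps3_const_arith(3)[symmetric] ps3_const_arith(5))
  then have "ps3_const (1 / k) * (ps3_const k * a) = a" by (simp only: mult.assoc[symmetric]) simp
  ultimately show ?thesis by (simp only:)
qed

lemma cohen_macaulay_if_inj:
  assumes inj: "\<forall>n. inj_at n"
  shows "cohen_macaulay_ring G"
proof -
  let ?e = "\<lambda>p. \<Phi> (tpoly p)"
  interpret G: palgebra G ?e by (rule palgebra_G)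
  obtain gs where gs: "set gs \<subseteq> carrier G" "pspan G ?e {\<zero>\<^bsub>G\<^esub>} gs = carrier G"
    using finite_over_tpoly by blast
  have "finite_torsionfree_palgebra G ?e gs"
  proof
    show "\<one>\<^bsub>G\<^esub> \<noteq> \<zero>\<^bsub>G\<^esub>"
      unfolding G_zero_one Phi_eq_0_iff using one_notin_J[of 0] by (auto intro!: exI[of _ 0])
    fix u p assume "u \<in> carrier G" "?e p \<otimes>\<^bsub>G\<^esub> u = \<zero>\<^bsub>G\<^esub>"
    then obtain q where q: "q \<in> rees" "u = \<Phi> q" "\<Phi> (tpoly p * q) = \<Phi> 0"
      unfolding carrier_G G_zero_one using G_simps(1)[OF tpoly_rees] by force
    show "p = 0 \<or> u = \<zero>\<^bsub>G\<^esub>"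
    proof (rule disjCI)
      assume u: "u \<noteq> \<zero>\<^bsub>G\<^esub>"
      show "p = 0"
      proof (rule ccontr)
        assume "p \<noteq> 0"
        \<comment> \<open>The lowest term of \<open>p\<close> is used: in degree
          \<open>m + d\<close> the product is c l^m times coefficient \<open>d\<close> of
          \<open>q\<close>, with c the lowest coefficient of \<open>p\<close>, plus terms with
          earlier coefficients of \<open>q\<close>, which are zero classes by induction. Injectivity
          of l then kills coefficient \<open>d\<close>.\<close>
        define m where "m = (LEAST i. coeff p i \<noteq> 0)"
        have "\<exists>i. coeff p i \<noteq> 0" using \<open>p \<noteq> 0\<close> by (auto simp: poly_eq_iff)
        then have m: "coeff p m \<noteq> 0" unfolding m_def by (rule LeastI_ex)
        have m0: "coeff p i = 0" if "i < m" for i using that not_less_Least unfolding m_def by blast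
        have "coeff q d \<in> J (Suc d)" for d
        proof (induction d rule: less_induct)
          case (less d)
          let ?t = "\<lambda>i. ps3_const (coeff p i) * l ^ i * coeff q (m + d - i)"
          have sum: "(\<Sum>i\<le>m + d. ?t i) \<in> J (Suc (m + d))"
            using q(3) unfolding Phi_eq_0_iff coeff_mult coeff_tpoly by blast
          have "?t i \<in> J (Suc (m + d))" if i: "i \<le> m + d" "i \<noteq> m" for i
          proof (cases "i < m")
            case True
            then show ?thesis using m0 ps3.subspace_0[OF subspace_J] by (simp add: ps3_const_arith)
          next
            case False
            then have "coeff q (m + d - i) \<in> J (Suc (m + d - i))" using i by (intro less) auto
            from J_mult_left[OF J_mult[OF l_power_max_power this, of i]] i(1)
            show ?thesis by (simp add: mult.assoc)
          qed
          then have "(\<Sum>i\<in>{..m + d} - {m}. ?t i) \<in> J (Suc (m + d))"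
            by (intro ps3.subspace_sum[OF subspace_J]) auto
          from J_diff[OF sum this] have "?t m \<in> J (Suc (m + d))"
            by (simp add: sum.remove[of "{..m + d}" m])
          then have "l ^ m * coeff q d \<in> J (Suc (m + d))"
            using ps3_const_cancel[OF m] by (simp add: mult.assoc)
          moreover have "coeff q d \<in> J d" using q(1) max_power_J by (auto simp: rees_def)
          ultimately show ?case using inj_power[OF inj] by blast
        qed
        then have "\<Phi> q = \<Phi> 0" unfolding Phi_eq_0_iff by blast
        then show False using u q(2) G_zero_one by simp
      qed
    qed
  qed (rule gs)+
  then show ?thesis by (rule finite_torsionfree_palgebra.cohen_macaulay)
qed

section \<open>The irrelevant ideal: maximality, height and depth\<close>

definition irrelevant :: "(nat \<Rightarrow> 'k ps3 set set) set" where
  "irrelevant = \<Phi> ` {p \<in> rees. coeff p 0 \<in> max_power 1}"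

lemma max_power_1_iff: "f \<in> max_power 1 \<longleftrightarrow> ps3_coeff f 0 0 0 = 0"
  by (auto simp: max_power_iff)

text \<open>Elements of \<open>I\<close> have no constant term, so the condition on coefficient 0
  does not depend on the representative.\<close>

lemma Phi_irrelevant_iff:
  assumes "p \<in> rees"
  shows "\<Phi> p \<in> irrelevant \<longleftrightarrow> coeff p 0 \<in> max_power 1"
proof
  assume "\<Phi> p \<in> irrelevant"
  then obtain q where "coeff q 0 \<in> max_power 1" "\<Phi> p = \<Phi> q" unfolding irrelevant_def by blast
  then have "coeff p 0 - coeff q 0 \<in> max_power 1" using J_1 unfolding Phi_eq_iff by force
  then have "(coeff p 0 - coeff q 0) + coeff q 0 \<in> max_power 1"
    using \<open>coeff q 0 \<in> max_power 1\<close> max_power_add by blast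
  then show "coeff p 0 \<in> max_power 1" by simp
qed (use assms in \<open>auto simp: irrelevant_def\<close>)

lemma maximalideal_irrelevant: "maximalideal irrelevant G"
proof -
  interpret G: cring G by (rule cring_G)
  have sub: "irrelevant \<subseteq> carrier G" unfolding irrelevant_def carrier_G by blast
  have id: "ideal irrelevant G"
  proof (rule idealI[OF G.ring_axioms])
    show "subgroup irrelevant (add_monoid G)"
    proof (rule G.add.subgroupI)
      show "irrelevant \<noteq> {}" unfolding irrelevant_def using rees_closed(1) max_power_zero by force
      fix u assume "u \<in> irrelevant"
      then obtain p where p: "p \<in> rees" "coeff p 0 \<in> max_power 1" "u = \<Phi> p" unfolding irrelevant_def by blast
      have "\<Phi> (- p) \<oplus>\<^bsub>G\<^esub> u = \<zero>\<^bsub>G\<^esub>"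
        unfolding p(3) G_simps[OF rees_closed(4)[OF p(1)] p(1)] G_zero_one by simp
      then have "\<ominus>\<^bsub>G\<^esub> u = \<Phi> (- p)"
        using p rees_closed(4)[OF p(1)] by (intro G.minus_equality) (auto simp: carrier_G)
      then show "\<ominus>\<^bsub>G\<^esub> u \<in> irrelevant"
        using Phi_irrelevant_iff[OF rees_closed(4)[OF p(1)]] max_power_uminus[OF p(2)] by simp
      fix v assume "v \<in> irrelevant"
      then obtain q where q: "q \<in> rees" "coeff q 0 \<in> max_power 1" "v = \<Phi> q" unfolding irrelevant_def by blast
      show "u \<oplus>\<^bsub>G\<^esub> v \<in> irrelevant"
        unfolding p(3) q(3) G_simps(2)[OF p(1) q(1)] Phi_irrelevant_iff[OF rees_closed(3)[OF p(1) q(1)]]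
        using max_power_add[OF p(2) q(2)] by simp
    qed (use sub in auto)
    fix u x assume "u \<in> irrelevant" "x \<in> carrier G"
    then obtain p q where p: "p \<in> rees" "coeff p 0 \<in> max_power 1" "u = \<Phi> p" and q: "q \<in> rees" "x = \<Phi> q"
      unfolding irrelevant_def carrier_G by blast
    show "x \<otimes>\<^bsub>G\<^esub> u \<in> irrelevant" "u \<otimes>\<^bsub>G\<^esub> x \<in> irrelevant"
      unfolding p(3) q(2) G_simps(1)[OF p(1) q(1)] G_simps(1)[OF q(1) p(1)]
        Phi_irrelevant_iff[OF rees_closed(5)[OF p(1) q(1)]] Phi_irrelevant_iff[OF rees_closed(5)[OF q(1) p(1)]]
      by (simp_all only: coeff_mult_0 max_power_mult_left[OF p(2)] max_power_mult_right[OF p(2)])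
  qed
  show ?thesis
  proof (rule maximalidealI[OF id])
    have "\<Phi> 1 \<notin> irrelevant" unfolding Phi_irrelevant_iff[OF rees_closed(2)] max_power_1_iff
      by (simp add: ps3_coeff_def)
    then show "carrier G \<noteq> irrelevant" unfolding carrier_G using rees_closed(2) by blast
    fix K assume K: "ideal K G" "irrelevant \<subseteq> K" "K \<subseteq> carrier G"
    interpret K: ideal K G by fact
    show "K = irrelevant \<or> K = carrier G"
    proof (rule disjCI)
      assume "K \<noteq> carrier G"
      have "u \<in> irrelevant" if u: "u \<in> K" for u
      proof (rule ccontr)
        assume "u \<notin> irrelevant"
        obtain p where p: "p \<in> rees" "u = \<Phi> p" using u K(3) unfolding carrier_G by blast
        define k where "k = ps3_coeff (coeff p 0) 0 0 0"
        have "k \<noteq> 0" using \<open>u \<notin> irrelevant\<close> Phi_irrelevant_iff[OF p(1)] p(2) unfolding max_power_1_iff k_def by simp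
        \<comment> \<open>Scaling by the inverse of the constant term makes \<open>c * p\<close>
          congruent to 1 modulo the irrelevant ideal, so \<open>K\<close> contains 1.\<close>
        define c where "c = monom (ps3_const (1 / k)) 0"
        have c: "c \<in> rees" unfolding c_def by (rule rees_closed(6)) (rule max_power_0)
        have cp: "c * p \<in> rees" "1 + - (c * p) \<in> rees"
          by (rule rees_closed c p(1))+
        have "coeff (1 + - (c * p)) 0 \<in> max_power 1"
          unfolding max_power_1_iff using \<open>k \<noteq> 0\<close> by (simp add: c_def coeff_mult_0 k_def) (simp add: ps3_coeff_def)
        then have "\<Phi> (1 + - (c * p)) \<in> K" using cp(2) K(2) Phi_irrelevant_iff by blast
        moreover have "\<Phi> (c * p) \<in> K"
          using K.I_l_closed[OF u, of "\<Phi> c"] c unfolding p(2) G_simps(1)[OF c p(1)] carrier_G by blast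
        ultimately have "\<Phi> (1 + - (c * p)) \<oplus>\<^bsub>G\<^esub> \<Phi> (c * p) \<in> K" by (rule K.a_closed)
        then have "\<one>\<^bsub>G\<^esub> \<in> K" unfolding G_simps(2)[OF cp(2,1)] G_zero_one by simp
        then show False using K.one_imp_carrier \<open>K \<noteq> carrier G\<close> by blast
      qed
      then show "K = irrelevant" using K(2) by blast
    qed
  qed
qed

lemma monom_l_power: "monom l 1 ^ n = monom (l ^ n) n"
  by (simp add: monom_power)

text \<open>\<open>S\<close> consists of powers of l times elements outside the irrelevant ideal.
  Zero is not among them because l is not nilpotent, so some prime inside the irrelevant ideal
  misses l.\<close>

lemma prime_height_irrelevant: "1 \<le> prime_height G irrelevant"
proof -
  interpret G: cring G by (rule cring_G)
  interpret M: maximalideal irrelevant G by (rule maximalideal_irrelevant)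
  interpret MP: primeideal irrelevant G by (rule G.maximalideal_prime[OF maximalideal_irrelevant])
  define S where "S = {\<Phi> (monom l 1 ^ n * q) | n q. q \<in> rees \<and> coeff q 0 \<notin> max_power 1}"
  have ml: "monom l 1 ^ n \<in> rees" for n
    unfolding monom_l_power by (rule rees_closed(6)[OF l_power_max_power])
  have one: "coeff (1 :: 'k ps3 poly) 0 \<notin> max_power 1" unfolding max_power_1_iff by (simp add: ps3_coeff_def)
  have SI: "\<Phi> (monom l 1 ^ n * q) \<in> S" if "q \<in> rees" "coeff q 0 \<notin> max_power 1" for n q
    unfolding S_def using that by blast
  have "\<exists>P. primeideal P G \<and> P \<inter> S = {}"
  proof (rule G.exists_primeideal_disjoint)
    show "S \<subseteq> carrier G" unfolding S_def carrier_G using ml rees_closed(5) by blast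
    show "\<one>\<^bsub>G\<^esub> \<in> S" using SI[OF rees_closed(2) one, of 0] by (simp add: G_zero_one)
    show "\<zero>\<^bsub>G\<^esub> \<notin> S"
    proof
      assume "\<zero>\<^bsub>G\<^esub> \<in> S"
      then obtain n q where q: "q \<in> rees" "coeff q 0 \<notin> max_power 1" "\<Phi> (monom l 1 ^ n * q) = \<Phi> 0"
        unfolding S_def G_zero_one by auto
      have "coeff (monom l 1 ^ n * q) n \<in> J (Suc n)" using q(3) unfolding Phi_eq_0_iff by blast
      then have 1: "l ^ n * coeff q 0 \<in> J (Suc n)" unfolding monom_l_power by (simp add: coeff_monom_mult)
      define k where "k = ps3_coeff (coeff q 0) 0 0 0"
      have "k \<noteq> 0" using q(2) unfolding max_power_1_iff k_def .
      \<comment> \<open>Up to positive order \<open>coeff q 0\<close> is the nonzero scalar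
        \<open>k\<close>, so its product with l^n is a zero class only if l^n is.\<close>
      have "coeff q 0 - ps3_const k \<in> max_power 1" unfolding max_power_1_iff by (simp add: k_def ps3_coeff_const)
      from max_power_mult[OF l_power_max_power this] have "l ^ n * (coeff q 0 - ps3_const k) \<in> J (Suc n)"
        using max_power_J by auto
      from J_diff[OF 1 this] have "ps3_const k * l ^ n \<in> J (Suc n)" by (simp add: algebra_simps)
      then show False using ps3_const_cancel[OF \<open>k \<noteq> 0\<close>] l_power_notin by blast
    qed
    fix u v assume "u \<in> S" "v \<in> S"
    then obtain m p n q where pq: "p \<in> rees" "coeff p 0 \<notin> max_power 1" "u = \<Phi> (monom l 1 ^ m * p)"
      "q \<in> rees" "coeff q 0 \<notin> max_power 1" "v = \<Phi> (monom l 1 ^ n * q)" unfolding S_def by blast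
    have "u \<otimes>\<^bsub>G\<^esub> v = \<Phi> ((monom l 1 ^ m * p) * (monom l 1 ^ n * q))"
      unfolding pq(3,6) by (intro G_simps rees_closed(5) ml pq)
    also have "(monom l 1 ^ m * p) * (monom l 1 ^ n * q) = monom l 1 ^ (m + n) * (p * q)"
      by (simp add: power_add mult_ac)
    finally have "u \<otimes>\<^bsub>G\<^esub> v = \<Phi> (monom l 1 ^ (m + n) * (p * q))" .
    moreover have "coeff (p * q) 0 \<notin> max_power 1"
      using pq(2,5) unfolding max_power_1_iff coeff_mult_0 by (simp add: ps3_coeff_mult)
    ultimately show "u \<otimes>\<^bsub>G\<^esub> v \<in> S" using SI[OF rees_closed(5)[OF pq(1,4)]] by simp
  qed
  then obtain P where P: "primeideal P G" "P \<inter> S = {}" by blast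
  interpret P: primeideal P G by fact
  have "P \<subseteq> irrelevant"
  proof
    fix u assume u: "u \<in> P"
    then obtain p where p: "p \<in> rees" "u = \<Phi> p" using P.Icarr unfolding carrier_G by blast
    show "u \<in> irrelevant"
    proof (rule ccontr)
      assume "u \<notin> irrelevant"
      then have "coeff p 0 \<notin> max_power 1" using Phi_irrelevant_iff[OF p(1)] p(2) by blast
      from SI[OF p(1) this, of 0] show False using P(2) u p(2) by auto
    qed
  qed
  moreover have "\<Phi> (monom l 1) \<notin> P" using SI[OF rees_closed(2) one, of 1] P(2) by auto
  moreover have "\<Phi> (monom l 1) \<in> irrelevant"
    using Phi_irrelevant_iff[of "monom l 1"] ml[of 1] by (simp add: max_power_zero)
  ultimately have PM: "P \<subset> irrelevant" by blast
  have "\<exists>p. p 1 = irrelevant \<and> (\<forall>i\<le>1. primeideal (p i) G) \<and> (\<forall>i<(1::nat). p i \<subset> p (Suc i))"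
    by (rule exI[of _ "\<lambda>i. if i = 0 then P else irrelevant"]) (use P PM MP.primeideal in auto)
  then show ?thesis
    unfolding prime_height_def by (intro Sup_upper) (unfold one_enat_def, blast)
qed

lemma inj_if_cohen_macaulay:
  assumes cm: "cohen_macaulay_ring G"
  shows "\<forall>n. inj_at n"
proof (rule ccontr)
  assume "\<not> (\<forall>n. inj_at n)"
  from socle_element[OF this] obtain n a where
    a: "a \<in> max_power n" "a \<notin> J (Suc n)" "\<And>r. r \<in> max_power 1 \<Longrightarrow> r * a \<in> J (n + 2)" by blast
  interpret G: cring G by (rule cring_G)
  have "ideal_depth G irrelevant = prime_height G irrelevant"
    using cm maximalideal_irrelevant unfolding cohen_macaulay_ring_def by blast
  then have d: "1 \<le> ideal_depth G irrelevant" using prime_height_irrelevant by simp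
  have "\<exists>xs. regular_sequence G xs \<and> set xs \<subseteq> irrelevant \<and> xs \<noteq> []"
  proof (rule ccontr)
    assume "\<not> ?thesis"
    then have "ideal_depth G irrelevant \<le> 0" unfolding ideal_depth_def
      by (intro Sup_least) (auto simp: zero_enat_def)
    then show False using d by (metis le_zero_eq zero_neq_one)
  qed
  then obtain u us where reg: "regular_sequence G (u # us)" and u: "u \<in> irrelevant"
    by (metis list.exhaust list.set_intros(1) subset_code(1))
  have "\<forall>i<length (u # us). \<forall>v\<in>carrier G.
      (u # us) ! i \<otimes>\<^bsub>G\<^esub> v \<in> Idl\<^bsub>G\<^esub> (set (take i (u # us))) \<longrightarrow> v \<in> Idl\<^bsub>G\<^esub> (set (take i (u # us)))"
    using reg unfolding regular_sequence_def by blast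
  from this[rule_format, of 0] have nzd: "\<And>v. v \<in> carrier G \<Longrightarrow> u \<otimes>\<^bsub>G\<^esub> v = \<zero>\<^bsub>G\<^esub> \<Longrightarrow> v = \<zero>\<^bsub>G\<^esub>"
    by (simp add: G.genideal_empty)
  obtain p where p: "p \<in> rees" "coeff p 0 \<in> max_power 1" "u = \<Phi> p" using u unfolding irrelevant_def by blast
  \<comment> \<open>The nonzerodivisor may be inhomogeneous, so annihilation of \<open>a\<close> by
    degree 1 is extended to all positive degrees.\<close>
  have pow: "max_power (Suc k) \<subseteq> {r. r * a \<in> J (Suc (n + Suc k))}" for k
  proof (induction k)
    case 0
    then show ?case using a(3) by auto
  next
    case (Suc k)
    show ?case
    proof (rule max_power_Suc_subset[OF Suc.IH])
      show "v + w \<in> {r. r * a \<in> J (Suc (n + Suc (Suc k)))}"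
        if "v \<in> {r. r * a \<in> J (Suc (n + Suc (Suc k)))}" "w \<in> {r. r * a \<in> J (Suc (n + Suc (Suc k)))}" for v w
        using that J_add by (simp add: distrib_right)
      show "r * v \<in> {r. r * a \<in> J (Suc (n + Suc (Suc k)))}"
        if "v \<in> {r. r * a \<in> J (Suc (n + Suc k))}" "r \<in> max_power 1" for v r
        using J_mult[OF that(2), of "v * a"] that(1) by (simp add: mult.assoc)
    qed
  qed
  have m: "monom a n \<in> rees" by (rule rees_closed(6)[OF a(1)])
  have "\<Phi> (p * monom a n) = \<Phi> 0"
    unfolding Phi_eq_0_iff
  proof
    fix t
    consider "t < n" | "t = n" | k where "t = n + Suc k" by (metis less_imp_Suc_add nat_neq_iff add_Suc_right)
    then show "coeff (p * monom a n) t \<in> J (Suc t)"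
    proof cases
      case 1
      then show ?thesis using ps3.subspace_0[OF subspace_J] by (simp add: mult.commute[of p] coeff_monom_mult)
    next
      case 2
      then show ?thesis using a(3)[OF p(2)] J_mono[of "Suc n" "n + 2"]
        by (auto simp: mult.commute[of p] coeff_monom_mult mult.commute[of a])
    next
      case 3
      have "coeff p (Suc k) \<in> max_power (Suc k)" using p(1) by (simp add: rees_def)
      then show ?thesis using pow[of k] 3 by (auto simp: mult.commute[of p] coeff_monom_mult mult.commute[of a])
    qed
  qed
  then have "u \<otimes>\<^bsub>G\<^esub> \<Phi> (monom a n) = \<zero>\<^bsub>G\<^esub>" unfolding p(3) G_simps(1)[OF p(1) m] G_zero_one .
  moreover have "\<Phi> (monom a n) \<in> carrier G" unfolding carrier_G using m by blast
  ultimately have "\<Phi> (monom a n) = \<Phi> 0" using nzd G_zero_one by metis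
  then have "coeff (monom a n) n \<in> J (Suc n)" unfolding Phi_eq_0_iff by blast
  then show False using a(2) by simp
qed

theorem cohen_macaulay_iff_strictly_increasing:
  "cohen_macaulay_ring G \<longleftrightarrow> strictly_increasing_HF (quot_HF I)"
  unfolding quot_HF_eq_hf strictly_increasing_iff_inj
  using cohen_macaulay_if_inj inj_if_cohen_macaulay by blast

end

theorem proposition2p5:
  fixes b :: nat and I :: "'k::{alg_closed_field, field_char_0} ps3 set"
  assumes "2 \<le> b"
    and "ideal_of_type 2 b I"
  shows "cohen_macaulay_ring (assoc_graded_ring (ps3_ring Quot I) (quot_max_ideal I))
     \<longleftrightarrow> strictly_increasing_HF (quot_HF I)"
proof -
  obtain l where l: "transversal_parameter I b l"
    using ideal_of_type_2_transversal_parameter[OF assms(2)] by blast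
  obtain f g where fg: "f \<noteq> 0" "g \<noteq> 0" "I = Idl\<^bsub>ps3_ring\<^esub> {f, g}" "ps3_order f = 2" "ps3_order g = b"
    using assms(2) unfolding ideal_of_type_def by blast
  have I: "I = {u * f + v * g | u v. True}" unfolding fg(3) by (rule ps3_Idl_pair)
  interpret transversal I b l
  proof
    have "0 * f + 0 * g \<in> I" unfolding I by blast
    then show "0 \<in> I" by simp
    show "i + j \<in> I" if ij: "i \<in> I" "j \<in> I" for i j
    proof -
      obtain u v u' v' where "i = u * f + v * g" "j = u' * f + v' * g" using ij unfolding I by blast
      then have "i + j = (u + u') * f + (v + v') * g" by (simp add: algebra_simps)
      then show ?thesis unfolding I by blast
    qed
    show "r * i \<in> I" if i: "i \<in> I" for i r
    proof -
      obtain u v where "i = u * f + v * g" using i unfolding I by blast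
      then have "r * i = (r * u) * f + (r * v) * g" by (simp add: algebra_simps)
      then show ?thesis unfolding I by blast
    qed
    have "f \<in> max_power 1" "g \<in> max_power 1"
      using ps3_order(1)[OF fg(1)] ps3_order(1)[OF fg(2)] fg(4,5) assms(1)
        max_power_mono[of 1 2] max_power_mono[of 1 b] by auto
    then show "I \<subseteq> max_power 1" unfolding I by (auto intro!: max_power_add max_power_mult_left)
  qed (rule l)
  show ?thesis
    using cohen_macaulay_iff_strictly_increasing unfolding G_def A_def mA_def .
qed

end
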